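(* Let $f=\sum_{n=0}^\infty a_nY_n^{-n}$ on $\mathbb{S}^2$. Suppose that for some $\frac34<p<\frac54$ and some constant $C$, $$|a_n|\le\frac{C}{n^p},\qquad|a_n-a_{n-1}|\le\frac{C}{n^{p+1}}\qquad\text{for all }n\ge1.$$ Let $u$ be the solution of $iu_t+\Delta_{\mathbb{S}^2}u=0$, $u(\cdot,0)=f$. Then for almost every $t$, $\dim_t(f)\le\frac{15}4-p$. If, in addition, $f\notin H^{p-\frac12+\epsilon}(\mathbb{S}^2)$ for every $\epsilon>0$, then for almost every $t$, $\dim_t(f)\ge\max\left(\frac{13}4-p,\,2\right)$.
   Context: The Gaussian beams are $Y_n^{-n}(\theta,\phi)=\sqrt{(2n+1)\binom{2n}n}\,2^{-n}\sin^n(\theta)\,e^{-in\phi}$, where $\theta\in[0,\pi]$ is the angle from the north pole and $\phi\in[0,2\pi)$; they are normalized in $L^2$ of $\mathbb S^2$ with normalized surface measure and $\Delta_{\mathbb{S}^2}Y_n^{-n}=-n(n+1)Y_n^{-n}$. $H^r(\mathbb{S}^2)$ has norm $\big(\sum_n\langle n\rangle^{2r}\|\mathrm{proj}_nf\|_{L^2}^2\big)^{1/2}$, with $\mathrm{proj}_n$ the projection onto spherical harmonics of degree $n$ and $\langle n\rangle=(1+n^2)^{1/2}$. The fractal (upper Minkowski) dimension of a bounded set $E$ is $\limsup_{\epsilon\to0}\frac{\log\mathcal N(E,\epsilon)}{\log(1/\epsilon)}$, where $\mathcal N(E,\epsilon)$ is the minimum number of boxes of sidelength $\epsilon$ needed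 to cover $E$. $\dim_t(f)$ denotes the maximum of the fractal dimensions of the graphs of the real and imaginary parts of $u(\cdot,t)$. *)

theory Defs
  imports "HOL-Analysis.Analysis"
begin

abbreviation S2 :: "(real ^ 3) set" where
  "S2 \<equiv> sphere 0 1"

definition sph_point :: "real \<Rightarrow> real \<Rightarrow> real ^ 3" where
  "sph_point \<theta> \<phi> = vector [sin \<theta> * cos \<phi>, sin \<theta> * sin \<phi>, cos \<theta>]"

definition polar_angle :: "real ^ 3 \<Rightarrow> real" where
  "polar_angle x = arccos (x $ 3)"

definition azimuth :: "real ^ 3 \<Rightarrow> real" where
  "azimuth x = Arg2pi (Complex (x $ 1) (x $ 2))"

(* Normalized surface measure sin \<theta> d\<theta> d\<phi> / (4 \<pi>), transported from the angles to S2.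
   Its underlying space is S2, so values of functions off the sphere are irrelevant. *)
definition sphere_measure :: "(real ^ 3) measure" where
  "sphere_measure =
     distr (density lborel
              (\<lambda>(\<theta>, \<phi>). ennreal (indicator ({0..pi} \<times> {0..<2 * pi}) (\<theta>, \<phi>) * sin \<theta> / (4 * pi))))
           (restrict_space borel S2) (\<lambda>(\<theta>, \<phi>). sph_point \<theta> \<phi>)"

(* The beam Y_n^{-n}; at the poles, where the azimuth is immaterial, sin \<theta> = 0. *)
definition gaussian_beam :: "nat \<Rightarrow> real ^ 3 \<Rightarrow> complex" where
  "gaussian_beam n x =
     of_real (sqrt (real ((2 * n + 1) * ((2 * n) choose n))) * (1 / 2) ^ n * sin (polar_angle x) ^ n)
     * exp (- \<i> * of_nat n * of_real (azimuth x))"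

lemma sph_point_polar_azimuth:
  assumes "x \<in> S2"
  shows "sph_point (polar_angle x) (azimuth x) = x"
    and "polar_angle x \<in> {0..pi}" and "azimuth x \<in> {0..<2 * pi}"
proof -
  have n: "(x $ 1)\<^sup>2 + (x $ 2)\<^sup>2 + (x $ 3)\<^sup>2 = 1"
    using assms by (simp add: norm_eq_1 inner_vec_def sum_3 power2_eq_square)
  have z: "\<bar>x $ 3\<bar> \<le> 1"
  proof -
    have "(x $ 3)\<^sup>2 \<le> 1"
      using n zero_le_power2[of "x $ 1"] zero_le_power2[of "x $ 2"] by linarith
    then show ?thesis
      by (simp only: abs_square_le_1)
  qed
  show "polar_angle x \<in> {0..pi}"
    using z arccos_lbound[of "x $ 3"] arccos_ubound[of "x $ 3"] by (auto simp: polar_angle_def)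
  show "azimuth x \<in> {0..<2 * pi}"
    using Arg2pi[of "Complex (x $ 1) (x $ 2)"] by (auto simp: azimuth_def)
  have "1 - (x $ 3)\<^sup>2 = (x $ 1)\<^sup>2 + (x $ 2)\<^sup>2"
    using n by linarith
  then have s: "sin (polar_angle x) = cmod (Complex (x $ 1) (x $ 2))"
    using z by (simp only: polar_angle_def sin_arccos_abs complex_norm)
  have e: "Complex (x $ 1) (x $ 2) = of_real (sin (polar_angle x)) * exp (\<i> * of_real (azimuth x))"
    unfolding s azimuth_def by (rule Arg2pi_eq)
  have "sin (polar_angle x) * cos (azimuth x) = x $ 1"
    using arg_cong[OF e, of Re] by (simp add: Re_exp)
  moreover have "sin (polar_angle x) * sin (azimuth x) = x $ 2"
    using arg_cong[OF e, of Im] by (simp add: Im_exp)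
  moreover have "cos (polar_angle x) = x $ 3"
    using z by (simp only: polar_angle_def cos_arccos_abs)
  ultimately show "sph_point (polar_angle x) (azimuth x) = x"
    by (simp add: sph_point_def vec_eq_iff forall_3)
qed

lemma gaussian_beam_cartesian:
  assumes "x \<in> S2"
  shows "gaussian_beam n x =
     of_real (sqrt (real ((2 * n + 1) * ((2 * n) choose n))) * (1 / 2) ^ n) * Complex (x $ 1) (- (x $ 2)) ^ n"
proof -
  have "of_real (sin (polar_angle x)) * exp (- \<i> * of_real (azimuth x)) = Complex (x $ 1) (- (x $ 2))"
  proof -
    have "sin (polar_angle x) * cos (azimuth x) = x $ 1" "sin (polar_angle x) * sin (azimuth x) = x $ 2"
      using arg_cong[OF sph_point_polar_azimuth(1)[OF assms], of "\<lambda>y. y $ 1"]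
        arg_cong[OF sph_point_polar_azimuth(1)[OF assms], of "\<lambda>y. y $ 2"]
      by (simp_all add: sph_point_def)
    then show ?thesis
      by (simp add: complex_eq_iff Re_exp Im_exp)
  qed
  moreover have "exp (- \<i> * of_nat n * of_real (azimuth x)) = exp (- \<i> * of_real (azimuth x)) ^ n"
    using exp_of_nat_mult[of n "- \<i> * of_real (azimuth x)"] by (simp only: mult_ac)
  ultimately show ?thesis
    by (simp only: gaussian_beam_def of_real_mult of_real_power mult.assoc power_mult_distrib [symmetric])
qed

definition sphere_L2 :: "(real ^ 3 \<Rightarrow> complex) set" where
  "sphere_L2 = {g. g \<in> borel_measurable sphere_measure \<and>
                   integrable sphere_measure (\<lambda>x. (cmod (g x))\<^sup>2)}"

definition sphere_L2_norm :: "(real ^ 3 \<Rightarrow> complex) \<Rightarrow> real" where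
  "sphere_L2_norm g = sqrt (\<integral>x. (cmod (g x))\<^sup>2 \<partial>sphere_measure)"

definition laplacian :: "('a::euclidean_space \<Rightarrow> 'b::real_normed_vector) \<Rightarrow> 'a \<Rightarrow> 'b" where
  "laplacian F x =
     (\<Sum>b\<in>Basis. vector_derivative
        (\<lambda>s. vector_derivative (\<lambda>r. F (x + r *\<^sub>R b)) (at s)) (at 0))"

definition degree0_extension :: "(real ^ 3 \<Rightarrow> complex) \<Rightarrow> real ^ 3 \<Rightarrow> complex" where
  "degree0_extension \<psi> y = \<psi> (y /\<^sub>R norm y)"

(* Laplace-Beltrami operator of the round unit sphere: the radial terms of the Euclidean
   Laplacian vanish on the extension that is constant along rays.
   Only meant for points of S2 and functions that are twice differentiable on S2. *)
definition laplace_beltrami :: "(real ^ 3 \<Rightarrow> complex) \<Rightarrow> real ^ 3 \<Rightarrow> complex" where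
  "laplace_beltrami \<psi> x = laplacian (degree0_extension \<psi>) x"

(* k times continuously differentiable on an open set S. *)
primrec Ck_on :: "nat \<Rightarrow> ('a::euclidean_space \<Rightarrow> 'b::real_normed_vector) \<Rightarrow> 'a set \<Rightarrow> bool" where
  "Ck_on 0 F S = continuous_on S F"
| "Ck_on (Suc k) F S =
     (\<exists>F'. (\<forall>x\<in>S. (F has_derivative F' x) (at x)) \<and> (\<forall>v. Ck_on k (\<lambda>x. F' x v) S))"

definition smooth_on_sphere :: "(real ^ 3 \<Rightarrow> complex) \<Rightarrow> bool" where
  "smooth_on_sphere \<psi> \<longleftrightarrow> (\<forall>k. Ck_on k (degree0_extension \<psi>) (- {0}))"

(* Spherical harmonics of degree n, represented by the homogeneous harmonic polynomials on
   real ^ 3 whose restrictions to S2 they are; such a polynomial is determined by its restriction. *)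
definition spherical_harmonics :: "nat \<Rightarrow> (real ^ 3 \<Rightarrow> complex) set" where
  "spherical_harmonics n =
     {h. polynomial_function h \<and> (\<forall>c x. h (c *\<^sub>R x) = c ^ n *\<^sub>R h x) \<and> (\<forall>x. laplacian h x = 0)}"

definition sphere_proj :: "nat \<Rightarrow> (real ^ 3 \<Rightarrow> complex) \<Rightarrow> real ^ 3 \<Rightarrow> complex" where
  "sphere_proj n f =
     (THE h. h \<in> spherical_harmonics n \<and>
        (\<forall>k\<in>spherical_harmonics n. (\<integral>x. (f x - h x) * cnj (k x) \<partial>sphere_measure) = 0))"

(* H^r for r \<ge> 0, where it consists of L2 functions. *)
definition sphere_sobolev :: "real \<Rightarrow> (real ^ 3 \<Rightarrow> complex) set" where
  "sphere_sobolev r =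
     {f \<in> sphere_L2. summable (\<lambda>n. sqrt (1 + (real n)\<^sup>2) powr (2 * r) * (sphere_L2_norm (sphere_proj n f))\<^sup>2)}"

(* u t x stands for u(x,t). For data in L2 the Schroedinger equation i u_t + \<Delta> u = 0 is understood
   in the usual sense: u is continuous in time with values in L2 and satisfies the equation
   in the sense of distributions on the sphere, at every time. *)
definition schroedinger_solution :: "(real ^ 3 \<Rightarrow> complex) \<Rightarrow> (real \<Rightarrow> real ^ 3 \<Rightarrow> complex) \<Rightarrow> bool" where
  "schroedinger_solution f u \<longleftrightarrow>
     (\<forall>t. u t \<in> sphere_L2) \<and>
     (\<forall>t. ((\<lambda>s. sphere_L2_norm (\<lambda>x. u s x - u t x)) \<longlongrightarrow> 0) (at t)) \<and>
     (AE x in sphere_measure. u 0 x = f x) \<and>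
     (\<forall>\<psi> t. smooth_on_sphere \<psi> \<longrightarrow>
        (\<exists>D. ((\<lambda>s. \<integral>x. u s x * \<psi> x \<partial>sphere_measure) has_vector_derivative D) (at t) \<and>
             \<i> * D + (\<integral>x. u t x * laplace_beltrami \<psi> x \<partial>sphere_measure) = 0))"

(* Boxes are closed axis-parallel cubes of side \<epsilon>, indexed by their lower corners. *)
definition covering_number :: "'a::euclidean_space set \<Rightarrow> real \<Rightarrow> nat" where
  "covering_number E \<epsilon> =
     Inf {card A | A. finite A \<and> E \<subseteq> (\<Union>c\<in>A. cbox c (c + \<epsilon> *\<^sub>R One))}"

definition fractal_dim :: "'a::euclidean_space set \<Rightarrow> ereal" where
  "fractal_dim E =
     Limsup (at_right 0) (\<lambda>\<epsilon>. ereal (ln (real (covering_number E \<epsilon>)) / ln (1 / \<epsilon>)))"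

definition sphere_graph :: "(real ^ 3 \<Rightarrow> real) \<Rightarrow> ((real ^ 3) \<times> real) set" where
  "sphere_graph g = (\<lambda>x. (x, g x)) ` S2"

definition graph_dim :: "(real ^ 3 \<Rightarrow> complex) \<Rightarrow> ereal" where
  "graph_dim v = max (fractal_dim (sphere_graph (\<lambda>x. Re (v x)))) (fractal_dim (sphere_graph (\<lambda>x. Im (v x))))"

(* An element of L2 is only defined almost everywhere, so its graph is that of its continuous
   representative, which is unique on S2. *)
definition continuous_version :: "(real ^ 3 \<Rightarrow> complex) \<Rightarrow> (real ^ 3 \<Rightarrow> complex) \<Rightarrow> bool" where
  "continuous_version g v \<longleftrightarrow> continuous_on S2 v \<and> (AE x in sphere_measure. g x = v x)"

end

(* The beams are multiples of w^n restricted to the sphere, where w = x_1 - i x_2, so the solution at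
   time t is the restriction of the power series F_t(w) with coefficients b_n cis(-t n (n + 1)), where
   b_n is of size n^(1/4 - p) and of bounded variation on that scale.  In the van der Corput
   differencing of the Weyl sum of cis(-t n (n + 1)) w^n the argument of w drops out after taking
   moduli, and the geometric sums that remain are controlled, for almost every t, by the convergence
   of the series over h of h^(-1-d) |sin(h t)|^(d-1).  Hence the Weyl sums have square root
   cancellation uniformly in w, and by summation by parts the dyadic blocks of F_t at frequency N are
   O(N^(3/4 - p + d)).  This gives Hoelder continuity of every order below p - 3/4 and the upper bound.

   For the lower bound, on each horizontal circle at height |z| of order at most N^(-1/2) the radius to
   the power N is bounded below.  Pairing the difference of two shifts of F_t along the circle with
   the dyadic block itself isolates the energy of the block, which has to be large for infinitely many
   N when f is not in the Sobolev space; the block is bounded in sup norm, so the shift differences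
   are large in L^1, and these differences are dominated by the heights of the boxes covering the
   graph.

   The solution is identified through its moments against the monomials, which satisfy linear
   differential equations in t; Stone-Weierstrass shows that they determine it. *)

theory Submission
  imports Defs
begin

section \<open>Weyl sums at almost every time\<close>

text \<open>At lag h the geometric sum is at most 1 / |sin (h t)|, which is not integrable in t.
  Interpolation with the trivial bound L gives L^d |sin (h t)|^(d - 1), which is integrable over a
  period. This makes averaging over t sufficient, without Diophantine properties of t, and keeps the
  exceptional null set independent of the data. Put q = p - 1/4 and disregard small powers. A block
  at frequency N has size N^(1/2 - q), so the Hoelder exponent is q - 1/2 and the graph has
  dimension at most 3 - (q - 1/2). In the other direction a slice with block energy E = N^(1 - 2 q)
  and block size B = N^(1/2 - q) needs about N^2 E / B boxes of side 1 / N. Beams of degree N live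
  in a band of width N^(-1/2) about the equator, so only about sqrt N slices at mutual distance 2 /
  N contribute, and the total is N^(3 - q). The narrow band is the reason for the gap of 1/2 between
  the two exponents. The energy is large only for infinitely many N, which an upper Minkowski
  dimension tolerates.\<close>

lemma norm_sum_correlations:
  fixes e :: "nat \<Rightarrow> complex"
  shows "of_real ((cmod (\<Sum>m<L. e m))\<^sup>2) =
     (\<Sum>m<L. of_real ((cmod (e m))\<^sup>2)) +
     (\<Sum>h\<in>{1..<L}. (\<Sum>m<L-h. e (m+h) * cnj (e m)) + cnj (\<Sum>m<L-h. e (m+h) * cnj (e m)))"
proof (induction L)
  case 0
  then show ?case by simp
next
  case (Suc L)
  define S where "S = (\<Sum>m<L. e m)"
  define X where "X = (\<lambda>L h. (\<Sum>m<L-h. e (m+h) * cnj (e m)))"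
  \<comment> \<open>Lengthening the sum adds exactly one term to each correlation; by
    \<open>2\<close> these terms assemble to e L times the conjugate of the old sum.\<close>
  have 1: "X (Suc L) h = X L h + e L * cnj (e (L - h))" if "h \<in> {1..<Suc L}" for h
    using that by (simp add: X_def Suc_diff_le)
  have 2: "(\<Sum>h\<in>{1..<Suc L}. e L * cnj (e (L - h))) = e L * cnj S"
    unfolding S_def cnj_sum sum_distrib_left
    by (rule sum.reindex_bij_witness[of _ "\<lambda>m. L - m" "\<lambda>m. L - m"]) auto
  \<comment> \<open>The new lag h = L contributes an empty sum.\<close>
  have 3: "(\<Sum>h\<in>{1..<Suc L}. X L h + cnj (X L h)) = (\<Sum>h\<in>{1..<L}. X L h + cnj (X L h))"
    by (cases "L = 0") (simp_all add: X_def sum.atLeastLessThan_Suc)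
  have "(\<Sum>h\<in>{1..<Suc L}. X (Suc L) h + cnj (X (Suc L) h))
      = (\<Sum>h\<in>{1..<Suc L}. (X L h + cnj (X L h)) + (e L * cnj (e (L - h)) + cnj (e L * cnj (e (L - h)))))"
    by (intro sum.cong refl) (simp add: 1)
  also have "\<dots> = (\<Sum>h\<in>{1..<L}. X L h + cnj (X L h)) + (e L * cnj S + cnj (e L * cnj S))"
    unfolding sum.distrib[of "\<lambda>h. X L h + cnj (X L h)"] 3 sum.distrib[of "\<lambda>h. e L * cnj (e (L - h))"]
      cnj_sum[symmetric] 2 ..
  finally have X: "(\<Sum>h\<in>{1..<Suc L}. X (Suc L) h + cnj (X (Suc L) h)) =
     (\<Sum>h\<in>{1..<L}. X L h + cnj (X L h)) + (e L * cnj S + cnj (e L * cnj S))" .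
  have "of_real ((cmod (\<Sum>m<Suc L. e m))\<^sup>2) = (S + e L) * cnj (S + e L)"
    by (simp only: complex_norm_square S_def sum.lessThan_Suc)
  also have "\<dots> = S * cnj S + e L * cnj (e L) + (e L * cnj S + cnj (e L * cnj S))"
    by (simp add: algebra_simps)
  finally show ?case
    using Suc.IH X by (simp add: X_def S_def complex_norm_square flip: of_real_power)
qed

text \<open>Weyl differencing with all lags kept: no cutoff in h is chosen, since for almost every t
  one convergent series controls the lags together.\<close>

lemma norm_sum_correlations_le:
  fixes e :: "nat \<Rightarrow> complex"
  shows "(cmod (\<Sum>m<L. e m))\<^sup>2 \<le>
     (\<Sum>m<L. (cmod (e m))\<^sup>2) + 2 * (\<Sum>h\<in>{1..<L}. cmod (\<Sum>m<L-h. e (m+h) * cnj (e m)))"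
proof -
  define X where "X = (\<lambda>h. (\<Sum>m<L-h. e (m+h) * cnj (e m)))"
  have "of_real ((cmod (\<Sum>m<L. e m))\<^sup>2) =
     (\<Sum>m<L. of_real ((cmod (e m))\<^sup>2)) + (\<Sum>h\<in>{1..<L}. X h + cnj (X h))"
    unfolding X_def by (rule norm_sum_correlations)
  from arg_cong[OF this, of Re]
  have "(cmod (\<Sum>m<L. e m))\<^sup>2 = (\<Sum>m<L. (cmod (e m))\<^sup>2) + (\<Sum>h\<in>{1..<L}. 2 * Re (X h))"
    by (simp only: Re_complex_of_real Re_sum plus_complex.sel cnj.sel mult_2)
  also have "\<dots> \<le> (\<Sum>m<L. (cmod (e m))\<^sup>2) + (\<Sum>h\<in>{1..<L}. 2 * cmod (X h))"
    by (intro add_left_mono sum_mono mult_left_mono complex_Re_le_cmod) auto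
  finally show ?thesis by (simp add: X_def sum_distrib_left)
qed

lemma cmod_one_minus_cis: "cmod (1 - cis (- 2 * x)) = 2 * \<bar>sin x\<bar>"
proof -
  have "(1 - cos (2 * x))\<^sup>2 + (sin (2 * x))\<^sup>2 = (2 * (sin x)\<^sup>2)\<^sup>2 + 4 * (sin x)\<^sup>2 * (cos x)\<^sup>2"
    unfolding cos_double_sin sin_double by (simp add: power_mult_distrib)
  also have "\<dots> = (2 * \<bar>sin x\<bar>)\<^sup>2"
    unfolding cos_squared_eq by (simp add: power_mult_distrib algebra_simps flip: power_add)
  finally have "(1 - cos (2 * x))\<^sup>2 + (sin (2 * x))\<^sup>2 = (2 * \<bar>sin x\<bar>)\<^sup>2" .
  then show ?thesis by (simp add: cmod_def real_sqrt_mult)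
qed

lemma geometric_cis_bound:
  assumes "sin x \<noteq> 0"
  shows "cmod (\<Sum>m<n. cis (- 2 * x) ^ m) \<le> 1 / \<bar>sin x\<bar>"
proof -
  have ne: "cis (- 2 * x) \<noteq> 1" using cmod_one_minus_cis[of x] assms by auto
  have "cmod (\<Sum>m<n. cis (- 2 * x) ^ m) = cmod (1 - cis (- 2 * x) ^ n) / (2 * \<bar>sin x\<bar>)"
    using ne by (simp only: sum_gp_strict if_False norm_divide cmod_one_minus_cis)
  also have "\<dots> \<le> 2 / (2 * \<bar>sin x\<bar>)"
    using norm_triangle_ineq4[of 1 "cis (- 2 * x) ^ n"]
    by (intro divide_right_mono) (auto simp: norm_power)
  finally show ?thesis by simp
qed

definition weyl_phase :: "real \<Rightarrow> nat \<Rightarrow> complex" where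
  "weyl_phase t n = cis (- t * (real n * (real n + 1)))"

lemma norm_weyl_phase [simp]: "cmod (weyl_phase t n) = 1"
  by (simp add: weyl_phase_def)

text \<open>Differencing at lag h turns the quadratic phase into one that is linear in m with step 2
  h t. The offset M and the argument of w enter only through unimodular factors, so the constant
  depends on t and d alone.\<close>

lemma weyl_sum_bound:
  assumes d: "0 < d" "d < 1" and w: "cmod w = 1"
    and s: "\<And>h. h \<ge> 1 \<Longrightarrow> sin (real h * t) \<noteq> 0"
    and E: "summable (\<lambda>h. real (Suc h) powr (-1-d) * \<bar>sin (real (Suc h) * t)\<bar> powr (d-1))"
  shows "cmod (\<Sum>m<L. weyl_phase t (M+m) * w ^ (M+m))
     \<le> sqrt (1 + 2 * (\<Sum>h. real (Suc h) powr (-1-d) * \<bar>sin (real (Suc h) * t)\<bar> powr (d-1))) * real L powr (1/2 + d)"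
proof (cases "L = 0")
  case False
  define e where "e = (\<lambda>m. weyl_phase t (M+m) * w ^ (M+m))"
  define g where "g = (\<lambda>h. \<bar>sin (real h * t)\<bar> powr (d-1))"
  define S where "S = (\<Sum>h. real (Suc h) powr (-1-d) * \<bar>sin (real (Suc h) * t)\<bar> powr (d-1))"
  have ne: "cmod (e m) = 1" for m by (simp add: e_def norm_mult norm_power w)
  have L1: "real L \<ge> 1" using False by simp
  have corr: "cmod (\<Sum>m<L-h. e (m+h) * cnj (e m)) \<le> real L powr d * g h" if "h \<in> {1..<L}" for h
  proof -
    have eq: "e (m+h) * cnj (e m) = (cis (- t * (2 * real M * h + h * h + h)) * w ^ h) * cis (-2 * (h * t)) ^ m" for m
    proof -
      have ww: "w ^ (M + (m + h)) * cnj (w ^ (M+m)) = w ^ h"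
      proof -
        have "w ^ (M + (m + h)) * cnj (w ^ (M+m)) = w ^ h * (w ^ (M+m) * cnj (w ^ (M+m)))"
          by (simp add: power_add mult_ac)
        also have "w ^ (M+m) * cnj (w ^ (M+m)) = of_real ((cmod (w ^ (M+m)))\<^sup>2)"
          by (simp only: complex_norm_square)
        finally show ?thesis by (simp add: norm_power w)
      qed
      have "e (m+h) * cnj (e m) = (weyl_phase t (M+(m+h)) * cnj (weyl_phase t (M+m))) * (w ^ (M + (m + h)) * cnj (w ^ (M+m)))"
        by (simp add: e_def mult_ac)
      also have "weyl_phase t (M+(m+h)) * cnj (weyl_phase t (M+m)) =
          cis (- t * (2 * real M * h + h * h + h)) * cis (-2 * (h * t)) ^ m"
        unfolding weyl_phase_def cis_cnj Complex.DeMoivre cis_mult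
        by (rule arg_cong[where f = cis]) (simp add: algebra_simps)
      finally show ?thesis unfolding ww by (simp add: mult_ac)
    qed
    define Y where "Y = cmod (\<Sum>m<L-h. e (m+h) * cnj (e m))"
    have Y: "Y = cmod (\<Sum>m<L-h. cis (-2 * (h * t)) ^ m)"
      unfolding Y_def eq sum_distrib_left[symmetric] by (simp add: norm_mult norm_power w)
    have sh: "sin (h * t) \<noteq> 0" using that s by simp
    have Y1: "Y \<le> 1 / \<bar>sin (h * t)\<bar>" unfolding Y by (rule geometric_cis_bound[OF sh])
    have "Y \<le> (\<Sum>m<L-h. 1)" unfolding Y by (rule sum_norm_le) (simp add: norm_power)
    then have Y2: "Y \<le> real L" by simp
    have Y0: "Y \<ge> 0" by (simp add: Y_def)
    \<comment> \<open>Interpolation between the trivial bound L and the geometric bound, so that the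
      remaining power of the sine is integrable in t.\<close>
    have "Y = Y powr d * Y powr (1-d)" using Y0 by (simp flip: powr_add)
    also have "\<dots> \<le> real L powr d * (1 / \<bar>sin (h * t)\<bar>) powr (1-d)"
      using d Y0 Y1 Y2 by (intro mult_mono powr_mono2) auto
    also have "(1 / \<bar>sin (h * t)\<bar>) powr (1-d) = g h"
      using powr_minus_divide[of "\<bar>sin (h * t)\<bar>" "1-d"] by (simp add: g_def powr_divide)
    finally show ?thesis unfolding Y_def .
  qed
  have "(\<Sum>h\<in>{1..<L}. g h) \<le> (\<Sum>h\<in>{1..<L}. real L powr (1+d) * (real h powr (-1-d) * g h))"
  proof (rule sum_mono)
    fix h assume h: "h \<in> {1..<L}"
    \<comment> \<open>As h < L, the weight h^(-1-d) of the series is restored at the price of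
      L^(1+d).\<close>
    have "1 = real h powr (1+d) * real h powr (-1-d)" using h by (simp flip: powr_add)
    also have "\<dots> \<le> real L powr (1+d) * real h powr (-1-d)"
      using h d by (intro mult_right_mono powr_mono2) auto
    finally have "1 * g h \<le> (real L powr (1+d) * real h powr (-1-d)) * g h"
      by (rule mult_right_mono) (simp add: g_def)
    then show "g h \<le> real L powr (1+d) * (real h powr (-1-d) * g h)" by (simp add: mult_ac)
  qed
  also have "\<dots> = real L powr (1+d) * (\<Sum>h\<in>{1..<L}. real h powr (-1-d) * g h)"
    by (simp add: sum_distrib_left)
  also have "(\<Sum>h\<in>{1..<L}. real h powr (-1-d) * g h) = (\<Sum>h<L-1. real (Suc h) powr (-1-d) * g (Suc h))"
    by (rule sum.reindex_bij_witness[of _ Suc "\<lambda>h. h - 1"]) auto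
  also have "\<dots> \<le> S"
    unfolding S_def g_def by (rule sum_le_suminf[OF E]) auto
  finally have G: "(\<Sum>h\<in>{1..<L}. g h) \<le> real L powr (1+d) * S"
    by (simp add: mult_left_mono)
  have S0: "S \<ge> 0" unfolding S_def by (rule suminf_nonneg[OF E]) simp
  have "(cmod (\<Sum>m<L. e m))\<^sup>2 \<le> (\<Sum>m<L. 1) + 2 * (\<Sum>h\<in>{1..<L}. real L powr d * g h)"
  proof -
    have "(\<Sum>h\<in>{1..<L}. cmod (\<Sum>m<L-h. e (m+h) * cnj (e m))) \<le> (\<Sum>h\<in>{1..<L}. real L powr d * g h)"
      by (rule sum_mono[OF corr])
    then show ?thesis using norm_sum_correlations_le[of e L] by (simp add: ne)
  qed
  also have "\<dots> = real L powr 1 + 2 * real L powr d * (\<Sum>h\<in>{1..<L}. g h)"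
    using False by (simp add: sum_distrib_left mult_ac)
  also have "\<dots> \<le> real L powr (1 + 2*d) + 2 * real L powr d * (real L powr (1+d) * S)"
    using G d L1 by (intro add_mono powr_mono mult_left_mono) auto
  also have "\<dots> = (1 + 2 * S) * real L powr (1 + 2*d)"
    by (simp add: algebra_simps flip: powr_add)
  also have "\<dots> = (sqrt (1 + 2 * S) * real L powr (1/2 + d))\<^sup>2"
    using S0 False by (simp add: power_mult_distrib powr_power algebra_simps)
  finally show ?thesis
    using S0 unfolding e_def S_def[symmetric] by (intro power2_le_imp_le[of "cmod _"]) auto
qed simp

section \<open>Averages of negative powers of the sine\<close>

lemma sin_ge_linear:
  assumes "0 \<le> x" "x \<le> pi / 2"
  shows "2 / pi * x \<le> sin x"
proof -
  have "concave_on {0..pi} sin"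
    by (rule f''_le0_imp_concave[where f' = cos and f'' = "\<lambda>x. - sin x"])
      (auto intro!: derivative_eq_intros sin_ge_zero)
  \<comment> \<open>Jordan's inequality: a concave function lies above its chord, here the one from
    0 to pi / 2.\<close>
  then have "sin ((1 - 2 / pi * x) *\<^sub>R 0 + (2 / pi * x) *\<^sub>R (pi / 2)) \<ge> (1 - 2 / pi * x) * sin 0 + (2 / pi * x) * sin (pi / 2)"
    using assms by (intro concave_onD) (auto simp: field_simps)
  then show ?thesis by simp
qed

text \<open>Near 0 Jordan's inequality compares the integrand with a multiple of x^(d - 1),
  integrable because d > 0; the reflection pi - x treats the other half of the period.\<close>

lemma nn_integral_sin_powr_finite:
  assumes d: "0 < d" "d < 1"
  shows "(\<integral>\<^sup>+x. ennreal (\<bar>sin x\<bar> powr (d-1)) * indicator {0..pi} x \<partial>lborel) < \<infinity>"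
proof -
  define f where "f = (\<lambda>x::real. indicator {0..pi} x * (2 / pi * x) powr (d-1))"
  have f[measurable]: "f \<in> borel_measurable borel" unfolding f_def by measurable
  have "((\<lambda>x. x powr (d-1)) has_integral (pi powr (d-1+1) / (d-1+1))) {0..pi}"
    using d by (intro has_integral_powr_from_0) auto
  then have "((\<lambda>x. (2 / pi) powr (d-1) * x powr (d-1)) has_integral ((2/pi) powr (d-1) * (pi powr (d-1+1) / (d-1+1)))) {0..pi}"
    by (rule has_integral_mult_right)
  then have "((\<lambda>x. if x \<in> {0..pi} then (2 / pi) powr (d-1) * x powr (d-1) else 0) has_integral ((2/pi) powr (d-1) * (pi powr (d-1+1) / (d-1+1)))) UNIV"
    by (simp only: has_integral_restrict_UNIV)
  also have "(\<lambda>x. if x \<in> {0..pi} then (2 / pi) powr (d-1) * x powr (d-1) else 0) = f"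
    by (auto simp: f_def fun_eq_iff powr_mult powr_divide)
  finally have "integral\<^sup>N lborel f = ennreal ((2/pi) powr (d-1) * (pi powr (d-1+1) / (d-1+1)))"
    by (intro nn_integral_has_integral_lborel) (auto simp: f_def)
  then have fin: "integral\<^sup>N lborel f < \<infinity>" by simp
  have "integral\<^sup>N lborel f = ennreal \<bar>-1\<bar> * integral\<^sup>N lborel (\<lambda>x. f (pi + (-1) * x))"
    using nn_integral_real_affine[of "\<lambda>x. ennreal (f x)" "-1" pi] by simp
  then have fin2: "integral\<^sup>N lborel (\<lambda>x. f (pi - x)) < \<infinity>" using fin by simp
  have le: "ennreal (\<bar>sin x\<bar> powr (d-1)) * indicator {0..pi} x \<le> ennreal (f x) + ennreal (f (pi - x))" for x
  proof (cases "x \<in> {0..pi}")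
    case True
    have aux: "\<bar>sin x\<bar> powr (d-1) \<le> (2 / pi * x) powr (d-1)" if "0 \<le> x" "x \<le> pi / 2" for x
    \<comment> \<open>At x = 0 both sides are \<open>0 powr (d - 1)\<close>, which is 0.\<close>
    proof (cases "x = 0")
      case False
      then have "0 < 2 / pi * x" using that by simp
      moreover have "2 / pi * x \<le> sin x" by (rule sin_ge_linear[OF that])
      ultimately show ?thesis using d by (intro powr_mono2') auto
    qed (use d in auto)
    have "\<bar>sin x\<bar> powr (d-1) \<le> f x + f (pi - x)"
    proof (cases "x \<le> pi / 2")
      case True
      have "f (pi - x) \<ge> 0" "f x = (2 / pi * x) powr (d-1)" using \<open>x \<in> {0..pi}\<close> by (auto simp: f_def)
      then show ?thesis using aux[of x] True \<open>x \<in> {0..pi}\<close> by auto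
    next
      case False
      have "f x \<ge> 0" "f (pi - x) = (2 / pi * (pi - x)) powr (d-1)" using \<open>x \<in> {0..pi}\<close> by (auto simp: f_def)
      then show ?thesis using aux[of "pi - x"] False \<open>x \<in> {0..pi}\<close> by auto
    qed
    then show ?thesis using True by (simp add: f_def flip: ennreal_plus)
  qed auto
  have "(\<integral>\<^sup>+x. ennreal (\<bar>sin x\<bar> powr (d-1)) * indicator {0..pi} x \<partial>lborel) \<le> (\<integral>\<^sup>+x. ennreal (f x) + ennreal (f (pi - x)) \<partial>lborel)"
    by (intro nn_integral_mono le)
  also have "\<dots> = (\<integral>\<^sup>+x. ennreal (f x) \<partial>lborel) + (\<integral>\<^sup>+x. ennreal (f (pi - x)) \<partial>lborel)"
    by (intro nn_integral_add) auto
  also have "\<dots> < \<infinity>" using fin fin2 by (simp add: less_top)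
  finally show ?thesis .
qed

lemma abs_sin_add_int_pi: "\<bar>sin (of_int k * pi + x)\<bar> = \<bar>sin x\<bar>"
proof -
  have "sin (of_int k * pi) = 0" by (auto simp: sin_zero_iff_int2)
  then show ?thesis using sin_zero_abs_cos_one[of "of_int k * pi"] by (simp add: sin_add abs_mult)
qed

text \<open>Only an inequality is claimed, so the endpoints shared by consecutive closed periods may
  be counted twice.\<close>

lemma nn_integral_sin_powr_periods:
  fixes k :: int and n :: nat
  shows "(\<integral>\<^sup>+x. ennreal (\<bar>sin x\<bar> powr (d-1)) * indicator {of_int k * pi..(of_int k + real n) * pi} x \<partial>lborel)
    \<le> of_nat n * (\<integral>\<^sup>+x. ennreal (\<bar>sin x\<bar> powr (d-1)) * indicator {0..pi} x \<partial>lborel)" (is "?I n \<le> of_nat n * ?G")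
proof (induction n)
  case 0
  have "{of_int k * pi} \<in> null_sets lborel" by (intro countable_imp_null_set_lborel) simp
  then have "(\<integral>\<^sup>+x. ennreal (\<bar>sin x\<bar> powr (d-1)) * indicator {of_int k * pi} x \<partial>lborel) = 0"
    by (rule nn_integral_null_set)
  then show ?case by simp
next
  case (Suc n)
  let ?g = "\<lambda>x. ennreal (\<bar>sin x\<bar> powr (d-1))"
  define a where "a = of_int k * pi"
  define c where "c = of_int (k + int n) * pi"
  have c: "(of_int k + real n) * pi = c" "(of_int k + real (Suc n)) * pi = c + pi" "a \<le> c"
    by (simp_all add: c_def a_def algebra_simps)
  have "?I (Suc n) \<le> (\<integral>\<^sup>+x. ?g x * indicator {a..c} x + ?g x * indicator {c..c + pi} x \<partial>lborel)"
    unfolding a_def[symmetric] c(2) using c(3) by (intro nn_integral_mono) (auto simp: indicator_def c(2) simp del: of_nat_Suc)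
  also have "\<dots> = (\<integral>\<^sup>+x. ?g x * indicator {a..c} x \<partial>lborel) + (\<integral>\<^sup>+x. ?g x * indicator {c..c + pi} x \<partial>lborel)"
    by (intro nn_integral_add) auto
  also have "(\<integral>\<^sup>+x. ?g x * indicator {a..c} x \<partial>lborel) = ?I n" unfolding c a_def ..
  also have "(\<integral>\<^sup>+x. ?g x * indicator {c..c + pi} x \<partial>lborel)
      = (\<integral>\<^sup>+x. ?g (c + x) * indicator {c..c + pi} (c + x) \<partial>lborel)"
    by (subst nn_integral_real_affine[where c = 1 and t = c]) auto
  also have "\<dots> = ?G"
    unfolding c_def abs_sin_add_int_pi by (intro nn_integral_cong) (auto simp: indicator_def)
  finally have "?I (Suc n) \<le> ?I n + ?G" .
  also have "\<dots> \<le> of_nat n * ?G + ?G" by (rule add_right_mono[OF Suc.IH])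
  also have "\<dots> = of_nat (Suc n) * ?G" by (simp add: algebra_simps)
  finally show ?case .
qed

text \<open>Tonelli on each interval [m pi, (m + 1) pi]: under the substitution x = H t it becomes H
  periods with Jacobian 1 / H, so the integral of |sin (H t)|^(d - 1) has the same bound G for every
  H, and the weights H^(-1-d) are summable. Countably many such intervals cover the line.\<close>

lemma AE_summable_sin_powr:
  assumes d: "0 < d" "d < 1"
  shows "AE t in lborel. summable (\<lambda>h. real (Suc h) powr (-1-d) * \<bar>sin (real (Suc h) * t)\<bar> powr (d-1))"
proof -
  define G where "G = (\<integral>\<^sup>+x. ennreal (\<bar>sin x\<bar> powr (d-1)) * indicator {0..pi} x \<partial>lborel)"
  have G: "G < \<infinity>" unfolding G_def by (rule nn_integral_sin_powr_finite[OF d])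
  define c where "c = (\<lambda>h. real (Suc h) powr (-1-d))"
  define g where "g = (\<lambda>h t. c h * \<bar>sin (real (Suc h) * t)\<bar> powr (d-1))"
  have [measurable]: "g h \<in> borel_measurable lborel" for h unfolding g_def by measurable
  have sc: "summable c"
  proof -
    have "summable (\<lambda>n. real n powr (-1-d))" using d by (simp add: summable_real_powr_iff)
    then show ?thesis unfolding c_def by (subst summable_Suc_iff)
  qed
  have piece: "AE t in lborel. t \<in> {of_int m * pi..(of_int m + 1) * pi} \<longrightarrow> summable (\<lambda>h. g h t)" for m :: int
  proof -
    let ?A = "{of_int m * pi..(of_int m + 1) * pi}"
    have one: "(\<integral>\<^sup>+t. ennreal (g h t) * indicator ?A t \<partial>lborel) \<le> ennreal (c h) * G" for h
    proof -
      define H where "H = real (Suc h)"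
      define J where "J = (\<integral>\<^sup>+t. ennreal (\<bar>sin (H * t)\<bar> powr (d-1)) * indicator ?A t \<partial>lborel)"
      have H0: "H > 0" by (simp add: H_def)
      have Hi: "H = real_of_int (1 + int h)" by (simp add: H_def)
      have "ennreal H * J = (\<integral>\<^sup>+x. ennreal (\<bar>sin x\<bar> powr (d-1)) * indicator {of_int ((1 + int h) * m) * pi..(of_int ((1 + int h) * m) + real (Suc h)) * pi} x \<partial>lborel)"
      proof (subst nn_integral_real_affine[where c = H and t = 0])
        have *: "indicator {of_int ((1 + int h) * m) * pi..(of_int ((1 + int h) * m) + real (Suc h)) * pi} (0 + H * t) = (indicator ?A t :: ennreal)" for t
        proof -
          have "of_int ((1 + int h) * m) * pi = H * (of_int m * pi)" by (simp add: Hi)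
          moreover have "(of_int ((1 + int h) * m) + real (Suc h)) * pi = H * ((of_int m + 1) * pi)" by (simp add: Hi algebra_simps)
          moreover have "0 + H * t \<in> {H * a..H * b} \<longleftrightarrow> t \<in> {a..b}" for a b
            using H0 by simp
          ultimately show ?thesis by (simp only: indicator_def)
        qed
        show "ennreal H * J = ennreal \<bar>H\<bar> * (\<integral>\<^sup>+t. ennreal (\<bar>sin (0 + H * t)\<bar> powr (d-1)) * indicator {of_int ((1 + int h) * m) * pi..(of_int ((1 + int h) * m) + real (Suc h)) * pi} (0 + H * t) \<partial>lborel)"
          unfolding * using H0 by (simp add: J_def)
      qed (use H0 in auto)
      also have "\<dots> \<le> of_nat (Suc h) * G"
        unfolding G_def by (rule nn_integral_sin_powr_periods)
      also have "\<dots> = ennreal H * G" by (simp add: H_def ennreal_of_nat_eq_real_of_nat)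
      finally have "J \<le> G" using H0 by (subst (asm) ennreal_mult_le_mult_iff) auto
      have "(\<integral>\<^sup>+t. ennreal (g h t) * indicator ?A t \<partial>lborel) = (\<integral>\<^sup>+t. ennreal (c h) * (ennreal (\<bar>sin (H * t)\<bar> powr (d-1)) * indicator ?A t) \<partial>lborel)"
        by (intro nn_integral_cong) (simp add: g_def H_def c_def ennreal_mult mult.assoc)
      also have "\<dots> = ennreal (c h) * J" unfolding J_def by (rule nn_integral_cmult) measurable
      finally show ?thesis using \<open>J \<le> G\<close> by (simp add: mult_left_mono)
    qed
    have "(\<integral>\<^sup>+t. (\<Sum>h. ennreal (g h t) * indicator ?A t) \<partial>lborel) = (\<Sum>h. \<integral>\<^sup>+t. ennreal (g h t) * indicator ?A t \<partial>lborel)"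
      by (intro nn_integral_suminf) measurable
    also have "\<dots> \<le> (\<Sum>h. ennreal (c h) * G)" by (intro suminf_le one) auto
    also have "\<dots> = (\<Sum>h. ennreal (c h)) * G" by simp
    also have "(\<Sum>h. ennreal (c h)) = ennreal (\<Sum>h. c h)" by (rule suminf_ennreal2[OF _ sc]) (simp add: c_def)
    also have "ennreal (\<Sum>h. c h) * G < \<infinity>" using G by (simp add: ennreal_mult_less_top)
    finally have "AE t in lborel. (\<Sum>h. ennreal (g h t) * indicator ?A t) \<noteq> \<infinity>"
      by (intro nn_integral_noteq_infinite) auto
    then show ?thesis
    proof eventually_elim
      case (elim t)
      show ?case
      proof
        assume "t \<in> ?A"
        then show "summable (\<lambda>h. g h t)"
          using elim by (intro summable_suminf_not_top) (auto simp: g_def c_def)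
      qed
    qed
  qed
  have "AE t in lborel. \<forall>m::int. t \<in> {of_int m * pi..(of_int m + 1) * pi} \<longrightarrow> summable (\<lambda>h. g h t)"
    unfolding AE_all_countable using piece by blast
  then show ?thesis
  proof eventually_elim
    case (elim t)
    have "t \<in> {of_int \<lfloor>t / pi\<rfloor> * pi..(of_int \<lfloor>t / pi\<rfloor> + 1) * pi}"
      using floor_divide_lower[of pi t] floor_divide_upper[of pi t] by auto
    then show ?case using elim by (auto simp: g_def c_def)
  qed
qed

text \<open>To have the quantifier over d inside the null set, only the countably many values 1 / (j
  + 2) are used; a larger d follows by monotonicity in the exponent, since L \<ge> 1 or the sum is
  empty.\<close>

theorem AE_weyl_sum_bound:
  "AE t in lborel. \<forall>d>0. \<exists>K\<ge>0. \<forall>M L w. cmod w = 1 \<longrightarrow>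
     cmod (\<Sum>m<L. weyl_phase t (M+m) * w ^ (M+m)) \<le> K * real L powr (1/2 + d)"
proof -
  have 1: "AE t in lborel. \<forall>j. summable (\<lambda>h. real (Suc h) powr (-1-inverse (real (Suc (Suc j)))) * \<bar>sin (real (Suc h) * t)\<bar> powr (inverse (real (Suc (Suc j)))-1))"
    unfolding AE_all_countable by (intro allI AE_summable_sin_powr) (simp_all add: inverse_less_1_iff)
  \<comment> \<open>Where sin (h t) = 0, the convention that \<open>0 powr (d - 1)\<close> is 0
    hides the singularity from the series, so rational multiples of pi are removed
    separately.\<close>
  have 2: "AE t in lborel. t \<notin> (\<Union>h\<in>{1::nat..}. \<Union>k::int. {of_int k * pi / real h})"
    by (intro AE_not_in countable_imp_null_set_lborel countable_UN) auto
  from 1 2 show ?thesis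
  proof eventually_elim
    case (elim t)
    have s: "sin (real h * t) \<noteq> 0" if "h \<ge> 1" for h
    proof
      assume "sin (real h * t) = 0"
      then obtain k :: int where "real h * t = of_int k * pi" by (auto simp: sin_zero_iff_int2)
      then have "t = of_int k * pi / real h" using that by (simp add: field_simps)
      then show False using elim(2) that by auto
    qed
    show ?case
    proof (intro allI impI)
      fix d :: real assume "d > 0"
      then obtain j where j: "inverse (real (Suc j)) < d" using reals_Archimedean by blast
      define d' where "d' = inverse (real (Suc (Suc j)))"
      have "d' \<le> inverse (real (Suc j))" unfolding d'_def by (rule le_imp_inverse_le) auto
      then have "d' \<le> d" using j by linarith
      then have d': "0 < d'" "d' < 1" "d' \<le> d" by (auto simp: d'_def inverse_less_1_iff)
      define K where "K = sqrt (1 + 2 * (\<Sum>h. real (Suc h) powr (-1-d') * \<bar>sin (real (Suc h) * t)\<bar> powr (d'-1)))"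
      have E: "summable (\<lambda>h. real (Suc h) powr (-1-d') * \<bar>sin (real (Suc h) * t)\<bar> powr (d'-1))"
        using elim(1) unfolding d'_def by blast
      have K0: "K \<ge> 0" unfolding K_def by (intro real_sqrt_ge_zero add_nonneg_nonneg mult_nonneg_nonneg suminf_nonneg[OF E]) auto
      have "cmod (\<Sum>m<L. weyl_phase t (M+m) * w ^ (M+m)) \<le> K * real L powr (1/2 + d)" if "cmod w = 1" for M L w
      proof -
        have "cmod (\<Sum>m<L. weyl_phase t (M+m) * w ^ (M+m)) \<le> K * real L powr (1/2 + d')"
          unfolding K_def by (rule weyl_sum_bound[OF d'(1,2) that s E])
        also have "\<dots> \<le> K * real L powr (1/2 + d)"
        proof (cases "L = 0")
          case False
          then show ?thesis using d' K0 by (intro mult_left_mono powr_mono) auto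
        qed simp
        finally show ?thesis .
      qed
      then show "\<exists>K\<ge>0. \<forall>M L w. cmod w = 1 \<longrightarrow> cmod (\<Sum>m<L. weyl_phase t (M+m) * w ^ (M+m)) \<le> K * real L powr (1/2 + d)"
        using K0 by blast
    qed
  qed
qed

section \<open>Dyadic decomposition of power series\<close>

lemma summation_by_parts:
  fixes c e :: "nat \<Rightarrow> complex"
  shows "(\<Sum>m<Suc L. c m * e m) = c L * (\<Sum>m<Suc L. e m) - (\<Sum>m<L. (c (Suc m) - c m) * (\<Sum>k<Suc m. e k))"
proof (induction L)
  case (Suc L)
  have "(\<Sum>m<Suc (Suc L). c m * e m) = c L * (\<Sum>m<Suc L. e m) - (\<Sum>m<L. (c (Suc m) - c m) * (\<Sum>k<Suc m. e k)) + c (Suc L) * e (Suc L)"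
    using Suc.IH by simp
  then show ?case by (simp add: algebra_simps)
qed simp

lemma summation_by_parts_variation_bound:
  fixes c e :: "nat \<Rightarrow> complex"
  assumes B: "\<And>l. l \<le> Suc L \<Longrightarrow> cmod (\<Sum>m<l. e m) \<le> B"
  shows "cmod (\<Sum>m<Suc L. c m * e m) \<le> B * (cmod (c L) + (\<Sum>m<L. cmod (c (Suc m) - c m)))"
proof -
  have "cmod (\<Sum>m<Suc L. c m * e m) \<le> cmod (c L * (\<Sum>m<Suc L. e m)) + cmod (\<Sum>m<L. (c (Suc m) - c m) * (\<Sum>k<Suc m. e k))"
    unfolding summation_by_parts by (rule norm_triangle_ineq4)
  also have "\<dots> \<le> cmod (c L) * B + (\<Sum>m<L. cmod (c (Suc m) - c m) * B)"
    unfolding norm_mult by (intro add_mono mult_left_mono B order.trans[OF norm_sum] sum_mono) (auto simp: norm_mult simp del: sum.lessThan_Suc intro!: mult_left_mono B)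
  finally show ?thesis by (simp add: algebra_simps sum_distrib_left sum_distrib_right)
qed

lemma summation_by_parts_bound:
  fixes c e :: "nat \<Rightarrow> complex"
  assumes B: "\<And>l. l \<le> L \<Longrightarrow> cmod (\<Sum>m<l. e m) \<le> B"
    and X: "\<And>m. m < L \<Longrightarrow> cmod (c m) \<le> X" "0 \<le> X"
    and Y: "\<And>m. Suc m < L \<Longrightarrow> cmod (c (Suc m) - c m) \<le> Y" "0 \<le> Y"
  shows "cmod (\<Sum>m<L. c m * e m) \<le> B * (X + real L * Y)"
proof (cases L)
  case 0
  then show ?thesis using B[of 0] X Y by simp
next
  case (Suc l)
  have B0: "0 \<le> B" using B[of 0] by simp
  have "cmod (\<Sum>m<L. c m * e m) \<le> B * (cmod (c l) + (\<Sum>m<l. cmod (c (Suc m) - c m)))"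
    unfolding Suc by (rule summation_by_parts_variation_bound) (use B Suc in auto)
  also have "(\<Sum>m<l. cmod (c (Suc m) - c m)) \<le> (\<Sum>m<l. Y)" by (intro sum_mono Y) (use Suc in auto)
  also have "\<dots> \<le> real L * Y" using Suc Y by (simp add: mult_right_mono)
  also have "cmod (c l) \<le> X" using X Suc by simp
  finally show ?thesis using B0 by (simp add: mult_left_mono)
qed

text \<open>The moduli of the powers of a point of the disc decrease, so summation by parts carries a
  bound from the circle to the disc.\<close>

lemma power_sum_bound_disc:
  fixes x :: "nat \<Rightarrow> complex"
  assumes B: "\<And>w l. cmod w = 1 \<Longrightarrow> l \<le> L \<Longrightarrow> cmod (\<Sum>m<l. x m * w ^ (N+m)) \<le> B"
    and z: "cmod z \<le> 1"
  shows "cmod (\<Sum>m<L. x m * z ^ (N+m)) \<le> B"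
proof (cases L)
  case 0
  then show ?thesis using B[of 1 0] by simp
next
  case (Suc l)
  define w where "w = (if z = 0 then 1 else sgn z)"
  define r where "r = cmod z"
  have B0: "0 \<le> B" using B[of 1 0] by simp
  have w: "cmod w = 1" by (simp add: w_def norm_sgn)
  have zw: "z = of_real r * w" by (simp add: w_def r_def sgn_eq)
  have "(\<Sum>m<Suc l. x m * z ^ (N+m)) = (\<Sum>m<Suc l. of_real (r ^ (N+m)) * (x m * w ^ (N+m)))"
    unfolding zw power_mult_distrib of_real_power by (intro sum.cong refl) (simp add: mult_ac)
  also have "cmod \<dots> \<le> B * (cmod (of_real (r ^ (N+l))) + (\<Sum>m<l. cmod (of_real (r ^ (N+Suc m)) - of_real (r ^ (N+m)))))"
    by (rule summation_by_parts_variation_bound) (use B w Suc in auto)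
  also have "(\<Sum>m<l. cmod (of_real (r ^ (N+Suc m)) - of_real (r ^ (N+m)))) = (\<Sum>m<l. r ^ (N+m) - r ^ (N+Suc m))"
  proof (intro sum.cong refl)
    fix m
    have "r ^ (N + Suc m) \<le> r ^ (N+m)" using z by (intro power_decreasing) (auto simp: r_def)
    then show "cmod (of_real (r ^ (N+Suc m)) - of_real (r ^ (N+m))) = r ^ (N+m) - r ^ (N+Suc m)"
      unfolding of_real_diff[symmetric] norm_of_real by simp
  qed
  also have "\<dots> = r ^ N - r ^ (N+l)"
    by (induction l) simp_all
  also have "cmod (of_real (r ^ (N+l))) = r ^ (N+l)" by (simp add: r_def norm_power)
  \<comment> \<open>For a decreasing sequence the last value and the total variation add up to the
    first value, so the constant B is not enlarged.\<close>
  also have "B * (r ^ (N+l) + (r ^ N - r ^ (N+l))) = B * r ^ N" by simp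
  also have "\<dots> \<le> B * 1" using B0 z by (intro mult_left_mono power_le_one) (auto simp: r_def)
  finally show ?thesis using Suc by simp
qed

text \<open>Over a block of N terms b changes by at most N times C N^(-q-1), which is of the order
  of its size C N^(-q); hence summation by parts costs only a constant. The Lipschitz bound is the
  same argument for the derivative, whose coefficients n b n are larger by one power of N.\<close>

lemma weyl_block_bounds:
  fixes b :: "nat \<Rightarrow> complex"
  assumes q: "0 < q" and C: "0 \<le> C" and K: "0 \<le> K" and d: "0 < d"
    and b1: "\<And>n. n \<ge> 1 \<Longrightarrow> cmod (b n) \<le> C * real n powr (-q)"
    and b2: "\<And>n. n \<ge> 1 \<Longrightarrow> cmod (b (Suc n) - b n) \<le> C * real n powr (-q-1)"
    and W: "\<And>M L w. cmod w = 1 \<Longrightarrow> cmod (\<Sum>m<L. weyl_phase t (M+m) * w ^ (M+m)) \<le> K * real L powr (1/2 + d)"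
    and N: "N \<ge> 1"
  shows weyl_block_bound: "cmod z \<le> 1 \<Longrightarrow> cmod (\<Sum>n\<in>{N..<2*N}. (b n * weyl_phase t n) * z ^ n) \<le> 2 * K * C * real N powr (1/2 + d - q)"
    and weyl_block_lipschitz: "cmod z \<le> 1 \<Longrightarrow> cmod z' \<le> 1 \<Longrightarrow>
      cmod ((\<Sum>n\<in>{N..<2*N}. (b n * weyl_phase t n) * z ^ n) - (\<Sum>n\<in>{N..<2*N}. (b n * weyl_phase t n) * z' ^ n))
        \<le> 5 * K * C * (real N * real N powr (1/2 + d - q)) * cmod (z - z')"
proof -
  have shift: "(\<Sum>n\<in>{N..<2*N}. f n) = (\<Sum>m<N. f (N+m))" for f :: "nat \<Rightarrow> complex"
    by (rule sum.reindex_bij_witness[of _ "\<lambda>m. N + m" "\<lambda>n. n - N"]) auto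
  have N0: "real N > 0" using N by simp
  have b1': "cmod (b (N+m)) \<le> C * real N powr (-q)" for m
    using b1[of "N+m"] N C q by (intro order.trans[OF b1] mult_left_mono powr_mono2') auto
  have b2': "cmod (b (Suc (N+m)) - b (N+m)) \<le> C * real N powr (-q-1)" for m
    using N C q by (intro order.trans[OF b2] mult_left_mono powr_mono2') auto
  have W': "cmod (\<Sum>m<l. weyl_phase t (N+m) * w ^ (N+m)) \<le> K * real N powr (1/2 + d)" if "cmod w = 1" "l \<le> N" for w l
    using W[OF that(1), of N l] that(2) K d by (elim order.trans) (intro mult_left_mono powr_mono2, auto)
  have pw: "real N * real N powr (-q-1) = real N powr (-q)"
    using N0 by (simp add: powr_diff)
  show "cmod (\<Sum>n\<in>{N..<2*N}. (b n * weyl_phase t n) * z ^ n) \<le> 2 * K * C * real N powr (1/2 + d - q)"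
    if z: "cmod z \<le> 1" for z
  proof -
    have "cmod (\<Sum>m<N. (b (N+m) * weyl_phase t (N+m)) * z ^ (N+m)) \<le> K * real N powr (1/2 + d) * (C * real N powr (-q) + real N * (C * real N powr (-q-1)))"
    proof (rule power_sum_bound_disc[OF _ z])
      fix w l assume w: "cmod w = 1" "l \<le> N"
      have "cmod (\<Sum>m<l. b (N+m) * (weyl_phase t (N+m) * w ^ (N+m))) \<le> K * real N powr (1/2 + d) * (C * real N powr (-q) + real l * (C * real N powr (-q-1)))"
        by (rule summation_by_parts_bound) (use W' w b1' b2' C in auto)
      also have "\<dots> \<le> K * real N powr (1/2 + d) * (C * real N powr (-q) + real N * (C * real N powr (-q-1)))"
        using w K C by (intro mult_left_mono add_left_mono mult_right_mono) auto
      finally show "cmod (\<Sum>m<l. b (N+m) * weyl_phase t (N+m) * w ^ (N+m)) \<le> K * real N powr (1/2 + d) * (C * real N powr (-q) + real N * (C * real N powr (-q-1)))"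
        by (simp add: mult.assoc)
    qed
    also have "\<dots> = 2 * K * C * (real N powr (1/2 + d) * real N powr (-q))"
      using pw by (simp add: mult.left_commute[of "real N"] algebra_simps)
    also have "real N powr (1/2 + d) * real N powr (-q) = real N powr (1/2 + d - q)"
      by (simp flip: powr_add)
    finally show ?thesis unfolding shift .
  qed
  let ?D = "\<lambda>z. (\<Sum>m<N. (b (N+m) * weyl_phase t (N+m)) * z ^ (N+m))"
  let ?D' = "\<lambda>z. (\<Sum>m<N. (of_nat (N+m) * b (N+m) * weyl_phase t (N+m)) * z ^ ((N-1)+m))"
  have D': "cmod (?D' z) \<le> 5 * K * C * (real N * real N powr (1/2 + d - q))" if z: "cmod z \<le> 1" for z
  proof -
    have "cmod (?D' z) \<le> K * real N powr (1/2 + d) * (2 * real N * (C * real N powr (-q)) + real N * (3 * C * real N powr (-q)))"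
    proof (rule power_sum_bound_disc[OF _ z])
      fix w l assume w: "cmod w = 1" "l \<le> N"
      have c1: "cmod (of_nat (N+m) * b (N+m)) \<le> 2 * real N * (C * real N powr (-q))" if "m < l" for m
        unfolding norm_mult norm_of_nat using that w b1'[of m] N0 by (intro mult_mono) auto
      \<comment> \<open>Product rule for differences: 2 comes from n + 1 \<le> 2 n and 1 from the
        term b n. With the 2 of \<open>c1\<close> this gives the factor 5.\<close>
      have c2: "cmod (of_nat (N+Suc m) * b (N+Suc m) - of_nat (N+m) * b (N+m)) \<le> 3 * C * real N powr (-q)" for m
      proof -
        let ?n = "N + m"
        have n: "?n \<ge> 1" using N by simp
        have "of_nat (N+Suc m) * b (N+Suc m) - of_nat (N+m) * b (N+m) = of_nat (Suc ?n) * (b (Suc ?n) - b ?n) + b ?n"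
          by (simp add: algebra_simps)
        also have "cmod \<dots> \<le> real (Suc ?n) * cmod (b (Suc ?n) - b ?n) + cmod (b ?n)"
          by (rule order.trans[OF norm_triangle_ineq]) (simp only: norm_mult norm_of_nat order_refl)
        also have "\<dots> \<le> (2 * real ?n) * (C * real ?n powr (-q-1)) + C * real ?n powr (-q)"
          using n C by (intro add_mono mult_mono b1 b2) auto
        also have "\<dots> = 2 * C * (real ?n * real ?n powr (-q-1)) + C * real ?n powr (-q)" by (simp only: mult_ac)
        also have "real ?n * real ?n powr (-q-1) = real ?n powr (-q)" using N by (simp add: powr_diff)
        also have "2 * C * real ?n powr (-q) + C * real ?n powr (-q) = 3 * C * real ?n powr (-q)" by simp
        also have "\<dots> \<le> 3 * C * real N powr (-q)"
          using N C q by (intro mult_left_mono powr_mono2') auto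
        finally show ?thesis .
      qed
      \<comment> \<open>On the circle a factor w is free, and it shifts the exponents N - 1 + m of
        the derivative to the exponents N + m of the Weyl sum.\<close>
      have weq: "w * (\<Sum>m<l. (of_nat (N+m) * b (N+m) * weyl_phase t (N+m)) * w ^ ((N-1)+m)) = (\<Sum>m<l. (of_nat (N+m) * b (N+m)) * (weyl_phase t (N+m) * w ^ (N+m)))"
        unfolding sum_distrib_left
      proof (intro sum.cong refl)
        fix m
        have "w ^ (N+m) = w * w ^ ((N-1)+m)" using N by (simp flip: power_Suc)
        then show "w * ((of_nat (N+m) * b (N+m) * weyl_phase t (N+m)) * w ^ ((N-1)+m)) = (of_nat (N+m) * b (N+m)) * (weyl_phase t (N+m) * w ^ (N+m))"
          by (simp add: mult_ac)
      qed
      have "cmod (\<Sum>m<l. (of_nat (N+m) * b (N+m) * weyl_phase t (N+m)) * w ^ ((N-1)+m)) = cmod (\<Sum>m<l. (of_nat (N+m) * b (N+m)) * (weyl_phase t (N+m) * w ^ (N+m)))"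
        unfolding weq[symmetric] norm_mult[of w] using w by simp
      also have "\<dots> \<le> K * real N powr (1/2 + d) * (2 * real N * (C * real N powr (-q)) + real l * (3 * C * real N powr (-q)))"
        by (rule summation_by_parts_bound) (use W' w c1 c2 C in auto)
      also have "\<dots> \<le> K * real N powr (1/2 + d) * (2 * real N * (C * real N powr (-q)) + real N * (3 * C * real N powr (-q)))"
        using w K C by (intro mult_left_mono add_left_mono mult_right_mono) auto
      finally show "cmod (\<Sum>m<l. (of_nat (N+m) * b (N+m) * weyl_phase t (N+m)) * w ^ ((N-1)+m)) \<le> \<dots>" .
    qed
    also have "\<dots> = 5 * K * C * (real N * (real N powr (1/2 + d) * real N powr (-q)))"
      by (simp add: algebra_simps)
    also have "real N powr (1/2 + d) * real N powr (-q) = real N powr (1/2 + d - q)"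
      by (simp flip: powr_add)
    finally show ?thesis .
  qed
  show "cmod ((\<Sum>n\<in>{N..<2*N}. (b n * weyl_phase t n) * z ^ n) - (\<Sum>n\<in>{N..<2*N}. (b n * weyl_phase t n) * z' ^ n))
        \<le> 5 * K * C * (real N * real N powr (1/2 + d - q)) * cmod (z - z')"
    if z: "cmod z \<le> 1" "cmod z' \<le> 1" for z z'
    unfolding shift
  proof (rule field_differentiable_bound[of "cball 0 1" ?D ?D'])
    show "(?D has_field_derivative ?D' z) (at z within cball 0 1)" if "z \<in> cball 0 1" for z
    proof (rule DERIV_sum)
      fix m
      show "((\<lambda>z. (b (N+m) * weyl_phase t (N+m)) * z ^ (N+m)) has_field_derivative (of_nat (N+m) * b (N+m) * weyl_phase t (N+m)) * z ^ ((N-1)+m)) (at z within cball 0 1)"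
      proof -
        have e: "N + m - Suc 0 = (N - 1) + m" using N by simp
        have "((\<lambda>z. z ^ (N+m)) has_field_derivative of_nat (N+m) * z ^ (N + m - Suc 0)) (at z within cball 0 1)"
          by (auto intro!: derivative_eq_intros)
        from DERIV_cmult[OF this, of "b (N+m) * weyl_phase t (N+m)"] show ?thesis
          unfolding e by (simp only: mult_ac)
      qed
    qed
  qed (use z D' in auto)
qed

section \<open>Hoelder continuity from dyadic blocks\<close>

definition dyadic_block :: "(nat \<Rightarrow> complex) \<Rightarrow> nat \<Rightarrow> complex \<Rightarrow> complex" where
  "dyadic_block \<beta> j z = (\<Sum>n\<in>{2^j..<2 * 2^j}. \<beta> n * z ^ n)"

text \<open>Summed by blocks because the cancellation is known for blocks only; on the unit circle
  the terms need not be absolutely summable.\<close>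

definition dyadic_series :: "(nat \<Rightarrow> complex) \<Rightarrow> complex \<Rightarrow> complex" where
  "dyadic_series \<beta> z = \<beta> 0 + (\<Sum>j. dyadic_block \<beta> j z)"

lemma sum_dyadic:
  fixes g :: "nat \<Rightarrow> 'a::comm_monoid_add"
  shows "(\<Sum>n<2^J. g n) = g 0 + (\<Sum>j<J. \<Sum>n\<in>{2^j..<2 * 2^j}. g n)"
proof (induction J)
  case (Suc J)
  have U: "{..<2^Suc J} = {..<2^J} \<union> {2^J..<2 * 2^J::nat}" by (subst ivl_disj_un) auto
  have "(\<Sum>n<2^Suc J. g n) = (\<Sum>n<2^J. g n) + (\<Sum>n\<in>{2^J..<2 * 2^J}. g n)"
    unfolding U by (rule sum.union_disjoint) (simp_all add: ivl_disj_int)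
  then show ?case using Suc.IH by (simp add: add.assoc)
qed (simp add: lessThan_Suc)

lemma sum_dyadic_blocks: "(\<Sum>n<2^J. \<beta> n * z ^ n) = \<beta> 0 + (\<Sum>j<J. dyadic_block \<beta> j z)"
  using sum_dyadic[of "\<lambda>n. \<beta> n * z ^ n" J] by (simp add: dyadic_block_def)

lemma weyl_dyadic_bounds:
  fixes b :: "nat \<Rightarrow> complex"
  assumes q: "0 < q" and C: "0 \<le> C" and d: "0 < d"
    and b1: "\<And>n. n \<ge> 1 \<Longrightarrow> cmod (b n) \<le> C * real n powr (-q)"
    and b2: "\<And>n. n \<ge> 1 \<Longrightarrow> cmod (b (Suc n) - b n) \<le> C * real n powr (-q-1)"
    and W: "\<forall>d>0. \<exists>K\<ge>0. \<forall>M L w. cmod w = 1 \<longrightarrow> cmod (\<Sum>m<L. weyl_phase t (M+m) * w ^ (M+m)) \<le> K * real L powr (1/2 + d)"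
  obtains A where "A \<ge> 0" "\<And>j z. cmod z \<le> 1 \<Longrightarrow> cmod (dyadic_block (\<lambda>n. b n * weyl_phase t n) j z) \<le> A * (2 powr (1/2 + d - q)) ^ j"
    "\<And>j z z'. cmod z \<le> 1 \<Longrightarrow> cmod z' \<le> 1 \<Longrightarrow> cmod (dyadic_block (\<lambda>n. b n * weyl_phase t n) j z - dyadic_block (\<lambda>n. b n * weyl_phase t n) j z') \<le> A * (2 * 2 powr (1/2 + d - q)) ^ j * cmod (z - z')"
proof -
  obtain K where K: "K \<ge> 0" "\<And>M L w. cmod w = 1 \<Longrightarrow> cmod (\<Sum>m<L. weyl_phase t (M+m) * w ^ (M+m)) \<le> K * real L powr (1/2 + d)"
    using W d by blast
  have p: "real (2^j) powr s = (2 powr s) ^ j" for j s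
    by (simp add: powr_realpow[symmetric] powr_powr mult.commute)
  have KC: "0 \<le> K * C" using K C by simp
  show thesis
  proof (rule that)
    show "0 \<le> 5 * K * C" using KC by (simp add: mult.assoc)
    fix j :: nat
    have N: "(2::nat) ^ j \<ge> 1" by simp

    show "cmod (dyadic_block (\<lambda>n. b n * weyl_phase t n) j z) \<le> 5 * K * C * (2 powr (1/2 + d - q)) ^ j" if "cmod z \<le> 1" for z
    proof -
      have "cmod (dyadic_block (\<lambda>n. b n * weyl_phase t n) j z) \<le> 2 * K * C * (2 powr (1/2 + d - q)) ^ j"
        unfolding dyadic_block_def p[symmetric]
        by (rule weyl_block_bound) (fact q C K(1) d b1 b2 K(2) N that)+
      also have "\<dots> \<le> 5 * K * C * (2 powr (1/2 + d - q)) ^ j"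
        using K(1) C by (intro mult_right_mono) auto
      finally show ?thesis .
    qed
    show "cmod (dyadic_block (\<lambda>n. b n * weyl_phase t n) j z - dyadic_block (\<lambda>n. b n * weyl_phase t n) j z') \<le> 5 * K * C * (2 * 2 powr (1/2 + d - q)) ^ j * cmod (z - z')"
      if "cmod z \<le> 1" "cmod z' \<le> 1" for z z'
    proof -
      have e: "(2 * 2 powr (1/2 + d - q)) ^ j = real (2 ^ j) * real (2 ^ j) powr (1/2 + d - q)"
        unfolding p by (simp add: power_mult_distrib)
      show ?thesis
        unfolding dyadic_block_def e
        by (rule weyl_block_lipschitz) (fact q C K(1) d b1 b2 K(2) N that)+
    qed
  qed
qed

text \<open>Write y = 2^(-\<alpha>), with 0 < \<alpha> < 1. For two points at distance about 2^(-J)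
  the blocks j < J use the Lipschitz bound, a geometric sum dominated by its end because 2 y > 1;
  the remaining blocks use the size bound, dominated by its beginning because y < 1. Both parts are
  of order y^J, that is 2^(-\<alpha> J).\<close>

lemma dyadic_series_properties:
  assumes y: "1/2 < y" "y < 1" and A: "A \<ge> 0"
    and D1: "\<And>j z. cmod z \<le> 1 \<Longrightarrow> cmod (dyadic_block \<beta> j z) \<le> A * y ^ j"
    and D2: "\<And>j z z'. cmod z \<le> 1 \<Longrightarrow> cmod z' \<le> 1 \<Longrightarrow> cmod (dyadic_block \<beta> j z - dyadic_block \<beta> j z') \<le> A * (2 * y) ^ j * cmod (z - z')"
  shows dyadic_series_remainder: "cmod z \<le> 1 \<Longrightarrow> cmod (dyadic_series \<beta> z - (\<Sum>n<2^J. \<beta> n * z ^ n)) \<le> A / (1 - y) * y ^ J"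
    and dyadic_series_hoelder: "\<exists>H\<ge>0. \<forall>z z'. cmod z \<le> 1 \<longrightarrow> cmod z' \<le> 1 \<longrightarrow> cmod (dyadic_series \<beta> z - dyadic_series \<beta> z') \<le> H * cmod (z - z') powr (- log 2 y)"
proof -
  let ?D = "dyadic_block \<beta>"
  have sg: "summable (\<lambda>j. A * y ^ j)" using y by (intro summable_mult summable_geometric) auto
  have rem: "cmod (dyadic_series \<beta> z - (\<Sum>n<2^J. \<beta> n * z ^ n)) \<le> A / (1 - y) * y ^ J" if z: "cmod z \<le> 1" for z J
  proof -
    have sD: "summable (\<lambda>j. ?D j z)" by (rule summable_comparison_test'[OF sg]) (rule D1[OF z])
    have "dyadic_series \<beta> z - (\<Sum>n<2^J. \<beta> n * z ^ n) = (\<Sum>j. ?D (j + J) z)"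
      unfolding sum_dyadic_blocks dyadic_series_def using suminf_split_initial_segment[OF sD, of J] by simp
    also have "cmod \<dots> \<le> (\<Sum>j. A * y ^ J * y ^ j)"
    proof (rule norm_suminf_le)
      show "cmod (?D (n + J) z) \<le> A * y ^ J * y ^ n" for n
        using D1[OF z, of "n + J"] by (simp add: power_add mult_ac)
    qed (use y in \<open>intro summable_mult summable_geometric; auto\<close>)
    also have "\<dots> = A * y ^ J * (1 / (1 - y))"
      using y by (subst suminf_mult) (auto intro: summable_geometric simp: suminf_geometric)
    finally show ?thesis by simp
  qed
  show "cmod z \<le> 1 \<Longrightarrow> cmod (dyadic_series \<beta> z - (\<Sum>n<2^J. \<beta> n * z ^ n)) \<le> A / (1 - y) * y ^ J"
    by (rule rem)
  define \<alpha> where "\<alpha> = - log 2 y"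
  have ya: "y = 2 powr (-\<alpha>)" using y by (simp add: \<alpha>_def)
  have a0: "\<alpha> > 0" using y by (simp add: \<alpha>_def)
  define H where "H = (A / (2 * y - 1) + 2 * (A / (1 - y))) * 2 powr \<alpha>"
  have H0: "H \<ge> 0" using A y by (simp add: H_def)
  have "cmod (dyadic_series \<beta> z - dyadic_series \<beta> z') \<le> H * cmod (z - z') powr \<alpha>" if z: "cmod z \<le> 1" "cmod z' \<le> 1" for z z'
  proof (cases "z = z'")
    case False
    define h where "h = cmod (z - z')"
    have h0: "h > 0" using False by (simp add: h_def)
    have "\<exists>J. (1/2) ^ Suc J < h"
    proof -
      obtain n where "(1/2) ^ n < h" using h0 real_arch_pow_inv[of h "1/2"] by auto
      moreover have "(1/2::real) ^ Suc n \<le> (1/2) ^ n" by simp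
      ultimately show ?thesis by (meson le_less_trans)
    qed
    \<comment> \<open>J is the dyadic scale of h. For h > 1/2 it is 0, where \<open>J2\<close> says
      nothing and the sum over j < J is empty.\<close>
    define J where "J = (LEAST J. (1/2) ^ Suc J < h)"
    have J1: "(1/2) ^ Suc J < h" unfolding J_def by (rule LeastI_ex) fact
    have J2: "h \<le> (1/2) ^ J" if pos: "J > 0"
    proof -
      obtain J' where "J = Suc J'" using pos gr0_implies_Suc by blast
      then have "\<not> (1/2) ^ Suc J' < h" using not_less_Least[of J' "\<lambda>J. (1/2) ^ Suc J < h"] unfolding J_def by simp
      then show ?thesis using \<open>J = Suc J'\<close> by simp
    qed
    have yJ: "y ^ J \<le> 2 powr \<alpha> * h powr \<alpha>"
    proof -
      have "y ^ J = (2 * (1/2) ^ Suc J) powr \<alpha>"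
      proof -
        have "2 * (1/2::real) ^ Suc J = 2 powr (- real J)"
          by (simp add: powr_minus powr_realpow power_one_over inverse_eq_divide)
        moreover have "(2 powr (-\<alpha>)) ^ J = 2 powr (-\<alpha> * real J)"
          by (simp add: powr_power mult.commute)
        ultimately show ?thesis unfolding ya by (simp only: powr_powr) (simp add: mult.commute)
      qed
      also have "\<dots> \<le> (2 * h) powr \<alpha>" using J1 a0 h0 by (intro powr_mono2) auto
      finally show ?thesis using h0 by (simp add: powr_mult)
    qed
    have small: "(\<Sum>j<J. A * (2 * y) ^ j * h) \<le> A / (2 * y - 1) * y ^ J"
    proof (cases "J = 0")
      case False
      have "(\<Sum>j<J. A * (2 * y) ^ j * h) = A * h * (\<Sum>j<J. (2 * y) ^ j)" by (simp add: sum_distrib_left mult_ac)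
      also have "(\<Sum>j<J. (2 * y) ^ j) = ((2 * y) ^ J - 1) / (2 * y - 1)" using y by (subst geometric_sum) auto
      also have "A * h * \<dots> \<le> A * (1/2) ^ J * ((2 * y) ^ J / (2 * y - 1))"
      proof -
        have "1 \<le> (2 * y) ^ J" using y by (intro one_le_power) auto
        then show ?thesis using J2 False A y h0 by (intro mult_mono divide_right_mono divide_nonneg_nonneg) auto
      qed
      also have "\<dots> = A / (2 * y - 1) * (((1/2) * (2 * y)) ^ J)" by (simp only: power_mult_distrib) simp
      finally show ?thesis by simp
    qed (use A y in simp)
    have "dyadic_series \<beta> z - dyadic_series \<beta> z' =
       (dyadic_series \<beta> z - (\<Sum>n<2^J. \<beta> n * z ^ n)) - (dyadic_series \<beta> z' - (\<Sum>n<2^J. \<beta> n * z' ^ n)) + (\<Sum>j<J. ?D j z - ?D j z')"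
      unfolding sum_dyadic_blocks by (simp add: sum_subtractf)
    also have "cmod \<dots> \<le> A / (1 - y) * y ^ J + A / (1 - y) * y ^ J + (\<Sum>j<J. A * (2 * y) ^ j * h)"
      unfolding h_def by (intro order.trans[OF norm_triangle_ineq] add_mono order.trans[OF norm_triangle_ineq4] rem z sum_norm_le D2)
    also have "\<dots> \<le> (A / (2 * y - 1) + 2 * (A / (1 - y))) * y ^ J" using small by (simp add: algebra_simps)
    also have "\<dots> \<le> (A / (2 * y - 1) + 2 * (A / (1 - y))) * (2 powr \<alpha> * h powr \<alpha>)"
      using yJ A y by (intro mult_left_mono) auto
    finally show ?thesis by (simp add: H_def h_def mult.assoc)
  qed simp
  then show "\<exists>H\<ge>0. \<forall>z z'. cmod z \<le> 1 \<longrightarrow> cmod z' \<le> 1 \<longrightarrow> cmod (dyadic_series \<beta> z - dyadic_series \<beta> z') \<le> H * cmod (z - z') powr (- log 2 y)"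
    using H0 unfolding \<alpha>_def by blast
qed

section \<open>Covering numbers of graphs\<close>

lemma One_inner_Basis: "b \<in> Basis \<Longrightarrow> One \<bullet> b = (1::real)"
  by (simp add: inner_sum_left inner_Basis sum.delta')

lemma mem_cube_product_iff:
  fixes x c :: "real ^ 3" and y d e :: real
  shows "(x, y) \<in> cbox (c, d) ((c, d) + e *\<^sub>R One) \<longleftrightarrow> (\<forall>i. c $ i \<le> x $ i \<and> x $ i \<le> c $ i + e) \<and> d \<le> y \<and> y \<le> d + e"
proof -
  have One: "(One :: (real ^ 3) \<times> real) = (One, 1)"
  proof (rule euclidean_eqI)
    fix b :: "(real ^ 3) \<times> real" assume b: "b \<in> Basis"
    then consider u where "u \<in> Basis" "b = (u, 0)" | "b = (0, 1)" by (auto simp: Basis_prod_def)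
    then show "One \<bullet> b = (One, 1) \<bullet> b"
      by cases (use One_inner_Basis[OF b] in \<open>auto simp: One_inner_Basis\<close>)
  qed
  have "x \<in> cbox c (c + e *\<^sub>R One) \<longleftrightarrow> (\<forall>i. c $ i \<le> x $ i \<and> x $ i \<le> c $ i + e)"
  proof -
    have "(One :: real ^ 3) $ i = 1" for i
      unfolding cart_eq_inner_axis by (rule One_inner_Basis) (simp add: axis_in_Basis_iff)
    then show ?thesis by (simp only: mem_box_cart vector_add_component vector_scaleR_component) auto
  qed
  moreover have "cbox (c, d) ((c, d) + e *\<^sub>R One) = cbox c (c + e *\<^sub>R One) \<times> cbox d (d + e)"
    unfolding One by (simp add: cbox_Pair_eq)
  ultimately show ?thesis by auto
qed

lemma covering_number_le:
  assumes "finite A" "E \<subseteq> (\<Union>c\<in>A. cbox c (c + \<epsilon> *\<^sub>R One))"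
  shows "covering_number E \<epsilon> \<le> card A"
  unfolding covering_number_def by (rule cInf_lower) (use assms in auto)

text \<open>Some finite cover has to be supplied: otherwise the infimum is over the empty set and
  says nothing.\<close>

lemma covering_number_attained:
  assumes "finite A" "E \<subseteq> (\<Union>c\<in>A. cbox c (c + \<epsilon> *\<^sub>R One))"
  obtains B where "finite B" "E \<subseteq> (\<Union>c\<in>B. cbox c (c + \<epsilon> *\<^sub>R One))" "covering_number E \<epsilon> = card B"
proof -
  have "covering_number E \<epsilon> \<in> {card A | A. finite A \<and> E \<subseteq> (\<Union>c\<in>A. cbox c (c + \<epsilon> *\<^sub>R One))}"
    unfolding covering_number_def by (rule Inf_nat_def1) (use assms in auto)
  then show thesis using that by auto
qed

section \<open>Covers of Hoelder graphs over the sphere\<close>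

lemma sph_point_in_S2: "sph_point \<theta> \<phi> \<in> S2"
proof -
  have "(sin \<theta> * cos \<phi>)\<^sup>2 + (sin \<theta> * sin \<phi>)\<^sup>2 + (cos \<theta>)\<^sup>2 = (sin \<theta>)\<^sup>2 * ((cos \<phi>)\<^sup>2 + (sin \<phi>)\<^sup>2) + (cos \<theta>)\<^sup>2"
    by (simp only: power_mult_distrib distrib_left)
  also have "\<dots> = 1" by simp
  finally show ?thesis
    by (simp add: sph_point_def norm_eq_1 inner_vec_def sum_3 power2_eq_square)
qed

lemma abs_sin_diff_le: "\<bar>sin x - sin y\<bar> \<le> \<bar>x - y :: real\<bar>"
proof -
  have "norm (sin x - sin y) \<le> 1 * norm (x - y)"
    by (rule field_differentiable_bound[of UNIV sin cos]) (auto intro!: derivative_eq_intros)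
  then show ?thesis by simp
qed

lemma abs_cos_diff_le: "\<bar>cos x - cos y\<bar> \<le> \<bar>x - y :: real\<bar>"
proof -
  have "norm (cos x - cos y) \<le> 1 * norm (x - y)"
    by (rule field_differentiable_bound[of UNIV cos "\<lambda>x. - sin x"]) (auto intro!: derivative_eq_intros)
  then show ?thesis by simp
qed

lemma abs_mult_diff_le:
  fixes a b c d :: real
  assumes "\<bar>a\<bar> \<le> 1" "\<bar>d\<bar> \<le> 1"
  shows "\<bar>a * b - c * d\<bar> \<le> \<bar>b - d\<bar> + \<bar>a - c\<bar>"
proof -
  have "a * b - c * d = a * (b - d) + (a - c) * d" by (simp add: algebra_simps)
  also have "\<bar>\<dots>\<bar> \<le> \<bar>a\<bar> * \<bar>b - d\<bar> + \<bar>a - c\<bar> * \<bar>d\<bar>" by (simp add: abs_mult[symmetric] abs_triangle_ineq)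
  also have "\<dots> \<le> 1 * \<bar>b - d\<bar> + \<bar>a - c\<bar> * 1" using assms by (intro add_mono mult_mono) auto
  finally show ?thesis by simp
qed

lemma sph_point_lipschitz: "\<bar>sph_point \<theta> \<phi> $ i - sph_point \<theta>' \<phi>' $ i\<bar> \<le> \<bar>\<theta> - \<theta>'\<bar> + \<bar>\<phi> - \<phi>'\<bar>"
proof -
  have "\<bar>sin \<theta> * cos \<phi> - sin \<theta>' * cos \<phi>'\<bar> \<le> \<bar>cos \<phi> - cos \<phi>'\<bar> + \<bar>sin \<theta> - sin \<theta>'\<bar>"
       "\<bar>sin \<theta> * sin \<phi> - sin \<theta>' * sin \<phi>'\<bar> \<le> \<bar>sin \<phi> - sin \<phi>'\<bar> + \<bar>sin \<theta> - sin \<theta>'\<bar>"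
    by (rule abs_mult_diff_le; simp)+
  then have "\<forall>i. \<bar>sph_point \<theta> \<phi> $ i - sph_point \<theta>' \<phi>' $ i\<bar> \<le> \<bar>\<theta> - \<theta>'\<bar> + \<bar>\<phi> - \<phi>'\<bar>"
    using abs_sin_diff_le[of \<theta> \<theta>'] abs_cos_diff_le[of \<theta> \<theta>'] abs_sin_diff_le[of \<phi> \<phi>'] abs_cos_diff_le[of \<phi> \<phi>']
      abs_ge_zero[of "\<phi> - \<phi>'"]
    unfolding forall_3 sph_point_def vector_3 by linarith
  then show ?thesis ..
qed

lemma floor_step:
  fixes h x :: real
  assumes "h > 0" "x \<ge> 0" "x \<le> X"
  obtains i where "i \<le> nat \<lfloor>X / h\<rfloor>" "real i * h \<le> x" "x \<le> real i * h + h"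
proof
  have "x / h \<le> X / h" using assms by (simp add: divide_right_mono)
  then show "nat \<lfloor>x / h\<rfloor> \<le> nat \<lfloor>X / h\<rfloor>" by (intro nat_mono floor_mono)
  have "real (nat \<lfloor>x / h\<rfloor>) = of_int \<lfloor>x / h\<rfloor>" using assms by simp
  then show "real (nat \<lfloor>x / h\<rfloor>) * h \<le> x" "x \<le> real (nat \<lfloor>x / h\<rfloor>) * h + h"
    using floor_divide_lower[of h x] floor_divide_upper[of h x] assms by (auto simp: algebra_simps)
qed

text \<open>A grid of step \<epsilon> / 4 in both angles moves each coordinate by at most \<epsilon>
  / 2, so a box base centred at each grid point suffices. Both angles are below 8, which gives at
  most (33 / \<epsilon>)^2 bases, and 33^2 = 1089. Over a base g deviates by at most \<rho> from its
  value at the grid point, so a column of height 2 \<rho> is enough, which takes about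
  \<epsilon>^(\<alpha> - 1) boxes.\<close>

lemma sphere_graph_cover:
  fixes g :: "real ^ 3 \<Rightarrow> real"
  assumes a: "0 < \<alpha>" "\<alpha> \<le> 1" and H: "0 \<le> H"
    and g: "\<And>x y. x \<in> S2 \<Longrightarrow> y \<in> S2 \<Longrightarrow> \<bar>g x - g y\<bar> \<le> H * norm (x - y) powr \<alpha>"
    and e: "0 < \<epsilon>" "\<epsilon> < 1"
  obtains A where "finite A" "sphere_graph g \<subseteq> (\<Union>c\<in>A. cbox c (c + \<epsilon> *\<^sub>R One))"
    "real (card A) \<le> 1089 * (4 * H + 1) * (1 / \<epsilon>) powr (3 - \<alpha>)"
proof -
  define h where "h = \<epsilon> / 4"
  have h0: "h > 0" using e by (simp add: h_def)
  define N where "N = nat \<lfloor>8 / h\<rfloor>"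
  define \<rho> where "\<rho> = H * (2 * \<epsilon>) powr \<alpha>"
  have r0: "\<rho> \<ge> 0" using H by (simp add: \<rho>_def)
  define M where "M = nat \<lfloor>2 * \<rho> / \<epsilon>\<rfloor>"
  define P where "P = (\<lambda>i j::nat. sph_point (real i * h) (real j * h))"
  define c where "c = (\<lambda>(i::nat, j::nat, k::nat). ((\<chi> l. P i j $ l - \<epsilon> / 2) :: real ^ 3, g (P i j) - \<rho> + real k * \<epsilon>))"
  define A where "A = c ` ({..N} \<times> {..N} \<times> {..M})"
  have cover: "sphere_graph g \<subseteq> (\<Union>c\<in>A. cbox c (c + \<epsilon> *\<^sub>R One))"
  proof
    fix w assume "w \<in> sphere_graph g"
    then obtain x where x: "x \<in> S2" "w = (x, g x)" by (auto simp: sphere_graph_def)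
    note pa = sph_point_polar_azimuth[OF x(1)]
    have "polar_angle x \<le> 8" "azimuth x \<le> 8" using pa(2,3) pi_less_4 by auto
    then obtain i j where i: "i \<le> N" "real i * h \<le> polar_angle x" "polar_angle x \<le> real i * h + h"
        and j: "j \<le> N" "real j * h \<le> azimuth x" "azimuth x \<le> real j * h + h"
      unfolding N_def using floor_step[OF h0, of "polar_angle x" 8] floor_step[OF h0, of "azimuth x" 8] pa(2,3) by (metis atLeastAtMost_iff atLeastLessThan_iff)
    have d: "\<bar>x $ l - P i j $ l\<bar> \<le> \<epsilon> / 2" for l
      using sph_point_lipschitz[of "polar_angle x" "azimuth x" l "real i * h" "real j * h"] i j
      unfolding pa(1) P_def h_def by linarith
    have "norm (x - P i j) \<le> (\<Sum>l\<in>UNIV. \<bar>(x - P i j) $ l\<bar>)" by (rule norm_le_l1_cart)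
    also have "\<dots> \<le> (\<Sum>l\<in>(UNIV::3 set). \<epsilon> / 2)" by (intro sum_mono) (simp only: vector_minus_component d)
    also have "\<dots> \<le> 2 * \<epsilon>" using e by simp
    finally have "norm (x - P i j) powr \<alpha> \<le> (2 * \<epsilon>) powr \<alpha>" using a by (intro powr_mono2) auto
    then have Hr: "H * norm (x - P i j) powr \<alpha> \<le> \<rho>" unfolding \<rho>_def by (rule mult_left_mono[OF _ H])
    have gd: "\<bar>g x - g (P i j)\<bar> \<le> \<rho>"
    proof -
      have "P i j \<in> S2" unfolding P_def by (rule sph_point_in_S2)
      from g[OF x(1) this] Hr show ?thesis by linarith
    qed
    have "0 \<le> g x - g (P i j) + \<rho>" "g x - g (P i j) + \<rho> \<le> 2 * \<rho>" using gd by linarith+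
    then obtain k where k: "k \<le> M" "real k * \<epsilon> \<le> g x - g (P i j) + \<rho>" "g x - g (P i j) + \<rho> \<le> real k * \<epsilon> + \<epsilon>"
      unfolding M_def by (rule floor_step[OF e(1)])
    have d': "P i j $ l - \<epsilon> / 2 \<le> x $ l \<and> x $ l \<le> P i j $ l - \<epsilon> / 2 + \<epsilon>" for l using d[of l] by linarith
    have k': "g (P i j) - \<rho> + real k * \<epsilon> \<le> g x" "g x \<le> g (P i j) - \<rho> + real k * \<epsilon> + \<epsilon>" using k by linarith+
    have "w \<in> cbox (c (i,j,k)) (c (i,j,k) + \<epsilon> *\<^sub>R One)"
      unfolding x(2) c_def split mem_cube_product_iff vec_lambda_beta using d' k' by blast
    moreover have "c (i,j,k) \<in> A" using i j k by (auto simp: A_def)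
    ultimately show "w \<in> (\<Union>c\<in>A. cbox c (c + \<epsilon> *\<^sub>R One))" by blast
  qed
  have "card A \<le> card ({..N} \<times> {..N} \<times> {..M})" unfolding A_def by (rule card_image_le) auto
  also have "\<dots> = (N+1)*((N+1)*(M+1))" by (simp add: card_cartesian_product)
  finally have "real (card A) \<le> real ((N+1)*((N+1)*(M+1)))" by (rule of_nat_mono)
  also have "\<dots> = (real N + 1) * ((real N + 1) * (real M + 1))" by (simp only: of_nat_mult of_nat_add of_nat_1)
  also have "\<dots> \<le> (33 / \<epsilon>) * ((33 / \<epsilon>) * ((4 * H + 1) * (1 / \<epsilon>) powr (1 - \<alpha>)))"
  proof -
    have "real N \<le> 8 / h" unfolding N_def using h0 by simp
    then have N: "real N + 1 \<le> 33 / \<epsilon>" using e by (simp add: h_def field_simps)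
    have "real M \<le> 2 * \<rho> / \<epsilon>" unfolding M_def using r0 e by simp
    also have "2 * \<rho> / \<epsilon> = 2 * H * 2 powr \<alpha> * (\<epsilon> powr \<alpha> / \<epsilon>)"
      using e by (simp add: \<rho>_def powr_mult)
    also have "\<epsilon> powr \<alpha> / \<epsilon> = (1 / \<epsilon>) powr (1 - \<alpha>)"
      using e by (simp add: powr_diff powr_divide)
    also have "2 * H * 2 powr \<alpha> * (1 / \<epsilon>) powr (1 - \<alpha>) \<le> 2 * H * 2 powr 1 * (1 / \<epsilon>) powr (1 - \<alpha>)"
      using a H by (intro mult_left_mono mult_right_mono powr_mono) auto
    finally have "real M \<le> 4 * H * (1 / \<epsilon>) powr (1 - \<alpha>)" by simp
    moreover have "1 \<le> (1 / \<epsilon>) powr (1 - \<alpha>)" using e a by (intro ge_one_powr_ge_zero) auto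
    ultimately have "real M + 1 \<le> (4 * H + 1) * (1 / \<epsilon>) powr (1 - \<alpha>)" by (simp add: algebra_simps)
    then show ?thesis using N e H by (intro mult_mono) auto
  qed
  also have "\<dots> = 1089 * (4 * H + 1) * ((1 / \<epsilon>) powr 2 * (1 / \<epsilon>) powr (1 - \<alpha>))"
    using e by (simp add: power2_eq_square)
  also have "(1 / \<epsilon>) powr 2 * (1 / \<epsilon>) powr (1 - \<alpha>) = (1 / \<epsilon>) powr (3 - \<alpha>)"
    by (simp only: powr_add[symmetric]) simp
  finally have "real (card A) \<le> 1089 * (4 * H + 1) * (1 / \<epsilon>) powr (3 - \<alpha>)" .
  moreover have "finite A" by (simp add: A_def)
  ultimately show thesis using that cover by blast
qed

lemma fractal_dim_le:
  assumes K: "K \<ge> 1" and s: "s \<ge> 0"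
    and cov: "\<And>\<epsilon>. 0 < \<epsilon> \<Longrightarrow> \<epsilon> < 1 \<Longrightarrow> real (covering_number E \<epsilon>) \<le> K * (1 / \<epsilon>) powr s"
  shows "fractal_dim E \<le> ereal s"
proof -
  have "((\<lambda>\<epsilon>::real. ln K / - ln \<epsilon>) \<longlongrightarrow> 0) (at_right 0)"
    by (intro real_tendsto_divide_at_top[OF tendsto_const] filterlim_compose[OF filterlim_uminus_at_top_at_bot ln_at_0])
  then have "((\<lambda>\<epsilon>::real. s + ln K / - ln \<epsilon>) \<longlongrightarrow> s + 0) (at_right 0)" by (intro tendsto_intros)
  then have L: "((\<lambda>\<epsilon>::real. ereal (s + ln K / - ln \<epsilon>)) \<longlongrightarrow> ereal s) (at_right 0)" by simp
  have "eventually (\<lambda>\<epsilon>. \<epsilon> \<in> {0<..<1::real}) (at_right 0)" by (rule eventually_at_right_real) simp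
  then have "eventually (\<lambda>\<epsilon>. ereal (ln (real (covering_number E \<epsilon>)) / ln (1 / \<epsilon>)) \<le> ereal (s + ln K / - ln \<epsilon>)) (at_right 0)"
  proof eventually_elim
    case (elim \<epsilon>)
    then have l: "ln (1 / \<epsilon>) > 0" "ln (1/\<epsilon>) = - ln \<epsilon>" by (auto simp: ln_div)
    have "ln (real (covering_number E \<epsilon>)) \<le> ln K + s * ln (1 / \<epsilon>)"
    proof (cases "covering_number E \<epsilon> = 0")
      \<comment> \<open>A vanishing covering number gives \<open>ln 0\<close>, which is 0 by
        convention; K \<ge> 1 and s \<ge> 0 make the right-hand side nonnegative.\<close>
      case True
      moreover have "0 \<le> ln K" using K by simp
      moreover have "0 \<le> s * ln (1 / \<epsilon>)" using s l(1) by (intro mult_nonneg_nonneg) linarith+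
      ultimately show ?thesis by simp
    next
      case False
      have "ln (real (covering_number E \<epsilon>)) \<le> ln (K * (1 / \<epsilon>) powr s)"
        using False cov[of \<epsilon>] elim by (subst ln_le_cancel_iff) (auto intro: order.strict_trans2)
      also have "\<dots> = ln K + s * ln (1 / \<epsilon>)" using K elim by (subst ln_mult) (auto simp: ln_powr)
      finally show ?thesis .
    qed
    then have "ln (real (covering_number E \<epsilon>)) / ln (1 / \<epsilon>) \<le> (ln K + s * ln (1 / \<epsilon>)) / ln (1 / \<epsilon>)"
      using l by (intro divide_right_mono) auto
    also have "\<dots> = s + ln K / - ln \<epsilon>" using l by (simp add: field_simps)
    finally show ?case by simp
  qed
  then have "fractal_dim E \<le> Limsup (at_right 0) (\<lambda>\<epsilon>::real. ereal (s + ln K / - ln \<epsilon>))"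
    unfolding fractal_dim_def by (rule Limsup_mono)
  also have "\<dots> = ereal s" by (rule lim_imp_Limsup[OF _ L]) simp
  finally show ?thesis .
qed

text \<open>The dimension is an upper limit, so a lower bound along scales tending to 0 suffices;
  the scales are those of the blocks with large energy.\<close>

lemma fractal_dim_ge:
  assumes K: "K > 0"
    and cov: "\<And>\<delta>. 0 < \<delta> \<Longrightarrow> \<exists>\<epsilon>. 0 < \<epsilon> \<and> \<epsilon> < \<delta> \<and> K * (1 / \<epsilon>) powr s \<le> real (covering_number E \<epsilon>)"
  shows "ereal s \<le> fractal_dim E"
proof (rule ccontr)
  assume "\<not> ereal s \<le> fractal_dim E"
  then have "fractal_dim E < ereal s" by simp
  then obtain y where y: "fractal_dim E < ereal y" "y < s" using ereal_dense2 by force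
  have "((\<lambda>\<epsilon>::real. ln K / - ln \<epsilon>) \<longlongrightarrow> 0) (at_right 0)"
    by (intro real_tendsto_divide_at_top[OF tendsto_const] filterlim_compose[OF filterlim_uminus_at_top_at_bot ln_at_0])
  then have "((\<lambda>\<epsilon>::real. s + ln K / - ln \<epsilon>) \<longlongrightarrow> s + 0) (at_right 0)" by (intro tendsto_intros)
  then have "eventually (\<lambda>\<epsilon>. y < s + ln K / - ln \<epsilon>) (at_right 0)"
    using y(2) by (auto dest: order_tendstoD(1))
  moreover have "eventually (\<lambda>\<epsilon>. ereal (ln (real (covering_number E \<epsilon>)) / ln (1 / \<epsilon>)) < ereal y) (at_right 0)"
    using y(1) unfolding fractal_dim_def by (rule Limsup_lessD)
  moreover have "eventually (\<lambda>\<epsilon>. \<epsilon> \<in> {0<..<1::real}) (at_right 0)" by (rule eventually_at_right_real) simp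
  ultimately have "eventually (\<lambda>\<epsilon>. y < s + ln K / - ln \<epsilon> \<and> \<epsilon> < 1 \<and>
      ln (real (covering_number E \<epsilon>)) / ln (1 / \<epsilon>) < y) (at_right 0)"
    by eventually_elim auto
  then obtain \<delta> where d0: "\<delta> > 0" and \<delta>: "\<And>\<epsilon>. 0 < \<epsilon> \<Longrightarrow> \<epsilon> < \<delta> \<Longrightarrow> y < s + ln K / - ln \<epsilon> \<and> \<epsilon> < 1 \<and>
      ln (real (covering_number E \<epsilon>)) / ln (1 / \<epsilon>) < y"
    unfolding eventually_at_right_field by auto
  obtain \<epsilon> where e: "0 < \<epsilon>" "\<epsilon> < \<delta>" "K * (1 / \<epsilon>) powr s \<le> real (covering_number E \<epsilon>)"
    using cov[OF d0] by auto
  note f = \<delta>[OF e(1,2)]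
  have l: "ln (1 / \<epsilon>) > 0" "ln (1/\<epsilon>) = - ln \<epsilon>" using e f by (auto simp: ln_div)
  have pos: "0 < K * (1 / \<epsilon>) powr s" using K e by simp
  have "y < s + ln K / - ln \<epsilon>" using f by simp
  also have "\<dots> = (ln K + s * ln (1 / \<epsilon>)) / ln (1 / \<epsilon>)" using l by (simp add: field_simps)
  also have "ln K + s * ln (1 / \<epsilon>) = ln (K * (1 / \<epsilon>) powr s)" using K e by (subst ln_mult) (auto simp: ln_powr)
  also have "ln (K * (1 / \<epsilon>) powr s) / ln (1 / \<epsilon>) \<le> ln (real (covering_number E \<epsilon>)) / ln (1 / \<epsilon>)"
    using e(3) pos l by (intro divide_right_mono) auto
  finally show False using f by simp
qed

theorem fractal_dim_hoelder_graph:
  fixes g :: "real ^ 3 \<Rightarrow> real"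
  assumes a: "0 < \<alpha>" "\<alpha> \<le> 1" and H: "0 \<le> H"
    and g: "\<And>x y. x \<in> S2 \<Longrightarrow> y \<in> S2 \<Longrightarrow> \<bar>g x - g y\<bar> \<le> H * norm (x - y) powr \<alpha>"
  shows "fractal_dim (sphere_graph g) \<le> ereal (3 - \<alpha>)"
proof (rule fractal_dim_le[of "1089 * (4 * H + 1)"])
  fix \<epsilon> :: real assume e: "0 < \<epsilon>" "\<epsilon> < 1"
  obtain A where "finite A" "sphere_graph g \<subseteq> (\<Union>c\<in>A. cbox c (c + \<epsilon> *\<^sub>R One))"
    "real (card A) \<le> 1089 * (4 * H + 1) * (1 / \<epsilon>) powr (3 - \<alpha>)"
    using sphere_graph_cover[OF a H g e] by blast
  then show "real (covering_number (sphere_graph g) \<epsilon>) \<le> 1089 * (4 * H + 1) * (1 / \<epsilon>) powr (3 - \<alpha>)"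
    using covering_number_le[of A "sphere_graph g" \<epsilon>] by linarith
qed (use H a in auto)

section \<open>Lower bounds for covers of graphs\<close>

lemma interval_cover_length:
  fixes a b \<epsilon> :: real
  assumes I: "finite I" and ab: "a \<le> b" and e: "\<epsilon> \<ge> 0" and cov: "{a..b} \<subseteq> (\<Union>i\<in>I. {c i..c i + \<epsilon>})"
  shows "b - a \<le> real (card I) * \<epsilon>"
proof -
  have "ennreal (b - a) = emeasure lborel {a..b}" using ab by simp
  also have "\<dots> \<le> emeasure lborel (\<Union>i\<in>I. {c i..c i + \<epsilon>})" using I by (intro emeasure_mono[OF cov]) auto
  also have "\<dots> \<le> (\<Sum>i\<in>I. emeasure lborel {c i..c i + \<epsilon>})" by (rule emeasure_subadditive_finite[OF I]) auto
  also have "\<dots> = (\<Sum>i\<in>I. ennreal \<epsilon>)" using e by (intro sum.cong) auto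
  also have "\<dots> = ennreal (real (card I) * \<epsilon>)" using e by (simp add: ennreal_mult ennreal_of_nat_eq_real_of_nat)
  finally show ?thesis using e by (subst (asm) ennreal_le_iff) auto
qed

text \<open>A chord of the unit circle has length 2 |sin u| with u half the difference of the
  angles. Division by r \<ge> 1/2 doubles the error, which leads to |sin u| \<le> 2 \<epsilon>.
  After reduction of u modulo pi, Jordan's inequality bounds the remainder by pi \<epsilon> \<le> 4
  \<epsilon>, and undoing the halving gives 8 \<epsilon>.\<close>

lemma close_angles:
  assumes r: "1 / 2 \<le> r" and e: "0 \<le> \<epsilon>"
    and c: "\<bar>r * cos x - r * cos y\<bar> \<le> \<epsilon>" and s: "\<bar>r * sin x - r * sin y\<bar> \<le> \<epsilon>"
  obtains k :: int where "\<bar>x - y - 2 * pi * of_int k\<bar> \<le> 8 * \<epsilon>"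
proof -
  have lip: "\<bar>a - b\<bar> \<le> 2 * \<epsilon>" if "\<bar>r * a - r * b\<bar> \<le> \<epsilon>" for a b
  proof -
    have "1 / 2 * \<bar>a - b\<bar> \<le> r * \<bar>a - b\<bar>" using r by (intro mult_right_mono) auto
    also have "\<dots> = \<bar>r * a - r * b\<bar>" using r by (simp add: abs_mult flip: right_diff_distrib)
    finally show ?thesis using that by simp
  qed
  define u where "u = (x - y) / 2"
  have "(cos x - cos y)\<^sup>2 + (sin x - sin y)\<^sup>2 = 2 - 2 * cos (x - y)"
    using sin_cos_squared_add[of x] sin_cos_squared_add[of y] by (simp add: cos_diff power2_eq_square algebra_simps)
  also have "x - y = 2 * u" by (simp add: u_def)
  also have "cos (2 * u) = 1 - 2 * (sin u)\<^sup>2" by (rule cos_double_sin)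
  finally have "4 * (sin u)\<^sup>2 = (cos x - cos y)\<^sup>2 + (sin x - sin y)\<^sup>2" by simp
  also have "\<dots> \<le> (2 * \<epsilon>)\<^sup>2 + (2 * \<epsilon>)\<^sup>2"
    using lip[OF c] lip[OF s] by (intro add_mono power2_le_iff_abs_le[THEN iffD2]) (use e in auto)
  also have "\<dots> \<le> 4 * (2 * \<epsilon>)\<^sup>2" by simp
  finally have "(sin u)\<^sup>2 \<le> (2 * \<epsilon>)\<^sup>2" by simp
  then have "\<bar>sin u\<bar> \<le> \<bar>2 * \<epsilon>\<bar>" by (simp only: abs_le_square_iff)
  then have su: "\<bar>sin u\<bar> \<le> 2 * \<epsilon>" using e by simp
  \<comment> \<open>|sin| has period pi; the nearest multiple leaves a remainder in the range of
    Jordan's inequality.\<close>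
  define k where "k = round (u / pi)"
  define w where "w = u - of_int k * pi"
  have "\<bar>of_int k - u / pi\<bar> \<le> 1 / 2" unfolding k_def by (rule of_int_round_abs_le)
  then have "\<bar>of_int k - u / pi\<bar> * pi \<le> 1 / 2 * pi" by (rule mult_right_mono) simp
  moreover have "\<bar>of_int k - u / pi\<bar> * pi = \<bar>w\<bar>"
  proof -
    have "(of_int k - u / pi) * pi = - w" by (simp add: w_def field_simps)
    then show ?thesis by (metis abs_minus_cancel abs_mult abs_of_pos pi_gt_zero)
  qed
  ultimately have w: "\<bar>w\<bar> \<le> pi / 2" by simp
  have "\<bar>sin u\<bar> = \<bar>sin w\<bar>" using abs_sin_add_int_pi[of k w] by (simp add: w_def)
  also have "\<dots> \<ge> sin \<bar>w\<bar>" by (simp add: abs_if)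
  finally have "2 / pi * \<bar>w\<bar> \<le> 2 * \<epsilon>" using sin_ge_linear[of "\<bar>w\<bar>"] w su by linarith
  then have "\<bar>w\<bar> \<le> pi * \<epsilon>" by (simp add: field_simps)
  also have "\<dots> \<le> 4 * \<epsilon>" using e pi_less_4 by (intro mult_right_mono) auto
  finally have "\<bar>x - y - 2 * pi * of_int k\<bar> \<le> 8 * \<epsilon>" by (simp add: w_def u_def abs_le_iff field_simps)
  then show thesis by (rule that)
qed

text \<open>The horizontal circle is labelled by its height instead of the polar angle, because the
  height is a coordinate of the boxes: whether a box can meet the slice is then read off from its
  third coordinate.\<close>

definition slice_point :: "real \<Rightarrow> real \<Rightarrow> real ^ 3" where
  "slice_point z \<phi> = vector [sqrt (1 - z\<^sup>2) * cos \<phi>, sqrt (1 - z\<^sup>2) * sin \<phi>, z]"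

lemma slice_point_in_S2:
  assumes "\<bar>z\<bar> \<le> 1"
  shows "slice_point z \<phi> \<in> S2"
proof -
  have z: "0 \<le> 1 - z\<^sup>2" using assms by (simp add: abs_square_le_1)
  have "(sqrt (1 - z\<^sup>2) * cos \<phi>)\<^sup>2 + (sqrt (1 - z\<^sup>2) * sin \<phi>)\<^sup>2 + z\<^sup>2 = (1 - z\<^sup>2) * ((cos \<phi>)\<^sup>2 + (sin \<phi>)\<^sup>2) + z\<^sup>2"
    using z by (simp only: power_mult_distrib distrib_left real_sqrt_pow2)
  also have "\<dots> = 1" by simp
  finally show ?thesis
    by (simp add: slice_point_def norm_eq_1 inner_vec_def sum_3 power2_eq_square)
qed

lemma continuous_on_slice_point: "continuous_on S (slice_point z)"
proof -
  have "slice_point z = (\<lambda>\<phi>. (sqrt (1 - z\<^sup>2) * cos \<phi>) *\<^sub>R axis 1 1 + (sqrt (1 - z\<^sup>2) * sin \<phi>) *\<^sub>R axis 2 1 + z *\<^sub>R axis 3 1)"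
    by (simp add: fun_eq_iff slice_point_def vec_eq_iff forall_3 axis_def)
  then show ?thesis by (simp only:) (intro continuous_intros)
qed

text \<open>Each box meeting the slice contributes at most its height to the oscillation over an arc of
  length \<open>s\<close>, and only for starting points in an interval of length comparable to its side.\<close>

lemma slice_variation_le:
  fixes g :: "real ^ 3 \<Rightarrow> real"
  assumes g: "continuous_on S2 g" and A: "finite A"
    and cov: "sphere_graph g \<subseteq> (\<Union>c\<in>A. cbox c (c + \<epsilon> *\<^sub>R One))"
    and e: "0 < \<epsilon>" "\<epsilon> \<le> 1 / 10" and z: "\<bar>z\<bar> \<le> 1 / 2" and s: "0 \<le> s" "s \<le> 2 * \<epsilon>"
  shows "integral {0..2 * pi} (\<lambda>\<phi>. \<bar>g (slice_point z (\<phi> + s)) - g (slice_point z \<phi>)\<bar>)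
    \<le> 100 * \<epsilon>\<^sup>2 * real (card {c\<in>A. fst c $ 3 \<le> z \<and> z \<le> fst c $ 3 + \<epsilon>})"
proof -
  define r where "r = sqrt (1 - z\<^sup>2)"
  have z1: "\<bar>z\<bar> \<le> 1" using z by simp
  have r: "1 / 2 \<le> r"
  proof -
    have "z\<^sup>2 \<le> (1 / 2)\<^sup>2" using z by (simp add: power2_le_iff_abs_le)
    then have "(1/2)\<^sup>2 \<le> 1 - z\<^sup>2" by (simp add: power2_eq_square)
    then show ?thesis unfolding r_def by (rule real_le_rsqrt)
  qed
  define P where "P = slice_point z"
  define Az where "Az = {c\<in>A. fst c $ 3 \<le> z \<and> z \<le> fst c $ 3 + \<epsilon>}"
  have fin: "finite Az" using A by (simp add: Az_def)
  define S where "S = (\<lambda>c :: (real ^ 3) \<times> real. {\<phi>\<in>{0..2 * pi + s}. \<forall>i. fst c $ i \<le> P \<phi> $ i \<and> P \<phi> $ i \<le> fst c $ i + \<epsilon>})"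
  \<comment> \<open>One angle at which the circle passes through the base of the box; all others lie
    within 8 \<epsilon> of it modulo 2 pi.\<close>
  define m where "m = (\<lambda>c. SOME \<phi>. \<phi> \<in> S c)"
  \<comment> \<open>10 \<epsilon> is the 8 \<epsilon> of \<open>close_angles\<close> plus 2
    \<epsilon> for the arc length s.\<close>
  define lo where "lo = (\<lambda>c k. m c + 2 * pi * of_int k - 10 * \<epsilon>)"
  \<comment> \<open>Whole turns that may separate two angles of [0, 2 pi + s]. These five values
    times the interval length 20 \<epsilon> make up the factor 100.\<close>
  define K where "K = {-2..2::int}"
  have gP: "continuous_on X (\<lambda>\<phi>. g (P \<phi>))" for X
    by (rule continuous_on_compose2[OF g]) (auto simp: P_def intro!: continuous_on_slice_point slice_point_in_S2[OF z1])
  have pw: "\<bar>g (P (\<phi> + s)) - g (P \<phi>)\<bar> \<le> (\<Sum>c\<in>Az. \<Sum>k\<in>K. \<epsilon> * (if \<phi> \<in> {lo c k..lo c k + 20 * \<epsilon>} then 1 else 0))"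
    if phi: "\<phi> \<in> {0..2 * pi}" for \<phi>
  proof -
    define I where "I = {c\<in>Az. \<exists>k\<in>K. \<phi> \<in> {lo c k..lo c k + 20 * \<epsilon>}}"
    have fI: "finite I" using fin by (simp add: I_def)
    define a b where "a = min (g (P \<phi>)) (g (P (\<phi> + s)))" and "b = max (g (P \<phi>)) (g (P (\<phi> + s)))"
    \<comment> \<open>By the intermediate value theorem each height between the two values is
      attained on the arc from \<phi> to \<phi> + s, and the box containing that point of the graph
      belongs to \<open>I\<close>.\<close>
    have "{a..b} \<subseteq> (\<Union>c\<in>I. {snd c..snd c + \<epsilon>})"
    proof
      fix y assume y: "y \<in> {a..b}"
      have "connected ((\<lambda>\<phi>. g (P \<phi>)) ` {\<phi>..\<phi> + s})"
        by (rule connected_continuous_image[OF gP]) simp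
      then have "is_interval ((\<lambda>\<phi>. g (P \<phi>)) ` {\<phi>..\<phi> + s})" by (simp add: is_interval_connected_1)
      moreover have "g (P \<phi>) \<in> (\<lambda>\<phi>. g (P \<phi>)) ` {\<phi>..\<phi> + s}" "g (P (\<phi> + s)) \<in> (\<lambda>\<phi>. g (P \<phi>)) ` {\<phi>..\<phi> + s}"
        using s by auto
      then have "a \<in> (\<lambda>\<phi>. g (P \<phi>)) ` {\<phi>..\<phi> + s}" "b \<in> (\<lambda>\<phi>. g (P \<phi>)) ` {\<phi>..\<phi> + s}"
        by (auto simp: a_def b_def min_def max_def)
      ultimately have "y \<in> (\<lambda>\<phi>. g (P \<phi>)) ` {\<phi>..\<phi> + s}"
        using y by (auto intro: mem_is_interval_1_I)
      then obtain \<psi> where psi: "\<psi> \<in> {\<phi>..\<phi> + s}" "y = g (P \<psi>)" by auto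
      have "(P \<psi>, y) \<in> sphere_graph g"
        unfolding sphere_graph_def psi(2) P_def using slice_point_in_S2[OF z1] by blast
      then obtain c where c: "c \<in> A" "(P \<psi>, y) \<in> cbox c (c + \<epsilon> *\<^sub>R One)" using cov by blast
      have "(P \<psi>, y) \<in> cbox (fst c, snd c) ((fst c, snd c) + \<epsilon> *\<^sub>R One)" using c(2) by (simp only: prod.collapse)
      then have box: "\<forall>i. fst c $ i \<le> P \<psi> $ i \<and> P \<psi> $ i \<le> fst c $ i + \<epsilon>" and yc: "snd c \<le> y" "y \<le> snd c + \<epsilon>"
        unfolding mem_cube_product_iff by auto
      have "P \<psi> $ 3 = z" by (simp add: P_def slice_point_def)
      then have cAz: "c \<in> Az" using box c(1) by (auto simp: Az_def)
      have psiS: "\<psi> \<in> S c" using box psi phi by (auto simp: S_def)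
      then have mS: "m c \<in> S c" unfolding m_def by (rule someI)
      have d: "\<bar>P \<psi> $ i - P (m c) $ i\<bar> \<le> \<epsilon>" for i
      proof -
        have "fst c $ i \<le> P \<psi> $ i" "P \<psi> $ i \<le> fst c $ i + \<epsilon>" "fst c $ i \<le> P (m c) $ i" "P (m c) $ i \<le> fst c $ i + \<epsilon>"
          using psiS mS by (auto simp: S_def)
        then show ?thesis by linarith
      qed
      obtain k :: int where k: "\<bar>\<psi> - m c - 2 * pi * of_int k\<bar> \<le> 8 * \<epsilon>"
        using close_angles[OF r, of \<epsilon> \<psi> "m c"] d[of 1] d[of 2] e by (auto simp: P_def slice_point_def r_def)
      have mc: "0 \<le> m c" "m c \<le> 2 * pi + s" using mS by (auto simp: S_def)
      have "k \<in> K"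
      proof -
        have pk: "2 * pi * of_int k \<le> 2 * pi + s + 8 * \<epsilon>" "- (2 * pi + s + 8 * \<epsilon>) \<le> 2 * pi * of_int k"
          using k mc psi phi by (auto simp: abs_le_iff)
        have "s + 8 * \<epsilon> < 2 * pi" using s e pi_gt3 by linarith
        then have "2 * pi * of_int k < 2 * pi * 2" "2 * pi * (-2) < 2 * pi * of_int k" using pk by linarith+
        then have "of_int k < (2::real)" "(-2::real) < of_int k" by (simp_all only: mult_less_cancel_left_pos pi_gt_zero mult_pos_pos zero_less_numeral)
        then show ?thesis by (simp add: K_def)
      qed
      moreover have "\<phi> \<in> {lo c k..lo c k + 20 * \<epsilon>}"
        using k psi s by (auto simp: lo_def abs_le_iff)
      ultimately have "c \<in> I" using cAz by (auto simp: I_def)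
      then show "y \<in> (\<Union>c\<in>I. {snd c..snd c + \<epsilon>})" using yc by auto
    qed
    then have "b - a \<le> real (card I) * \<epsilon>"
      using e by (intro interval_cover_length[OF fI]) (auto simp: a_def b_def)
    also have "\<dots> = (\<Sum>c\<in>I. \<epsilon>)" by simp
    also have "\<dots> \<le> (\<Sum>c\<in>I. \<Sum>k\<in>K. \<epsilon> * (if \<phi> \<in> {lo c k..lo c k + 20 * \<epsilon>} then 1 else 0))"
    proof (rule sum_mono)
      fix c assume "c \<in> I"
      then obtain k where k: "k \<in> K" "\<phi> \<in> {lo c k..lo c k + 20 * \<epsilon>}" by (auto simp: I_def)
      have "\<epsilon> = \<epsilon> * (if \<phi> \<in> {lo c k..lo c k + 20 * \<epsilon>} then 1 else 0)" using k by simp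
      also have "\<dots> \<le> (\<Sum>k\<in>K. \<epsilon> * (if \<phi> \<in> {lo c k..lo c k + 20 * \<epsilon>} then 1 else 0))"
        by (rule member_le_sum[OF k(1)]) (use e in \<open>auto simp: K_def\<close>)
      finally show "\<epsilon> \<le> (\<Sum>k\<in>K. \<epsilon> * (if \<phi> \<in> {lo c k..lo c k + 20 * \<epsilon>} then 1 else 0))" .
    qed
    also have "\<dots> \<le> (\<Sum>c\<in>Az. \<Sum>k\<in>K. \<epsilon> * (if \<phi> \<in> {lo c k..lo c k + 20 * \<epsilon>} then 1 else 0))"
      using e by (intro sum_mono2[OF fin]) (auto simp: I_def intro!: sum_nonneg)
    finally show ?thesis by (simp add: a_def b_def abs_if min_def max_def split: if_splits)
  qed
  have ind: "((\<lambda>\<phi>. if \<phi> \<in> {l..l + 20 * \<epsilon>} then 1 else 0) has_integral measure lborel ({0..2*pi} \<inter> {l..l + 20 * \<epsilon>})) {0..2 * pi}" for l :: real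
  proof -
    have "((\<lambda>\<phi>. 1::real) has_integral measure lborel {max 0 l..min (2*pi) (l + 20 * \<epsilon>)} * 1) {max 0 l..min (2*pi) (l + 20 * \<epsilon>)}"
      using has_integral_const_real[of "1::real" "max 0 l" "min (2*pi) (l + 20 * \<epsilon>)"] by simp
    then show ?thesis
      by (subst has_integral_restrict_Int) (simp add: Int_commute Int_atLeastAtMost max.commute min.commute)
  qed
  have cont: "measure lborel ({0..2*pi} \<inter> {l..l + 20 * \<epsilon>}) \<le> 20 * \<epsilon>" for l
  proof -
    have "measure lborel ({0..2*pi} \<inter> {l..l + 20 * \<epsilon>}) \<le> measure lborel {l..l + 20 * \<epsilon>}"
      using e by (intro measure_mono_fmeasurable) (auto simp: fmeasurable_def)
    then show ?thesis using e by simp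
  qed
  have hi: "((\<lambda>\<phi>. \<Sum>c\<in>Az. \<Sum>k\<in>K. \<epsilon> * (if \<phi> \<in> {lo c k..lo c k + 20 * \<epsilon>} then 1 else 0)) has_integral
      (\<Sum>c\<in>Az. \<Sum>k\<in>K. \<epsilon> * measure lborel ({0..2*pi} \<inter> {lo c k..lo c k + 20 * \<epsilon>}))) {0..2 * pi}"
    using fin by (intro has_integral_sum has_integral_mult_right ind) (auto simp: K_def)
  have "integral {0..2 * pi} (\<lambda>\<phi>. \<bar>g (P (\<phi> + s)) - g (P \<phi>)\<bar>) \<le> (\<Sum>c\<in>Az. \<Sum>k\<in>K. \<epsilon> * measure lborel ({0..2*pi} \<inter> {lo c k..lo c k + 20 * \<epsilon>}))"
  proof (rule has_integral_le[OF integrable_integral hi])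
    have "continuous_on {0..2 * pi} (\<lambda>\<phi>. g (P (\<phi> + s)))"
      by (rule continuous_on_compose2[OF gP[of UNIV]]) (auto intro!: continuous_intros)
    then show "(\<lambda>\<phi>. \<bar>g (P (\<phi> + s)) - g (P \<phi>)\<bar>) integrable_on {0..2 * pi}"
      by (intro integrable_continuous_interval continuous_intros gP)
  qed (rule pw)
  also have "\<dots> \<le> (\<Sum>c\<in>Az. \<Sum>k\<in>K. \<epsilon> * (20 * \<epsilon>))"
    using e by (intro sum_mono mult_left_mono cont) auto
  also have "\<dots> = 100 * \<epsilon>\<^sup>2 * real (card Az)" by (simp add: K_def power2_eq_square)
  finally show ?thesis unfolding P_def Az_def .
qed

section \<open>Fourier analysis on horizontal circles\<close>

lemma has_integral_cis:
  "((\<lambda>\<phi>. cis (real_of_int k * \<phi>)) has_integral of_real (if k = 0 then 2 * pi else 0)) {0..2 * pi}"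
proof (cases "k = 0")
  case True
  then show ?thesis using has_integral_const_real[of "1::complex" 0 "2*pi"] by (simp add: scaleR_conv_of_real)
next
  case False
  have "((\<lambda>\<phi>. cis (real_of_int k * \<phi>)) has_integral (cis (real_of_int k * (2 * pi)) / (\<i> * of_int k) - cis (real_of_int k * 0) / (\<i> * of_int k))) {0..2 * pi}"
  proof (rule fundamental_theorem_of_calculus)
    fix x :: real
    have "((\<lambda>\<phi>. cis (real_of_int k * \<phi>)) has_vector_derivative (real_of_int k *\<^sub>R (\<i> * cis (real_of_int k * x)))) (at x within {0..2*pi})"
      by (auto intro!: derivative_eq_intros simp: has_vector_derivative_def scaleR_conv_of_real mult_ac)
    then have "((\<lambda>\<phi>. cis (real_of_int k * \<phi>) / (\<i> * of_int k)) has_vector_derivative (real_of_int k *\<^sub>R (\<i> * cis (real_of_int k * x))) / (\<i> * of_int k)) (at x within {0..2*pi})"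
      by (rule has_vector_derivative_divide)
    then show "((\<lambda>\<phi>. cis (real_of_int k * \<phi>) / (\<i> * of_int k)) has_vector_derivative cis (real_of_int k * x)) (at x within {0..2*pi})"
      using False by (simp add: scaleR_conv_of_real)
  qed simp
  moreover have "cis (real_of_int k * (2 * pi)) = 1"
    using cis_multiple_2pi[of "of_int k"] by (simp add: mult_ac)
  ultimately show ?thesis using False by simp
qed

lemma continuous_on_cis_comp [continuous_intros]:
  "continuous_on S f \<Longrightarrow> continuous_on S (\<lambda>x. cis (f x))"
  unfolding cis_conv_exp by (intro continuous_intros)

text \<open>By duality: the pairing of the shift difference with a block is at most B times its L1
  norm. Orthogonality leaves the frequencies n of the block, each with the factor cis (- n s) - 1,
  whose real part is at most -1 by the hypothesis on the cosine, so the terms cannot cancel. The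
  block is taken on the unit circle, hence r^n appears once instead of squared. The pairing is
  computed for partial sums beyond the block, where it no longer depends on J, and passes to F by
  uniform convergence.\<close>

lemma shift_difference_energy:
  fixes F :: "complex \<Rightarrow> complex"
  assumes F: "continuous_on (cball 0 1) F"
    and R: "\<And>J z. cmod z \<le> 1 \<Longrightarrow> cmod (F z - (\<Sum>n<2^J. \<beta> n * z ^ n)) \<le> R J" "R \<longlonglongrightarrow> 0"
    and B: "\<And>w. cmod w = 1 \<Longrightarrow> cmod (dyadic_block \<beta> j w) \<le> B"
    and r: "0 \<le> r" "r \<le> 1"
    and s: "\<And>n. n \<in> {2^j..<2 * 2^j} \<Longrightarrow> cos (real n * s) \<le> 0"
  shows "2 * pi * (\<Sum>n\<in>{2^j..<2 * 2^j}. (cmod (\<beta> n))\<^sup>2 * r ^ n) \<le>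
     B * integral {0..2 * pi} (\<lambda>\<phi>. cmod (F (of_real r * cis (- (\<phi> + s))) - F (of_real r * cis (- \<phi>))))"
proof -
  define Bl where "Bl = {2^j..<2 * 2^j::nat}"
  define D where "D = (\<lambda>\<phi>. dyadic_block \<beta> j (cis (- \<phi>)))"
  define G where "G = (\<lambda>\<phi>. F (of_real r * cis (- (\<phi> + s))) - F (of_real r * cis (- \<phi>)))"
  define GJ where "GJ = (\<lambda>J \<phi>. (\<Sum>n<2^J. \<beta> n * (of_real r * cis (- (\<phi> + s))) ^ n) - (\<Sum>n<2^J. \<beta> n * (of_real r * cis (- \<phi>)) ^ n))"
  define X where "X = (\<Sum>n\<in>Bl. of_real (2 * pi * ((cmod (\<beta> n))\<^sup>2 * r ^ n)) * (cis (- (real n * s)) - 1))"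
  have nD: "cmod (D \<phi>) \<le> B" for \<phi> unfolding D_def by (rule B) simp
  have B0: "B \<ge> 0" using nD[of 0] norm_ge_zero order_trans by blast
  have disc: "cmod (of_real r * cis x) \<le> 1" for x using r by (simp add: norm_mult)
  have cG: "continuous_on {0..2*pi} G" unfolding G_def
    by (intro continuous_intros continuous_on_compose2[OF F]) (auto simp: norm_mult r)
  have cD: "continuous_on {0..2*pi} D" unfolding D_def dyadic_block_def by (intro continuous_intros)
  have cGJ: "continuous_on {0..2*pi} (GJ J)" for J unfolding GJ_def by (intro continuous_intros)
  have IJ: "((\<lambda>\<phi>. GJ J \<phi> * cnj (D \<phi>)) has_integral X) {0..2*pi}" if J: "j < J" for J
  proof -
    define co where "co = (\<lambda>n m. \<beta> n * of_real (r ^ n) * (cis (- (real n * s)) - 1) * cnj (\<beta> m))"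
    have "GJ J \<phi> * cnj (D \<phi>) = (\<Sum>n<2^J. \<Sum>m\<in>Bl. co n m * cis (real_of_int (int m - int n) * \<phi>))" for \<phi>
    proof -
      have "GJ J \<phi> = (\<Sum>n<2^J. \<beta> n * of_real (r ^ n) * (cis (- (real n * s)) - 1) * cis (- (real n * \<phi>)))"
        unfolding GJ_def sum_subtractf[symmetric]
      proof (intro sum.cong refl)
        fix n :: nat
        have "(of_real r * cis (- (\<phi> + s))) ^ n = of_real (r ^ n) * (cis (- (real n * s)) * cis (- (real n * \<phi>)))"
          by (simp add: power_mult_distrib Complex.DeMoivre cis_mult algebra_simps)
        moreover have "(of_real r * cis (- \<phi>)) ^ n = of_real (r ^ n) * cis (- (real n * \<phi>))"
          by (simp add: power_mult_distrib Complex.DeMoivre)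
        ultimately show "\<beta> n * (of_real r * cis (- (\<phi> + s))) ^ n - \<beta> n * (of_real r * cis (- \<phi>)) ^ n = \<beta> n * of_real (r ^ n) * (cis (- (real n * s)) - 1) * cis (- (real n * \<phi>))"
          by (simp only:) (simp add: algebra_simps)
      qed
      moreover have "cnj (D \<phi>) = (\<Sum>m\<in>Bl. cnj (\<beta> m) * cis (real m * \<phi>))"
        unfolding D_def dyadic_block_def Bl_def by (simp add: Complex.DeMoivre cis_cnj)
      ultimately have "GJ J \<phi> * cnj (D \<phi>) = (\<Sum>n<2^J. \<Sum>m\<in>Bl. (\<beta> n * of_real (r ^ n) * (cis (- (real n * s)) - 1) * cis (- (real n * \<phi>))) * (cnj (\<beta> m) * cis (real m * \<phi>)))"
        by (simp only: sum_product)
      also have "\<dots> = (\<Sum>n<2^J. \<Sum>m\<in>Bl. co n m * cis (real_of_int (int m - int n) * \<phi>))"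
      proof (intro sum.cong refl)
        fix n m :: nat
        have "cis (real_of_int (int m - int n) * \<phi>) = cis (- (real n * \<phi>)) * cis (real m * \<phi>)"
          by (simp add: cis_mult algebra_simps)
        then show "(\<beta> n * of_real (r ^ n) * (cis (- (real n * s)) - 1) * cis (- (real n * \<phi>))) * (cnj (\<beta> m) * cis (real m * \<phi>)) = co n m * cis (real_of_int (int m - int n) * \<phi>)"
          by (simp only: co_def mult_ac)
      qed
      finally show ?thesis .
    qed
    moreover have "((\<lambda>\<phi>. \<Sum>n<2^J. \<Sum>m\<in>Bl. co n m * cis (real_of_int (int m - int n) * \<phi>)) has_integral
        (\<Sum>n<2^J. \<Sum>m\<in>Bl. co n m * of_real (if int m - int n = 0 then 2 * pi else 0))) {0..2*pi}"
      by (intro has_integral_sum has_integral_mult_right has_integral_cis) (auto simp: Bl_def)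
    moreover have "(\<Sum>n<2^J. \<Sum>m\<in>Bl. co n m * of_real (if int m - int n = 0 then 2 * pi else 0)) = X"
    proof -
      have fB: "finite Bl" by (simp add: Bl_def)
      have sub: "Bl \<subseteq> {..<2^J}"
      proof -
        have "(2::nat) * 2^j \<le> 2^J" using power_increasing[of "Suc j" J "2::nat"] J by simp
        then show ?thesis by (auto simp: Bl_def)
      qed
      have "(\<Sum>m\<in>Bl. co n m * of_real (if int m - int n = 0 then 2 * pi else 0)) = (if n \<in> Bl then co n n * of_real (2 * pi) else 0)" for n
      proof -
        have "(\<Sum>m\<in>Bl. co n m * of_real (if int m - int n = 0 then 2 * pi else 0)) = (\<Sum>m\<in>Bl. if m = n then co n m * of_real (2 * pi) else 0)"
          by (intro sum.cong) auto
        then show ?thesis using fB by simp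
      qed
      then have "(\<Sum>n<2^J. \<Sum>m\<in>Bl. co n m * of_real (if int m - int n = 0 then 2 * pi else 0)) = (\<Sum>n\<in>{..<2^J} \<inter> Bl. co n n * of_real (2 * pi))"
        by (simp only: sum.inter_restrict[OF finite_lessThan])
      also have "{..<2^J} \<inter> Bl = Bl" using sub by auto
      also have "(\<Sum>n\<in>Bl. co n n * of_real (2 * pi)) = X"
        unfolding X_def
      proof (intro sum.cong refl)
        fix n
        have "of_real ((cmod (\<beta> n))\<^sup>2) = \<beta> n * cnj (\<beta> n)" by (rule complex_norm_square)
        then show "co n n * of_real (2 * pi) = of_real (2 * pi * ((cmod (\<beta> n))\<^sup>2 * r ^ n)) * (cis (- (real n * s)) - 1)"
          by (simp only: co_def of_real_mult) (simp only: mult_ac)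
      qed
      finally show ?thesis .
    qed
    ultimately show ?thesis by (simp only:)
  qed
  define Y where "Y = integral {0..2*pi} (\<lambda>\<phi>. G \<phi> * cnj (D \<phi>))"
  have iG: "(\<lambda>\<phi>. G \<phi> * cnj (D \<phi>)) integrable_on {0..2*pi}"
    by (intro integrable_continuous_interval continuous_intros cG cD)
  have "cmod (Y - X) \<le> (2 * R J * B) * (2 * pi)" if J: "j < J" for J
  proof -
    have RJ: "0 \<le> R J" by (rule order_trans[OF norm_ge_zero R(1)[of 0]]) simp
    have "((\<lambda>\<phi>. G \<phi> * cnj (D \<phi>) - GJ J \<phi> * cnj (D \<phi>)) has_integral (Y - X)) {0..2*pi}"
      unfolding Y_def by (intro has_integral_diff integrable_integral iG IJ J)
    moreover have "cmod (G \<phi> * cnj (D \<phi>) - GJ J \<phi> * cnj (D \<phi>)) \<le> 2 * R J * B" for \<phi>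
    proof -
      have "G \<phi> - GJ J \<phi> = (F (of_real r * cis (- (\<phi> + s))) - (\<Sum>n<2^J. \<beta> n * (of_real r * cis (- (\<phi> + s))) ^ n)) - (F (of_real r * cis (- \<phi>)) - (\<Sum>n<2^J. \<beta> n * (of_real r * cis (- \<phi>)) ^ n))"
        by (simp add: G_def GJ_def)
      also have "cmod \<dots> \<le> R J + R J"
        by (rule order.trans[OF norm_triangle_ineq4 add_mono[OF R(1)[OF disc] R(1)[OF disc]]])
      finally have "cmod (G \<phi> - GJ J \<phi>) \<le> 2 * R J" by simp
      then have "cmod (G \<phi> - GJ J \<phi>) * cmod (D \<phi>) \<le> 2 * R J * B"
        using nD RJ by (intro mult_mono) auto
      then show ?thesis by (simp add: norm_mult flip: left_diff_distrib)
    qed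
    moreover have "0 \<le> 2 * R J * B"
      using RJ B0 by simp
    ultimately show ?thesis using has_integral_bound[of "2 * R J * B" _ "Y - X" 0 "2*pi"] by simp
  qed
  then have "\<forall>\<^sub>F J in sequentially. cmod (Y - X) \<le> (2 * R J * B) * (2 * pi)"
    using eventually_gt_at_top[of j] by (elim eventually_mono) auto
  moreover have "(\<lambda>J. (2 * R J * B) * (2 * pi)) \<longlonglongrightarrow> (2 * 0 * B) * (2 * pi)"
    by (intro tendsto_intros R(2))
  ultimately have "cmod (Y - X) \<le> (2 * 0 * B) * (2 * pi)"
    by (intro tendsto_lowerbound[where F = sequentially]) auto
  then have YX: "Y = X" by simp
  have "2 * pi * (\<Sum>n\<in>Bl. (cmod (\<beta> n))\<^sup>2 * r ^ n) = (\<Sum>n\<in>Bl. 2 * pi * ((cmod (\<beta> n))\<^sup>2 * r ^ n) * 1)"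
    by (simp add: sum_distrib_left)
  also have "\<dots> \<le> (\<Sum>n\<in>Bl. 2 * pi * ((cmod (\<beta> n))\<^sup>2 * r ^ n) * (1 - cos (real n * s)))"
    using s r by (intro sum_mono mult_left_mono) (auto simp: Bl_def)
  also have "\<dots> = - Re X"
    unfolding X_def Re_sum sum_negf[symmetric] by (intro sum.cong refl) (simp add: algebra_simps)
  also have "\<dots> \<le> cmod X" using complex_Re_le_cmod[of "- X"] by simp
  also have "\<dots> \<le> integral {0..2*pi} (\<lambda>\<phi>. B * cmod (G \<phi>))"
    unfolding YX[symmetric] Y_def
  proof (rule integral_norm_bound_integral[OF iG])
    show "(\<lambda>\<phi>. B * cmod (G \<phi>)) integrable_on {0..2*pi}"
      by (intro integrable_continuous_interval continuous_intros cG)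
    show "cmod (G \<phi> * cnj (D \<phi>)) \<le> B * cmod (G \<phi>)" for \<phi>
      using nD[of \<phi>] by (simp add: norm_mult mult.commute[of B] mult_left_mono)
  qed
  also have "\<dots> = B * integral {0..2*pi} (\<lambda>\<phi>. cmod (G \<phi>))" by simp
  finally show ?thesis unfolding Bl_def G_def .
qed
lemma complex_slice_point:
  "Complex (slice_point z \<phi> $ 1) (- (slice_point z \<phi> $ 2)) = of_real (sqrt (1 - z\<^sup>2)) * cis (- \<phi>)"
  by (simp add: slice_point_def complex_eq_iff)

text \<open>The slices are 2 \<epsilon> apart and a box has height \<epsilon>, so no box is counted
  for two slices.\<close>

lemma sum_card_slices_le:
  fixes A :: "((real ^ 3) \<times> real) set"
  assumes A: "finite A" and e: "0 < \<epsilon>"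
  shows "(\<Sum>i\<in>{1..M}. card {c\<in>A. fst c $ 3 \<le> 2 * \<epsilon> * real i \<and> 2 * \<epsilon> * real i \<le> fst c $ 3 + \<epsilon>}) \<le> card A"
proof -
  let ?S = "\<lambda>i::nat. {c\<in>A. fst c $ 3 \<le> 2 * \<epsilon> * real i \<and> 2 * \<epsilon> * real i \<le> fst c $ 3 + \<epsilon>}"
  have disj: "?S i \<inter> ?S i' = {}" if "i < i'" for i i' :: nat
  proof (rule ccontr)
    assume "?S i \<inter> ?S i' \<noteq> {}"
    then obtain c where "c \<in> ?S i" "c \<in> ?S i'" by blast
    then have "fst c $ 3 \<le> 2 * \<epsilon> * real i" "2 * \<epsilon> * real i' \<le> fst c $ 3 + \<epsilon>" by simp_all
    moreover have "2 * \<epsilon> * (real i + 1) \<le> 2 * \<epsilon> * real i'" using that e by (intro mult_left_mono) auto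
    ultimately show False using e by (simp add: algebra_simps)
  qed
  have "(\<Sum>i\<in>{1..M}. card (?S i)) = card (\<Union>i\<in>{1..M}. ?S i)"
  proof (rule card_UN_disjoint[symmetric])
    show "\<forall>i\<in>{1..M}. \<forall>j\<in>{1..M}. i \<noteq> j \<longrightarrow> ?S i \<inter> ?S j = {}"
    proof (intro ballI impI)
      fix i i' :: nat assume "i \<noteq> i'"
      then consider "i < i'" | "i' < i" by linarith
      then show "?S i \<inter> ?S i' = {}" by cases (use disj[of i i'] disj[of i' i] in auto)
    qed
  qed (use A in auto)
  also have "\<dots> \<le> card A" by (rule card_mono[OF A]) auto
  finally show ?thesis .
qed

text \<open>Bernoulli's inequality for half of the exponent gives 1/2; squaring gives 1/4. For the
  full exponent it would only give 0.\<close>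

lemma one_minus_inverse_power_ge:
  assumes "j \<ge> 1"
  shows "(1 / 4 :: real) \<le> (1 - 1 / 2 ^ j) ^ (2 ^ j)"
proof -
  obtain i where i: "j = Suc i" using assms by (cases j) auto
  have "1 + real (2 ^ i) * (- (1 / 2 ^ j)) \<le> (1 + - (1 / 2 ^ j)) ^ (2 ^ i)"
    by (rule Bernoulli_inequality) simp
  then have "(1 / 2 :: real) \<le> (1 - 1 / 2 ^ j) ^ (2 ^ i)" by (simp add: i field_simps)
  then have "(1 / 2 :: real)\<^sup>2 \<le> ((1 - 1 / 2 ^ j) ^ (2 ^ i))\<^sup>2" by (rule power_mono) simp
  also have "\<dots> = (1 - 1 / 2 ^ j) ^ (2 ^ j)" by (simp add: i power_mult[symmetric] mult.commute)
  finally show ?thesis by (simp add: power2_eq_square)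
qed

text \<open>On each slice near the equator the shift difference has L1 norm at least of order E / B,
  and by \<open>slice_variation_le\<close> this requires N^2 E / B boxes up to a constant; summing
  over disjointly counted slices gives the bound. The energy E belongs to the complex function, so
  only the sum of the box counts for the real and the imaginary part is controlled.\<close>

theorem graph_cover_lower_bound:
  fixes F :: "complex \<Rightarrow> complex" and v :: "real ^ 3 \<Rightarrow> complex"
  assumes F: "continuous_on (cball 0 1) F"
    and v: "\<And>x. v x = F (Complex (x $ 1) (- (x $ 2)))"
    and vc: "continuous_on S2 v"
    and R: "\<And>J z. cmod z \<le> 1 \<Longrightarrow> cmod (F z - (\<Sum>n<2^J. \<beta> n * z ^ n)) \<le> R J" "R \<longlonglongrightarrow> 0"
    and B: "\<And>w. cmod w = 1 \<Longrightarrow> cmod (dyadic_block \<beta> j w) \<le> B" "B > 0"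
    and j: "j \<ge> 4" and N: "N = 2 ^ j"
    and A1: "finite A1" "sphere_graph (\<lambda>x. Re (v x)) \<subseteq> (\<Union>c\<in>A1. cbox c (c + (1 / real N) *\<^sub>R One))"
    and A2: "finite A2" "sphere_graph (\<lambda>x. Im (v x)) \<subseteq> (\<Union>c\<in>A2. cbox c (c + (1 / real N) *\<^sub>R One))"
  shows "(real N)\<^sup>2 * sqrt (real N) * (\<Sum>n\<in>{N..<2*N}. (cmod (\<beta> n))\<^sup>2) / (800 * B) \<le> real (card A1) + real (card A2)"
proof -
  define \<epsilon> where "\<epsilon> = 1 / real N"
  define E where "E = (\<Sum>n\<in>{N..<2*N}. (cmod (\<beta> n))\<^sup>2)"
  \<comment> \<open>The heights 2 i / N with i \<le> M do not exceed 1 / sqrt N, which is the band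
    where r^n is bounded below on the block.\<close>
  define M where "M = nat \<lfloor>sqrt (real N) / 2\<rfloor>"
  \<comment> \<open>Chosen so that n s lies in [pi / 2, pi] for every n of the block.\<close>
  define s where "s = pi / (2 * real N)"
  have N16: "real N \<ge> 16"
    using power_increasing[of 4 j "2::real"] j by (simp add: N)
  have N0: "real N > 0" using N16 by simp
  have sN: "sqrt (real N) \<ge> 4" using real_sqrt_le_mono[OF N16] real_sqrt_abs[of 4] by simp
  have e: "0 < \<epsilon>" "\<epsilon> \<le> 1 / 10" using N16 by (auto simp: \<epsilon>_def field_simps)
  have E0: "E \<ge> 0" unfolding E_def by (rule sum_nonneg) simp
  have s0: "0 \<le> s" "s \<le> 2 * \<epsilon>"
    using N0 pi_less_4 by (auto simp: s_def \<epsilon>_def field_simps)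
  have scos: "cos (real n * s) \<le> 0" if "n \<in> {N..<2 * N}" for n
  proof -
    have "real N * s \<le> real n * s" "real n * s \<le> real (2 * N) * s"
      using that s0 by (auto intro!: mult_right_mono)
    moreover have "real N * s = pi / 2" "real (2 * N) * s = pi" using N0 by (auto simp: s_def field_simps)
    ultimately have l: "pi / 2 \<le> real n * s" "real n * s \<le> pi" by auto
    have "cos (real n * s) \<le> cos (pi / 2)" by (rule cos_monotone_0_pi_le) (use l in auto)
    then show ?thesis by simp
  qed
  have M: "sqrt (real N) / 4 \<le> real M"
  proof -
    have "sqrt (real N) / 2 < real_of_int \<lfloor>sqrt (real N) / 2\<rfloor> + 1" by (rule real_of_int_floor_add_one_gt)
    moreover have "real M = real_of_int \<lfloor>sqrt (real N) / 2\<rfloor>" unfolding M_def using sN by simp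
    ultimately show ?thesis using sN by linarith
  qed
  define g1 where "g1 = (\<lambda>x. Re (v x))"
  define g2 where "g2 = (\<lambda>x. Im (v x))"
  define V where "V = (\<lambda>(g :: real ^ 3 \<Rightarrow> real) z. integral {0..2 * pi} (\<lambda>\<phi>. \<bar>g (slice_point z (\<phi> + s)) - g (slice_point z \<phi>)\<bar>))"
  define S where "S = (\<lambda>A z. {c\<in>A. fst c $ 3 \<le> z \<and> z \<le> fst c $ 3 + \<epsilon>} :: ((real ^ 3) \<times> real) set)"
  have gc: "continuous_on S2 g1" "continuous_on S2 g2" unfolding g1_def g2_def by (intro continuous_intros vc)+
  have slice: "E * pi / (2 * B) \<le> 100 * \<epsilon>\<^sup>2 * (real (card (S A1 z)) + real (card (S A2 z)))" if i: "i \<in> {1..M}" "z = 2 * \<epsilon> * real i" for i z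
  proof -
    have "real i \<le> real M" using i by simp
    also have "real M \<le> sqrt (real N) / 2" unfolding M_def by (rule of_nat_floor) (use sN in simp)
    finally have "z \<le> 2 * \<epsilon> * (sqrt (real N) / 2)" unfolding i(2) using e by (intro mult_left_mono) auto
    also have "\<dots> = 1 / sqrt (real N)" using N0 by (simp add: \<epsilon>_def real_div_sqrt field_simps)
    finally have zs: "z \<le> 1 / sqrt (real N)" .
    have z0: "0 \<le> z" using i e by simp
    have "1 / sqrt (real N) \<le> 1 / 4" using sN N0 by (intro divide_left_mono) auto
    then have z: "\<bar>z\<bar> \<le> 1 / 2" "\<bar>z\<bar> \<le> 1" using zs z0 by auto
    have "z\<^sup>2 \<le> (1 / sqrt (real N))\<^sup>2" using zs z0 by (rule power_mono)
    also have "\<dots> = 1 / real N" using N0 by (simp add: power_divide)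
    finally have z2: "z\<^sup>2 \<le> 1 / real N" .
    define r where "r = sqrt (1 - z\<^sup>2)"
    have z1: "z\<^sup>2 \<le> 1" using z(2) by (simp add: abs_square_le_1)
    have r: "0 \<le> r" "r \<le> 1" using z1 by (auto simp: r_def)
    have "1 / 4 \<le> r ^ n" if n: "n \<in> {N..<2*N}" for n
    proof -
      have "1 / 4 \<le> (1 - 1 / real N) ^ N" using one_minus_inverse_power_ge[of j] j by (simp add: N)
      also have "\<dots> \<le> (1 - z\<^sup>2) ^ N" using z2 N16 by (intro power_mono) (auto simp: field_simps)
      also have "\<dots> = r ^ (2 * N)" using z1 by (simp add: r_def power_mult)
      also have "\<dots> \<le> r ^ n" using n r by (intro power_decreasing) auto
      finally show ?thesis .
    qed
    then have "(\<Sum>n\<in>{N..<2*N}. (cmod (\<beta> n))\<^sup>2 * (1 / 4)) \<le> (\<Sum>n\<in>{N..<2*N}. (cmod (\<beta> n))\<^sup>2 * r ^ n)"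
      by (intro sum_mono mult_left_mono) auto
    then have "E / 4 \<le> (\<Sum>n\<in>{N..<2*N}. (cmod (\<beta> n))\<^sup>2 * r ^ n)"
      by (simp add: E_def sum_divide_distrib)
    then have "2 * pi * (E / 4) \<le> 2 * pi * (\<Sum>n\<in>{N..<2*N}. (cmod (\<beta> n))\<^sup>2 * r ^ n)"
      by (intro mult_left_mono) auto
    also have "\<dots> \<le> B * integral {0..2 * pi} (\<lambda>\<phi>. cmod (F (of_real r * cis (- (\<phi> + s))) - F (of_real r * cis (- \<phi>))))"
      unfolding N by (rule shift_difference_energy[OF F R B(1) r]) (use scos in \<open>auto simp: N\<close>)
    also have "(\<lambda>\<phi>. cmod (F (of_real r * cis (- (\<phi> + s))) - F (of_real r * cis (- \<phi>)))) = (\<lambda>\<phi>. cmod (v (slice_point z (\<phi> + s)) - v (slice_point z \<phi>)))"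
      unfolding v complex_slice_point r_def ..
    also have "integral {0..2 * pi} (\<lambda>\<phi>. cmod (v (slice_point z (\<phi> + s)) - v (slice_point z \<phi>))) \<le> V g1 z + V g2 z"
    proof -
      have c: "continuous_on {0..2*pi} (\<lambda>\<phi>. h (slice_point z (\<phi> + s)))" "continuous_on {0..2*pi} (\<lambda>\<phi>. h (slice_point z \<phi>))"
        if "continuous_on S2 h" for h :: "real ^ 3 \<Rightarrow> 'b::real_normed_vector"
      proof -
        have hz: "continuous_on UNIV (\<lambda>\<phi>. h (slice_point z \<phi>))"
          by (rule continuous_on_compose2[OF that continuous_on_slice_point]) (use slice_point_in_S2[OF z(2)] in auto)
        show "continuous_on {0..2*pi} (\<lambda>\<phi>. h (slice_point z (\<phi> + s)))"
          by (rule continuous_on_compose2[OF hz]) (auto intro!: continuous_intros)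
        show "continuous_on {0..2*pi} (\<lambda>\<phi>. h (slice_point z \<phi>))"
          using hz by (rule continuous_on_subset) simp
      qed
      have i: "(\<lambda>\<phi>. \<bar>g (slice_point z (\<phi> + s)) - g (slice_point z \<phi>)\<bar>) integrable_on {0..2*pi}" if "continuous_on S2 g" for g :: "real ^ 3 \<Rightarrow> real"
        by (intro integrable_continuous_interval continuous_intros c that)
      have "integral {0..2 * pi} (\<lambda>\<phi>. cmod (v (slice_point z (\<phi> + s)) - v (slice_point z \<phi>))) \<le>
          integral {0..2 * pi} (\<lambda>\<phi>. \<bar>g1 (slice_point z (\<phi> + s)) - g1 (slice_point z \<phi>)\<bar> + \<bar>g2 (slice_point z (\<phi> + s)) - g2 (slice_point z \<phi>)\<bar>)"
      proof (rule integral_le)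
        show "(\<lambda>\<phi>. cmod (v (slice_point z (\<phi> + s)) - v (slice_point z \<phi>))) integrable_on {0..2 * pi}"
          by (intro integrable_continuous_interval continuous_intros c vc)
        show "(\<lambda>\<phi>. \<bar>g1 (slice_point z (\<phi> + s)) - g1 (slice_point z \<phi>)\<bar> + \<bar>g2 (slice_point z (\<phi> + s)) - g2 (slice_point z \<phi>)\<bar>) integrable_on {0..2 * pi}"
          by (intro integrable_add i gc)
        show "cmod (v (slice_point z (\<phi> + s)) - v (slice_point z \<phi>)) \<le> \<bar>g1 (slice_point z (\<phi> + s)) - g1 (slice_point z \<phi>)\<bar> + \<bar>g2 (slice_point z (\<phi> + s)) - g2 (slice_point z \<phi>)\<bar>" for \<phi>
          using cmod_le[of "v (slice_point z (\<phi> + s)) - v (slice_point z \<phi>)"] by (simp add: g1_def g2_def)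
      qed
      also have "\<dots> = V g1 z + V g2 z" unfolding V_def by (intro integral_add i gc)
      finally show ?thesis .
    qed
    also have "V g1 z \<le> 100 * \<epsilon>\<^sup>2 * real (card (S A1 z))"
      unfolding V_def S_def by (rule slice_variation_le[OF gc(1) A1(1) _ e z(1) s0]) (use A1(2) in \<open>simp add: g1_def \<epsilon>_def\<close>)
    also have "V g2 z \<le> 100 * \<epsilon>\<^sup>2 * real (card (S A2 z))"
      unfolding V_def S_def by (rule slice_variation_le[OF gc(2) A2(1) _ e z(1) s0]) (use A2(2) in \<open>simp add: g2_def \<epsilon>_def\<close>)
    finally have "2 * pi * (E / 4) \<le> B * (100 * \<epsilon>\<^sup>2 * real (card (S A1 z)) + 100 * \<epsilon>\<^sup>2 * real (card (S A2 z)))"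
      using B(2) by (simp add: mult_left_mono)
    then show ?thesis using B(2) by (simp add: field_simps)
  qed
  have "real M * (E * pi / (2 * B)) = (\<Sum>i\<in>{1..M}. E * pi / (2 * B))" by simp
  also have "\<dots> \<le> (\<Sum>i\<in>{1..M}. 100 * \<epsilon>\<^sup>2 * (real (card (S A1 (2 * \<epsilon> * real i))) + real (card (S A2 (2 * \<epsilon> * real i)))))"
    by (intro sum_mono slice) auto
  also have "\<dots> = 100 * \<epsilon>\<^sup>2 * (real (\<Sum>i\<in>{1..M}. card (S A1 (2 * \<epsilon> * real i))) + real (\<Sum>i\<in>{1..M}. card (S A2 (2 * \<epsilon> * real i))))"
    by (simp add: sum_distrib_left[symmetric] sum.distrib)
  also have "\<dots> \<le> 100 * \<epsilon>\<^sup>2 * (real (card A1) + real (card A2))"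
    unfolding S_def using sum_card_slices_le[OF A1(1) e(1)] sum_card_slices_le[OF A2(1) e(1)]
    by (intro mult_left_mono add_mono of_nat_mono) auto
  finally have fin: "real M * (E * pi / (2 * B)) \<le> 100 * \<epsilon>\<^sup>2 * (real (card A1) + real (card A2))" .
  \<comment> \<open>Here pi is replaced by 1; the factors 4, 2 and 100 make up the 800.\<close>
  have "sqrt (real N) / 4 * (E * 1 / (2 * B)) \<le> real M * (E * pi / (2 * B))"
    using M E0 B(2) pi_gt3 sN by (intro mult_mono divide_right_mono mult_left_mono) auto
  with fin have "sqrt (real N) / 4 * (E * 1 / (2 * B)) \<le> 100 * \<epsilon>\<^sup>2 * (real (card A1) + real (card A2))" by linarith
  then have "(real N)\<^sup>2 * (sqrt (real N) / 4 * (E * 1 / (2 * B))) \<le> (real N)\<^sup>2 * (100 * \<epsilon>\<^sup>2 * (real (card A1) + real (card A2)))"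
    by (rule mult_left_mono) simp
  also have "\<dots> = 100 * (real (card A1) + real (card A2))" using N0 by (simp add: \<epsilon>_def power_divide)
  finally show ?thesis unfolding E_def[symmetric] by (simp add: field_simps)
qed

section \<open>Moments on the sphere\<close>

definition sphere_weight :: "real \<times> real \<Rightarrow> real" where
  "sphere_weight = (\<lambda>(\<theta>, \<phi>). indicator ({0..pi} \<times> {0..<2 * pi}) (\<theta>, \<phi>) * sin \<theta> / (4 * pi))"

lemma sphere_weight_nonneg: "0 \<le> sphere_weight p"
  by (cases p) (auto simp: sphere_weight_def indicator_def intro!: divide_nonneg_pos sin_ge_zero)

lemma sphere_weight_le: "sphere_weight p \<le> indicator ({0..pi} \<times> {0..<2 * pi}) p"
proof (cases p)
  case (Pair \<theta> \<phi>)
  have "sin \<theta> \<le> 4 * pi" using pi_gt3 sin_le_one[of \<theta>] by linarith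
  then have "sin \<theta> / (4 * pi) \<le> 1" by simp
  then show ?thesis using Pair by (auto simp: sphere_weight_def indicator_def)
qed

lemma borel_measurable_sphere_weight [measurable]: "sphere_weight \<in> borel_measurable borel"
proof -
  have *: "{0..pi} \<times> {0..<2 * pi} \<in> sets (borel :: (real \<times> real) measure)" by (intro borel_Times) auto
  have "(\<lambda>p. indicat_real ({0..pi} \<times> {0..<2 * pi}) p * sin (fst p) / (4 * pi)) \<in> borel_measurable borel"
    by (intro borel_measurable_divide borel_measurable_times borel_measurable_indicator[OF *]
        borel_measurable_const borel_measurable_continuous_onI continuous_intros)
  also have "(\<lambda>p. indicat_real ({0..pi} \<times> {0..<2 * pi}) p * sin (fst p) / (4 * pi)) = sphere_weight"
    by (auto simp: sphere_weight_def fun_eq_iff)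
  finally show ?thesis .
qed

lemma continuous_on_sph_point: "continuous_on S (\<lambda>p. sph_point (fst p) (snd p))"
proof -
  have "(\<lambda>p. sph_point (fst p) (snd p)) = (\<lambda>p. (sin (fst p) * cos (snd p)) *\<^sub>R axis 1 1 + (sin (fst p) * sin (snd p)) *\<^sub>R axis 2 1 + cos (fst p) *\<^sub>R axis 3 1)"
    by (simp add: fun_eq_iff sph_point_def vec_eq_iff forall_3 axis_def)
  then show ?thesis by (simp only:) (intro continuous_intros)
qed

lemma measurable_sph_point [measurable]:
  "(\<lambda>p. sph_point (fst p) (snd p)) \<in> measurable borel (restrict_space borel S2)"
  using continuous_on_sph_point[of UNIV] sph_point_in_S2
  by (intro measurable_restrict_space2 borel_measurable_continuous_onI) auto

lemma sphere_measure_eq: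
  "sphere_measure = distr (density lborel (\<lambda>p. ennreal (sphere_weight p))) (restrict_space borel S2) (\<lambda>p. sph_point (fst p) (snd p))"
  unfolding sphere_measure_def sphere_weight_def by (simp add: case_prod_unfold)

lemma sets_sphere_measure [measurable_cong]: "sets sphere_measure = sets (restrict_space borel S2)"
  by (simp add: sphere_measure_eq)

lemma space_sphere_measure: "space sphere_measure = S2"
  by (simp add: sphere_measure_eq space_restrict_space)

lemma finite_measure_sphere: "finite_measure sphere_measure"
proof
  have "emeasure sphere_measure (space sphere_measure) = (\<integral>\<^sup>+p. ennreal (sphere_weight p) \<partial>lborel)"
  proof -
    have "S2 \<in> sets (restrict_space borel S2)"
      using sets.top[of "restrict_space borel S2"] by (simp add: space_restrict_space)
    then have "emeasure sphere_measure S2 = emeasure (density lborel (\<lambda>p. ennreal (sphere_weight p))) ((\<lambda>p. sph_point (fst p) (snd p)) -` S2 \<inter> space (density lborel (\<lambda>p. ennreal (sphere_weight p))))"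
      unfolding sphere_measure_eq by (intro emeasure_distr) (simp_all add: measurable_sph_point)
    also have "(\<lambda>p. sph_point (fst p) (snd p)) -` S2 \<inter> space (density lborel (\<lambda>p. ennreal (sphere_weight p))) = UNIV"
      using sph_point_in_S2 unfolding space_density by auto
    finally show ?thesis unfolding space_sphere_measure by (simp add: emeasure_density)
  qed
  also have "\<dots> \<le> (\<integral>\<^sup>+p. indicator ({0..pi} \<times> {0..<2 * pi}) p \<partial>lborel)"
    using ennreal_leI[OF sphere_weight_le] by (intro nn_integral_mono) (simp add: ennreal_indicator)
  also have "\<dots> \<le> (\<integral>\<^sup>+p. indicator (cbox (0, 0) (pi, 2 * pi)) p \<partial>lborel)"
    by (intro nn_integral_mono) (auto simp: indicator_def cbox_Pair_eq)
  also have "\<dots> = emeasure lborel (cbox (0, 0) (pi, 2 * pi))" by (intro nn_integral_indicator) auto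
  also have "\<dots> < \<infinity>" by (rule emeasure_lborel_cbox_finite)
  finally show "emeasure sphere_measure (space sphere_measure) \<noteq> \<infinity>" by simp
qed

lemma integral_sphere_measure:
  fixes h :: "real ^ 3 \<Rightarrow> 'b::{banach, second_countable_topology}"
  assumes h: "h \<in> borel_measurable sphere_measure"
  shows "(\<integral>x. h x \<partial>sphere_measure) = (\<integral>p. sphere_weight p *\<^sub>R h (sph_point (fst p) (snd p)) \<partial>lborel)"
proof -
  have h': "h \<in> borel_measurable (restrict_space borel S2)" using h by (simp add: measurable_cong_sets[OF sets_sphere_measure refl])
  have hm: "(\<lambda>p. h (sph_point (fst p) (snd p))) \<in> borel_measurable borel"
    by (rule measurable_compose[OF measurable_sph_point h'])
  have "(\<integral>x. h x \<partial>sphere_measure) = (\<integral>p. h (sph_point (fst p) (snd p)) \<partial>density lborel (\<lambda>p. ennreal (sphere_weight p)))"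
    unfolding sphere_measure_eq by (rule integral_distr[OF _ h']) (simp add: measurable_sph_point)
  also have "\<dots> = (\<integral>p. sphere_weight p *\<^sub>R h (sph_point (fst p) (snd p)) \<partial>lborel)"
    using hm by (intro integral_density) (auto simp: sphere_weight_nonneg)
  finally show ?thesis .
qed

lemma borel_measurable_sphere_continuous:
  assumes "continuous_on S2 h"
  shows "h \<in> borel_measurable sphere_measure"
  using borel_measurable_continuous_on_restrict[OF assms] by (simp add: measurable_cong_sets[OF sets_sphere_measure refl])

lemma bounded_sphere_continuous:
  assumes "continuous_on S2 (h :: real ^ 3 \<Rightarrow> 'b::real_normed_vector)"
  obtains B where "B > 0" "\<And>x. x \<in> S2 \<Longrightarrow> norm (h x) \<le> B"
proof -
  have "bounded (h ` S2)" by (intro compact_imp_bounded compact_continuous_image assms compact_sphere)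
  then show thesis using that by (auto simp: bounded_pos)
qed

lemma integrable_sphere_continuous:
  fixes h :: "real ^ 3 \<Rightarrow> 'b::{banach, second_countable_topology}"
  assumes "continuous_on S2 h"
  shows "integrable sphere_measure h"
proof -
  obtain B where "\<And>x. x \<in> S2 \<Longrightarrow> norm (h x) \<le> B" using bounded_sphere_continuous[OF assms] by blast
  then show ?thesis
    by (intro finite_measure.integrable_const_bound[OF finite_measure_sphere, of _ B] borel_measurable_sphere_continuous assms)
      (auto simp: space_sphere_measure intro!: AE_I2)
qed

text \<open>Monomials in x_1 + i x_2, x_1 - i x_2 and x_3. They span the complex polynomials,
  conjugation exchanges a and b, and on the sphere the beam of degree n is a multiple of
  \<open>mon 0 n 0\<close>.\<close>

definition mon :: "nat \<Rightarrow> nat \<Rightarrow> nat \<Rightarrow> real ^ 3 \<Rightarrow> complex" where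
  "mon a b c x = Complex (x $ 1) (x $ 2) ^ a * Complex (x $ 1) (- (x $ 2)) ^ b * of_real (x $ 3) ^ c"

lemma mon_mult: "mon a b c x * mon a' b' c' x = mon (a + a') (b + b') (c + c') x"
  by (simp add: mon_def power_add mult_ac)

lemma continuous_on_mon [continuous_intros]: "continuous_on S (mon a b c)"
  unfolding mon_def Complex_eq by (intro continuous_intros)

lemma mon_sph_point:
  "mon a b c (sph_point \<theta> \<phi>) = of_real (sin \<theta> ^ (a + b) * cos \<theta> ^ c) * cis (real_of_int (int a - int b) * \<phi>)"
proof -
  have "Complex (sph_point \<theta> \<phi> $ 1) (sph_point \<theta> \<phi> $ 2) = of_real (sin \<theta>) * cis \<phi>"
       "Complex (sph_point \<theta> \<phi> $ 1) (- (sph_point \<theta> \<phi> $ 2)) = of_real (sin \<theta>) * cis (- \<phi>)"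
       "sph_point \<theta> \<phi> $ 3 = cos \<theta>"
    by (simp_all add: sph_point_def complex_eq_iff)
  moreover have "cis (real_of_int (int a - int b) * \<phi>) = cis (real a * \<phi>) * cis (- (real b * \<phi>))"
    by (simp add: cis_mult algebra_simps)
  ultimately show ?thesis
    unfolding mon_def by (simp add: power_mult_distrib Complex.DeMoivre power_add mult_ac)
qed

text \<open>What remains of a monomial with equal exponents a = b after the azimuthal integration:
  sin^(2 a) times the density sin, and 1/2 is 2 pi / (4 pi).\<close>

definition polar_moment :: "nat \<Rightarrow> nat \<Rightarrow> real" where
  "polar_moment a c = integral {0..pi} (\<lambda>\<theta>. sin \<theta> ^ (2 * a + 1) * cos \<theta> ^ c) / 2"

lemma integral_mon:
  "(\<integral>x. mon a b c x \<partial>sphere_measure) = (if a = b then of_real (polar_moment a c) else 0)"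
proof -
  let ?f = "\<lambda>\<theta>::real. (indicator {0..pi} \<theta> * (sin \<theta> * (sin \<theta> ^ (a + b) * cos \<theta> ^ c)) :: real)"
  let ?g = "\<lambda>\<phi>::real. indicator {0..<2 * pi} \<phi> *\<^sub>R (cis (real_of_int (int a - int b) * \<phi>))"
  let ?h = "\<lambda>p. sphere_weight p *\<^sub>R mon a b c (sph_point (fst p) (snd p))"
  have h: "?h (\<theta>, \<phi>) = of_real (?f \<theta> / (4 * pi)) * ?g \<phi>" for \<theta> \<phi>
    by (simp add: mon_sph_point sphere_weight_def indicator_times scaleR_conv_of_real mult_ac indicator_def)
  have int: "integrable lborel ?h"
  proof (rule integrableI_bounded_set[where A = "cbox (0, 0) (pi, 2 * pi)" and B = 1])
    have "continuous_on UNIV (\<lambda>p. mon a b c (sph_point (fst p) (snd p)))"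
      by (rule continuous_on_compose2[OF continuous_on_mon[of UNIV] continuous_on_sph_point]) auto
    then show "?h \<in> borel_measurable lborel"
      by (intro borel_measurable_scaleR) (simp_all add: borel_measurable_continuous_onI)
    show "emeasure lborel (cbox (0::real, 0::real) (pi, 2 * pi)) < \<infinity>" by (rule emeasure_lborel_cbox_finite)
    have "norm (?h p) \<le> 1" for p
    proof -
      have "norm (mon a b c (sph_point (fst p) (snd p))) \<le> 1"
        unfolding mon_sph_point norm_mult norm_of_real norm_cis abs_mult power_abs
        by (simp add: mult_le_one power_le_one)
      moreover have "sphere_weight p \<le> 1" by (rule order_trans[OF sphere_weight_le indicator_le_1])
      ultimately show ?thesis using sphere_weight_nonneg[of p] by (simp add: mult_le_one)
    qed
    then show "AE p in lborel. p \<in> cbox (0, 0) (pi, 2 * pi) \<longrightarrow> norm (?h p) \<le> 1" by simp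
    show "AE p in lborel. p \<notin> cbox (0, 0) (pi, 2 * pi) \<longrightarrow> ?h p = 0"
      by (auto simp: sphere_weight_def indicator_def cbox_Pair_eq)
  qed simp
  have "(\<integral>x. mon a b c x \<partial>sphere_measure) = (\<integral>p. ?h p \<partial>(lborel \<Otimes>\<^sub>M lborel))"
    unfolding lborel_prod by (intro integral_sphere_measure borel_measurable_sphere_continuous continuous_intros)
  also have "\<dots> = (\<integral>\<theta>. \<integral>\<phi>. ?h (\<theta>, \<phi>) \<partial>lborel \<partial>lborel)"
    by (rule lborel_pair.integral_fst'[symmetric]) (simp add: lborel_prod int)
  also have "\<dots> = (\<integral>\<theta>. of_real (?f \<theta> / (4 * pi)) * (\<integral>\<phi>. ?g \<phi> \<partial>lborel) \<partial>lborel)"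
    unfolding h by (intro Bochner_Integration.integral_cong refl integral_mult_right_zero)
  also have "\<dots> = of_real ((\<integral>\<theta>. ?f \<theta> \<partial>lborel) / (4 * pi)) * (\<integral>\<phi>. ?g \<phi> \<partial>lborel)"
    by (simp flip: of_real_divide add: integral_mult_left_zero)
  also have "(\<integral>\<phi>. ?g \<phi> \<partial>lborel) = (\<integral>\<phi>. indicator {0..2 * pi} \<phi> *\<^sub>R (cis (real_of_int (int a - int b) * \<phi>)) \<partial>lborel)"
  proof (rule integral_cong_AE)
    show "AE \<phi> in lborel. ?g \<phi> = indicator {0..2 * pi} \<phi> *\<^sub>R (cis (real_of_int (int a - int b) * \<phi>))"
      using AE_lborel_singleton[of "2 * pi"] by eventually_elim (auto simp: indicator_def)
    have [measurable]: "(\<lambda>\<phi>. cis (real_of_int (int a - int b) * \<phi>)) \<in> borel_measurable borel"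
      by (intro borel_measurable_continuous_onI continuous_intros)
    show "?g \<in> borel_measurable lborel" "(\<lambda>\<phi>. indicat_real {0..2 * pi} \<phi> *\<^sub>R (cis (real_of_int (int a - int b) * \<phi>))) \<in> borel_measurable lborel"
      by measurable
  qed
  also have "\<dots> = integral {0..2 * pi} (\<lambda>\<phi>. cis (real_of_int (int a - int b) * \<phi>))"
    unfolding set_lebesgue_integral_def[symmetric]
    by (rule set_borel_integral_eq_integral(2)) (auto intro!: borel_integrable_atLeastAtMost' continuous_intros)
  also have "\<dots> = of_real (if int a - int b = 0 then 2 * pi else 0)"
    by (rule integral_unique[OF has_integral_cis])
  finally have main: "(\<integral>x. mon a b c x \<partial>sphere_measure) = of_real ((\<integral>\<theta>. ?f \<theta> \<partial>lborel) / (4 * pi)) * of_real (if int a - int b = 0 then 2 * pi else 0)" .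
  show ?thesis
  proof (cases "a = b")
    case True
    have "(\<integral>\<theta>. ?f \<theta> \<partial>lborel) = (LINT \<theta>:{0..pi}|lborel. sin \<theta> ^ (2 * a + 1) * cos \<theta> ^ c)"
      unfolding set_lebesgue_integral_def using True by (simp add: mult_2 mult.assoc)
    also have "\<dots> = integral {0..pi} (\<lambda>\<theta>. sin \<theta> ^ (2 * a + 1) * cos \<theta> ^ c)"
      by (rule set_borel_integral_eq_integral(2)) (auto intro!: borel_integrable_atLeastAtMost' continuous_intros)
    finally show ?thesis using main True by (simp add: polar_moment_def)
  qed (use main in simp)
qed

text \<open>The first identity integrates the derivative of sin^(2 a) cos^(c + 1) over [0, pi],
  whose boundary values vanish for a \<ge> 1. For c = 1 the integrand has a power of the sine as
  antiderivative.\<close>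

lemma polar_moment_parts:
  shows polar_moment_sin: "a \<ge> 1 \<Longrightarrow> real (c + 1) * polar_moment a c = 2 * real a * polar_moment (a - 1) (c + 2)"
    and polar_moment_odd: "polar_moment a 1 = 0"
    and polar_moment_pythagoras: "polar_moment a (c + 2) + polar_moment (a + 1) c = polar_moment a c"
    and polar_moment_0_0: "polar_moment 0 0 = 1"
proof -
  have cont: "(\<lambda>\<theta>. sin \<theta> ^ a * cos \<theta> ^ c) integrable_on {0..pi}" for a c
    by (intro integrable_continuous_interval continuous_intros)
  show "real (c + 1) * polar_moment a c = 2 * real a * polar_moment (a - 1) (c + 2)" if a: "a \<ge> 1"
  proof -
    obtain a' where a': "a = Suc a'" using a by (cases a) auto
    have "((\<lambda>\<theta>. 2 * real a * (sin \<theta> ^ (2 * (a - 1) + 1) * cos \<theta> ^ (c + 2)) - real (c + 1) * (sin \<theta> ^ (2 * a + 1) * cos \<theta> ^ c)) has_integral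
        (sin pi ^ (2 * a) * cos pi ^ (c + 1) - sin 0 ^ (2 * a) * cos 0 ^ (c + 1))) {0..pi}"
    proof (rule fundamental_theorem_of_calculus)
      fix x :: real
      have "((\<lambda>\<theta>. sin \<theta> ^ (2 * a) * cos \<theta> ^ (c + 1)) has_real_derivative
         2 * real a * (sin x ^ (2 * (a - 1) + 1) * cos x ^ (c + 2)) - real (c + 1) * (sin x ^ (2 * a + 1) * cos x ^ c)) (at x within {0..pi})"
        by (rule derivative_eq_intros refl)+ (simp add: a' algebra_simps)
      then show "((\<lambda>\<theta>. sin \<theta> ^ (2 * a) * cos \<theta> ^ (c + 1)) has_vector_derivative
         2 * real a * (sin x ^ (2 * (a - 1) + 1) * cos x ^ (c + 2)) - real (c + 1) * (sin x ^ (2 * a + 1) * cos x ^ c)) (at x within {0..pi})"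
        by (simp add: has_real_derivative_iff_has_vector_derivative)
    qed simp
    moreover have "((\<lambda>\<theta>. 2 * real a * (sin \<theta> ^ (2 * (a - 1) + 1) * cos \<theta> ^ (c + 2)) - real (c + 1) * (sin \<theta> ^ (2 * a + 1) * cos \<theta> ^ c)) has_integral
        2 * real a * (2 * polar_moment (a - 1) (c + 2)) - real (c + 1) * (2 * polar_moment a c)) {0..pi}"
      unfolding polar_moment_def by (simp only: nonzero_mult_div_cancel_left times_divide_eq_right zero_neq_numeral not_False_eq_True)
        (intro has_integral_diff has_integral_mult_right integrable_integral cont)
    ultimately have "2 * real a * (2 * polar_moment (a - 1) (c + 2)) - real (c + 1) * (2 * polar_moment a c) = 0"
      using a by (auto dest: has_integral_unique simp: power_0_left)
    then show ?thesis by (simp add: algebra_simps)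
  qed
  show "polar_moment a 1 = 0"
  proof -
    have "((\<lambda>\<theta>. sin \<theta> ^ (2 * a + 1) * cos \<theta> ^ 1) has_integral (sin pi ^ (2 * a + 2) / real (2 * a + 2) - sin 0 ^ (2 * a + 2) / real (2 * a + 2))) {0..pi}"
    proof (rule fundamental_theorem_of_calculus)
      fix x :: real
      have "((\<lambda>\<theta>. sin \<theta> ^ (2 * a + 2) / real (2 * a + 2)) has_real_derivative (real (2 * a + 2) * (cos x * sin x ^ (2 * a + 1))) / real (2 * a + 2)) (at x within {0..pi})"
        by (intro DERIV_cdivide) (rule derivative_eq_intros refl | simp)+
      then show "((\<lambda>\<theta>. sin \<theta> ^ (2 * a + 2) / real (2 * a + 2)) has_vector_derivative sin x ^ (2 * a + 1) * cos x ^ 1) (at x within {0..pi})"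
        by (simp add: has_real_derivative_iff_has_vector_derivative mult.commute del: of_nat_add of_nat_mult)
    qed simp
    then have "integral {0..pi} (\<lambda>\<theta>. sin \<theta> ^ (2 * a + 1) * cos \<theta> ^ 1) = 0" by (simp add: integral_unique)
    then show ?thesis unfolding polar_moment_def by simp
  qed
  show "polar_moment a (c + 2) + polar_moment (a + 1) c = polar_moment a c"
  proof -
    have "integral {0..pi} (\<lambda>\<theta>. sin \<theta> ^ (2 * a + 1) * cos \<theta> ^ (c + 2)) + integral {0..pi} (\<lambda>\<theta>. sin \<theta> ^ (2 * (a + 1) + 1) * cos \<theta> ^ c)
      = integral {0..pi} (\<lambda>\<theta>. sin \<theta> ^ (2 * a + 1) * cos \<theta> ^ (c + 2) + sin \<theta> ^ (2 * (a + 1) + 1) * cos \<theta> ^ c)"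
      by (rule Henstock_Kurzweil_Integration.integral_add[symmetric]) (rule cont)+
    also have "(\<lambda>\<theta>::real. sin \<theta> ^ (2 * a + 1) * cos \<theta> ^ (c + 2) + sin \<theta> ^ (2 * (a + 1) + 1) * cos \<theta> ^ c) = (\<lambda>\<theta>. sin \<theta> ^ (2 * a + 1) * cos \<theta> ^ c)"
    proof (rule ext)
      fix \<theta> :: real
      have "sin \<theta> ^ (2 * a + 1) * cos \<theta> ^ (c + 2) + sin \<theta> ^ (2 * (a + 1) + 1) * cos \<theta> ^ c = sin \<theta> ^ (2 * a + 1) * cos \<theta> ^ c * ((cos \<theta>)\<^sup>2 + (sin \<theta>)\<^sup>2)"
      proof -
        have "sin \<theta> ^ (2 * (a + 1) + 1) = sin \<theta> ^ (2 * a + 1) * (sin \<theta>)\<^sup>2" by (simp add: power2_eq_square)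
        then show ?thesis unfolding distrib_left power_add[of _ c 2] by (simp only: mult_ac)
      qed
      then show "sin \<theta> ^ (2 * a + 1) * cos \<theta> ^ (c + 2) + sin \<theta> ^ (2 * (a + 1) + 1) * cos \<theta> ^ c = sin \<theta> ^ (2 * a + 1) * cos \<theta> ^ c"
        by simp
    qed
    finally show ?thesis unfolding polar_moment_def by simp
  qed
  show "polar_moment 0 0 = 1"
  proof -
    have "((\<lambda>\<theta>. sin \<theta>) has_integral (- cos pi - - cos 0)) {0..pi}"
      by (rule fundamental_theorem_of_calculus) (auto intro!: derivative_eq_intros simp: has_real_derivative_iff_has_vector_derivative[symmetric])
    then show ?thesis by (simp add: polar_moment_def integral_unique)
  qed
qed

text \<open>Integration by parts combined with sin^2 + cos^2 = 1. With its companion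
  \<open>polar_moment_lower_cos\<close> it expresses the lowered moments in the Laplacian of a
  monomial by the original one. At a = 0 the difference a - 1 is truncated, and the conditional
  makes both sides vanish.\<close>

lemma polar_moment_lower_sin: "2 * real a * polar_moment (a - 1) c = real (if a = 0 then 0 else 2 * a + c + 1) * polar_moment a c"
proof (cases "a = 0")
  case False
  have "2 * real a * polar_moment (a - 1) c = 2 * real a * polar_moment (a - 1) (c + 2) + 2 * real a * polar_moment a c"
    using polar_moment_pythagoras[of "a - 1" c] False by (simp flip: distrib_left)
  also have "2 * real a * polar_moment (a - 1) (c + 2) = real (c + 1) * polar_moment a c"
    using polar_moment_sin[of a c] False by simp
  finally show ?thesis using False by (simp add: algebra_simps)
qed simp

lemma polar_moment_lower_cos: "real c * real (c - 1) * polar_moment a (c - 2) = real c * real (2 * a + c + 1) * polar_moment a c"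
proof -
  consider "c = 0" | "c = 1" | d where "c = d + 2" by (metis One_nat_def add_2_eq_Suc' not0_implies_Suc)
  then show ?thesis
  proof cases
    case 3
    have "real (d + 1) * polar_moment (a + 1) d = 2 * real (a + 1) * polar_moment a (d + 2)"
      using polar_moment_sin[of "a + 1" d] by simp
    moreover have "real (d + 1) * polar_moment a d = real (d + 1) * polar_moment a (d + 2) + real (d + 1) * polar_moment (a + 1) d"
      using polar_moment_pythagoras[of a d] by (simp flip: distrib_left)
    ultimately have "real (d + 1) * polar_moment a d = real (2 * a + d + 3) * polar_moment a (d + 2)"
      by (simp add: algebra_simps)
    then have "real (d + 2) * (real (d + 1) * polar_moment a d) = real (d + 2) * (real (2 * a + d + 3) * polar_moment a (d + 2))" by simp
    then show ?thesis using 3 by (simp add: mult.assoc)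
  qed (simp_all add: polar_moment_odd[unfolded One_nat_def])
qed

text \<open>The Laplace--Beltrami eigenvalue equation of the beam of degree \<open>m\<close>, tested against a monomial.\<close>

lemma beam_moment_eigen:
  fixes I :: "nat \<Rightarrow> nat \<Rightarrow> nat \<Rightarrow> real"
  assumes I: "\<And>a b c. I a b c = (if a = b then polar_moment a c else 0)"
  shows "4 * real a * real b * I (a - 1) (b - 1 + m) c + real c * real (c - 1) * I a (b + m) (c - 2)
     - real (a + b + c) * real (a + b + c + 1) * I a (b + m) c = - (real m * real (m + 1)) * I a (b + m) c"
proof (cases "a = b + m")
  case False
  then have "I a (b + m) c = 0" "I a (b + m) (c - 2) = 0" by (simp_all add: I)
  moreover have "real a * real b * I (a - 1) (b - 1 + m) c = 0"
    using False by (cases a; cases b) (auto simp: I)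
  ultimately show ?thesis by (metis (no_types, opaque_lifting) mult.assoc mult_zero_right add.right_neutral diff_zero)
next
  case True
  have e1: "4 * real a * real b * I (a - 1) (b - 1 + m) c = 2 * real b * real (2 * a + c + 1) * polar_moment a c"
  proof (cases "b = 0")
    case False
    then have "a - 1 = b - 1 + m" "a \<noteq> 0" using True by auto
    then have "4 * real a * real b * I (a - 1) (b - 1 + m) c = 2 * real b * (2 * real a * polar_moment (a - 1) c)"
      by (simp add: I)
    also have "\<dots> = 2 * real b * (real (2 * a + c + 1) * polar_moment a c)"
      unfolding polar_moment_lower_sin using \<open>a \<noteq> 0\<close> by simp
    finally show ?thesis by simp
  qed simp
  have e2: "real c * real (c - 1) * I a (b + m) (c - 2) = real c * real (2 * a + c + 1) * polar_moment a c"
    using True polar_moment_lower_cos[of c a] by (simp add: I)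
  have e3: "I a (b + m) c = polar_moment a c" using True by (simp add: I)
  \<comment> \<open>Once every moment is a multiple of P = \<open>polar_moment a c\<close>, the
    eigenvalue equation with a = b + m is a polynomial identity in b, c and m.\<close>
  have e4: "2 * real b * real (2 * a + c + 1) * P + real c * real (2 * a + c + 1) * P - real (a + b + c) * real (a + b + c + 1) * P
      = - (real m * real (m + 1)) * P" for P
    unfolding True by (simp add: algebra_simps)
  show ?thesis unfolding e1 e2 e3 by (rule e4)
qed

section \<open>Derivatives of homogeneous monomials\<close>

definition horizontal :: "real ^ 3 \<Rightarrow> complex" where
  "horizontal v = Complex (v $ 1) (v $ 2)"

lemma bounded_linear_horizontal: "bounded_linear horizontal"
proof -
  have eq: "horizontal = (\<lambda>v. of_real (v $ 1) + \<i> * of_real (v $ 2))"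
    by (simp add: horizontal_def Complex_eq fun_eq_iff)
  show ?thesis
    by (subst eq) (intro bounded_linear_add bounded_linear_compose[OF bounded_linear_of_real bounded_linear_vec_nth]
       bounded_linear_compose[OF bounded_linear_mult_right bounded_linear_compose[OF bounded_linear_of_real bounded_linear_vec_nth]])
qed

lemma mon_horizontal: "mon a b c x = horizontal x ^ a * cnj (horizontal x) ^ b * of_real (x $ 3) ^ c"
  by (simp add: mon_def horizontal_def complex_cnj)

text \<open>Directional derivatives of such functions are linear combinations of functions of the
  same kind, which gives the Laplacian and smoothness at once. The case m = 0 is the monomial
  itself, and m = a + b + c is its extension constant along rays.\<close>

definition homog :: "nat \<Rightarrow> nat \<Rightarrow> nat \<Rightarrow> nat \<Rightarrow> real ^ 3 \<Rightarrow> complex" where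
  "homog a b c m x = mon a b c x * of_real (inverse (norm x)) ^ m"

text \<open>The last summand is the derivative of the power of the norm: the inner product of x and
  v is expanded as in \<open>inner_horizontal\<close> and absorbed into the exponents.\<close>

definition homog_deriv :: "nat \<Rightarrow> nat \<Rightarrow> nat \<Rightarrow> nat \<Rightarrow> real ^ 3 \<Rightarrow> real ^ 3 \<Rightarrow> complex" where
  "homog_deriv a b c m x v =
     horizontal v * (of_nat a * homog (a - 1) b c m x) + cnj (horizontal v) * (of_nat b * homog a (b - 1) c m x)
     + of_real (v $ 3) * (of_nat c * homog a b (c - 1) m x)
     - of_nat m * (cnj (horizontal v) / 2 * homog (a + 1) b c (m + 2) x + horizontal v / 2 * homog a (b + 1) c (m + 2) x
        + of_real (v $ 3) * homog a b (c + 1) (m + 2) x)"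

lemma inner_horizontal:
  "of_real (x \<bullet> v) = (horizontal x * cnj (horizontal v) + cnj (horizontal x) * horizontal v) / 2 + of_real (x $ 3) * of_real (v $ 3)"
  by (simp add: horizontal_def inner_vec_def sum_3 complex_eq_iff algebra_simps)

lemma mon_has_derivative:
  "(mon a b c has_derivative (\<lambda>v. horizontal v * (of_nat a * mon (a - 1) b c x) + cnj (horizontal v) * (of_nat b * mon a (b - 1) c x)
     + of_real (v $ 3) * (of_nat c * mon a b (c - 1) x))) (at x)"
proof -
  have h: "(horizontal has_derivative horizontal) (at x)" by (rule bounded_linear_imp_has_derivative[OF bounded_linear_horizontal])
  have h': "((\<lambda>x. cnj (horizontal x)) has_derivative (\<lambda>v. cnj (horizontal v))) (at x)"
    by (rule bounded_linear_imp_has_derivative[OF bounded_linear_compose[OF bounded_linear_cnj bounded_linear_horizontal]])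
  have h3: "((\<lambda>x. complex_of_real (x $ 3)) has_derivative (\<lambda>v. of_real (v $ 3))) (at x)"
    by (rule bounded_linear_imp_has_derivative[OF bounded_linear_compose[OF bounded_linear_of_real bounded_linear_vec_nth]])
  have "((\<lambda>x. horizontal x ^ a * cnj (horizontal x) ^ b * of_real (x $ 3) ^ c) has_derivative
    (\<lambda>v. horizontal v * (of_nat a * mon (a - 1) b c x) + cnj (horizontal v) * (of_nat b * mon a (b - 1) c x)
     + of_real (v $ 3) * (of_nat c * mon a b (c - 1) x))) (at x)"
    by (rule has_derivative_eq_rhs[OF has_derivative_mult[OF has_derivative_mult[OF has_derivative_power[OF h] has_derivative_power[OF h']] has_derivative_power[OF h3]]])
      (simp add: fun_eq_iff mon_horizontal algebra_simps)
  then show ?thesis by (simp only: mon_horizontal[abs_def])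
qed

lemma inverse_norm_power_has_derivative:
  fixes x :: "real ^ 3"
  assumes "x \<noteq> 0"
  shows "((\<lambda>x. complex_of_real (inverse (norm x)) ^ m) has_derivative
     (\<lambda>v. - of_nat m * of_real (x \<bullet> v) * of_real (inverse (norm x)) ^ (m + 2))) (at x)"
proof -
  have "((\<lambda>x. inverse (norm x)) has_derivative (\<lambda>v. - (inverse (norm x) * (x \<bullet> v / norm x) * inverse (norm x)))) (at x)"
  proof (rule Deriv.has_derivative_inverse)
    show "(norm has_derivative (\<lambda>v. x \<bullet> v / norm x)) (at x)"
      using has_derivative_norm[OF assms] by (simp add: sgn_div_norm divide_inverse mult_ac inner_commute)
  qed (use assms in simp)
  then have "((\<lambda>x. complex_of_real (inverse (norm x))) has_derivative (\<lambda>v. of_real (- (inverse (norm x) * (x \<bullet> v / norm x) * inverse (norm x))))) (at x)"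
    by (rule has_derivative_of_real)
  from has_derivative_power[OF this, of m] show ?thesis
    by (rule has_derivative_eq_rhs) (cases m, auto simp: fun_eq_iff divide_inverse power2_eq_square algebra_simps)
qed

text \<open>The alternative m = 0 retains the origin for plain polynomials, since solid harmonics
  have vanishing Laplacian there too.\<close>

lemma homog_has_derivative:
  assumes "x \<noteq> 0 \<or> m = 0"
  shows "(homog a b c m has_derivative homog_deriv a b c m x) (at x)"
proof (cases "m = 0")
  case True
  then show ?thesis using mon_has_derivative[of a b c x] by (simp add: homog_def[abs_def] homog_deriv_def[abs_def])
next
  case False
  let ?r = "of_real (inverse (norm x)) :: complex"
  let ?M = "\<lambda>v. horizontal v * (of_nat a * mon (a - 1) b c x) + cnj (horizontal v) * (of_nat b * mon a (b - 1) c x)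
     + of_real (v $ 3) * (of_nat c * mon a b (c - 1) x)"
  have "((\<lambda>x. mon a b c x * of_real (inverse (norm x)) ^ m) has_derivative
      (\<lambda>v. mon a b c x * (- of_nat m * of_real (x \<bullet> v) * ?r ^ (m + 2)) + ?M v * ?r ^ m)) (at x)"
    by (rule has_derivative_mult[OF mon_has_derivative inverse_norm_power_has_derivative]) (use assms False in auto)
  moreover have "(\<lambda>v. mon a b c x * (- of_nat m * of_real (x \<bullet> v) * ?r ^ (m + 2)) + ?M v * ?r ^ m) = homog_deriv a b c m x"
  proof
    fix v
    have shift: "mon (a + 1) b c x = mon a b c x * horizontal x" "mon a (b + 1) c x = mon a b c x * cnj (horizontal x)"
      "mon a b (c + 1) x = mon a b c x * of_real (x $ 3)"
      by (simp_all add: mon_horizontal mult_ac)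
    show "mon a b c x * (- of_nat m * of_real (x \<bullet> v) * ?r ^ (m + 2)) + ?M v * ?r ^ m = homog_deriv a b c m x v"
    proof -
      have ring: "M * (- n * ((z * w' + z' * w) / 2 + s * t) * R') + (w * (A * Ma) + w' * (B * Mb) + t * (C * Mc)) * R
        = w * (A * (Ma * R)) + w' * (B * (Mb * R)) + t * (C * (Mc * R)) - n * (w' / 2 * (M * z * R') + w / 2 * (M * z' * R') + t * (M * s * R'))"
        for M n z w w' z' s t R R' A B C Ma Mb Mc :: complex
        by (simp add: field_simps)
      show ?thesis
        unfolding homog_deriv_def homog_def inner_horizontal shift
        by (rule ring)
    qed
  qed
  ultimately show ?thesis by (simp only: homog_def[abs_def])
qed

lemma line_has_vector_derivative:
  assumes "(f has_derivative D) (at (x + s *\<^sub>R b))"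
  shows "((\<lambda>r. f (x + r *\<^sub>R b)) has_vector_derivative D b) (at s)"
proof -
  have l: "((\<lambda>r. x + r *\<^sub>R b) has_derivative (\<lambda>r. r *\<^sub>R b)) (at s)"
    by (auto intro!: derivative_eq_intros)
  have "((\<lambda>r. f (x + r *\<^sub>R b)) has_derivative (\<lambda>r. D (r *\<^sub>R b))) (at s)"
    using has_derivative_compose[OF l assms] by simp
  moreover have "D (r *\<^sub>R b) = r *\<^sub>R D b" for r
    using assms by (simp add: has_derivative_def bounded_linear.linear linear_scale)
  ultimately show ?thesis by (simp add: has_vector_derivative_def)
qed

text \<open>The inner derivative is differentiated once more, so it must be known on a neighbourhood
  of x; this is the role of U.\<close>

lemma laplacian_eq:
  assumes U: "open U" "x \<in> U"
    and F': "\<And>y. y \<in> U \<Longrightarrow> (F has_derivative F' y) (at y)"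
    and F'': "\<And>b. b \<in> Basis \<Longrightarrow> ((\<lambda>y. F' y b) has_derivative F'' b) (at x)"
  shows "laplacian F x = (\<Sum>b\<in>Basis. F'' b b)"
  unfolding laplacian_def
proof (intro sum.cong refl)
  fix b :: 'a assume b: "b \<in> Basis"
  define V where "V = (\<lambda>s. x + s *\<^sub>R b) -` U"
  have V: "open V" "0 \<in> V" unfolding V_def using U by (auto intro!: open_vimage continuous_intros)
  have "((\<lambda>s. F' (x + s *\<^sub>R b) b) has_vector_derivative F'' b b) (at 0)"
    by (rule line_has_vector_derivative) (simp add: F''[OF b])
  then have "((\<lambda>s. vector_derivative (\<lambda>r. F (x + r *\<^sub>R b)) (at s)) has_vector_derivative F'' b b) (at 0)"
  proof (rule has_vector_derivative_transform_within_open[OF _ V])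
    fix s assume "s \<in> V"
    then have "((\<lambda>r. F (x + r *\<^sub>R b)) has_vector_derivative F' (x + s *\<^sub>R b) b) (at s)"
      by (intro line_has_vector_derivative F') (simp add: V_def)
    then show "F' (x + s *\<^sub>R b) b = vector_derivative (\<lambda>r. F (x + r *\<^sub>R b)) (at s)"
      by (simp add: vector_derivative_at)
  qed
  then show "vector_derivative (\<lambda>s. vector_derivative (\<lambda>r. F (x + r *\<^sub>R b)) (at s)) (at 0) = F'' b b"
    by (rule vector_derivative_at)
qed

definition homog_deriv2 :: "nat \<Rightarrow> nat \<Rightarrow> nat \<Rightarrow> nat \<Rightarrow> real ^ 3 \<Rightarrow> real ^ 3 \<Rightarrow> real ^ 3 \<Rightarrow> complex" where
  "homog_deriv2 a b c m x v w =
     horizontal v * (of_nat a * homog_deriv (a - 1) b c m x w) + cnj (horizontal v) * (of_nat b * homog_deriv a (b - 1) c m x w)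
     + of_real (v $ 3) * (of_nat c * homog_deriv a b (c - 1) m x w)
     - of_nat m * (cnj (horizontal v) / 2 * homog_deriv (a + 1) b c (m + 2) x w + horizontal v / 2 * homog_deriv a (b + 1) c (m + 2) x w
        + of_real (v $ 3) * homog_deriv a b (c + 1) (m + 2) x w)"

lemma homog_deriv_has_derivative:
  assumes "x \<noteq> 0 \<or> m = 0"
  shows "((\<lambda>x. homog_deriv a b c m x v) has_derivative homog_deriv2 a b c m x v) (at x)"
proof (cases "m = 0")
  case True
  have h: "(homog a' b' c' 0 has_derivative homog_deriv a' b' c' 0 x) (at x)" for a' b' c'
    by (rule homog_has_derivative) simp
  show ?thesis unfolding True homog_deriv_def[where m = 0, of _ _ _ _ v] homog_deriv2_def[abs_def] of_nat_0 mult_zero_left diff_zero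
    by (intro has_derivative_add has_derivative_mult_right h)
next
  case False
  have h: "(homog a' b' c' m' has_derivative homog_deriv a' b' c' m' x) (at x)" for a' b' c' m'
    by (rule homog_has_derivative) (use assms False in simp)
  show ?thesis unfolding homog_deriv_def[of _ _ _ _ _ v] homog_deriv2_def[abs_def]
    by (intro has_derivative_add has_derivative_diff has_derivative_mult_right h)
qed

lemma sum_Basis_3: "(\<Sum>b\<in>(Basis :: (real ^ 3) set). f b) = f (axis 1 1) + f (axis 2 1) + f (axis 3 1)"
proof -
  have B: "(Basis :: (real ^ 3) set) = (\<lambda>i. axis i 1) ` UNIV" by (auto simp: Basis_vec_def)
  have "inj (\<lambda>i::3. axis i (1::real))" by (auto simp: inj_def axis_eq_axis)
  from sum.reindex[OF this, of f] show ?thesis unfolding B[symmetric] by (simp add: sum_3)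
qed

text \<open>In the complex coordinate z of \<open>horizontal\<close>, the Laplacian is 4 d/dz d/dz'
  + d^2/dx_3^2, with z' the conjugate of z. The cross term with |x|^(-m) is - 2 m (a + b + c) by
  Euler's identity, and the Laplacian of |x|^(-m) supplies - 3 m and m (m + 2), the latter with
  |x|^2 expanded into the exponents.\<close>

lemma sum_homog_deriv2:
  "(\<Sum>v\<in>Basis. homog_deriv2 a b c m x v v) =
     4 * of_nat a * of_nat b * homog (a - 1) (b - 1) c m x + of_nat c * of_nat (c - 1) * homog a b (c - 2) m x
     - of_nat m * (2 * of_nat (a + b + c) + 3) * homog a b c (m + 2) x
     + of_nat m * of_nat (m + 2) * (homog (a + 1) (b + 1) c (m + 4) x + homog a b (c + 2) (m + 4) x)"
proof -
  have ax: "horizontal (axis 1 1) = 1" "horizontal (axis 2 1) = \<i>" "horizontal (axis 3 1) = 0"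
    by (simp_all add: horizontal_def axis_def complex_eq_iff)
  have ax3: "(axis 1 1 :: real ^ 3) $ 3 = 0" "(axis 2 1 :: real ^ 3) $ 3 = 0" "(axis 3 1 :: real ^ 3) $ 3 = 1"
    by (simp_all add: axis_def)
  have m4: "m + 2 + 2 = m + 4" by simp
  show ?thesis
    unfolding sum_Basis_3 homog_deriv2_def homog_deriv_def ax ax3 m4
    by (cases a; cases b; cases c) (simp_all add: field_simps numeral_2_eq_2)
qed

lemma laplacian_homog:
  assumes "x \<noteq> 0 \<or> m = 0"
  shows "laplacian (homog a b c m) x =
     4 * of_nat a * of_nat b * homog (a - 1) (b - 1) c m x + of_nat c * of_nat (c - 1) * homog a b (c - 2) m x
     - of_nat m * (2 * of_nat (a + b + c) + 3) * homog a b c (m + 2) x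
     + of_nat m * of_nat (m + 2) * (homog (a + 1) (b + 1) c (m + 4) x + homog a b (c + 2) (m + 4) x)"
  unfolding sum_homog_deriv2[symmetric]
proof (rule laplacian_eq[where F' = "homog_deriv a b c m" and F'' = "homog_deriv2 a b c m x" and U = "if m = 0 then UNIV else - {0}"])
  show "(homog a b c m has_derivative homog_deriv a b c m y) (at y)" if "y \<in> (if m = 0 then UNIV else - {0})" for y
    by (rule homog_has_derivative) (use that in \<open>auto split: if_splits\<close>)
qed (use assms in \<open>auto intro!: homog_deriv_has_derivative\<close>)

lemma degree0_extension_mon: "degree0_extension (mon a b c) = homog a b c (a + b + c)"
proof
  fix y
  have "horizontal (y /\<^sub>R norm y) = of_real (inverse (norm y)) * horizontal y"
    by (simp add: horizontal_def complex_of_real_mult_Complex del: of_real_inverse)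
  then show "degree0_extension (mon a b c) y = homog a b c (a + b + c) y"
    unfolding degree0_extension_def homog_def mon_horizontal
    by (simp add: power_mult_distrib power_add mult_ac)
qed

lemma mon_sphere: "x \<in> S2 \<Longrightarrow> mon (a + 1) (b + 1) c x + mon a b (c + 2) x = mon a b c x"
proof -
  assume "x \<in> S2"
  then have "(x $ 1)\<^sup>2 + (x $ 2)\<^sup>2 + (x $ 3)\<^sup>2 = 1"
    by (simp add: norm_eq_1 inner_vec_def sum_3 power2_eq_square)
  moreover have "horizontal x * cnj (horizontal x) + of_real (x $ 3) ^ 2 = of_real ((x $ 1)\<^sup>2 + (x $ 2)\<^sup>2 + (x $ 3)\<^sup>2)"
    by (simp add: horizontal_def complex_eq_iff power2_eq_square)
  ultimately have 1: "horizontal x * cnj (horizontal x) + of_real (x $ 3) ^ 2 = 1" by simp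
  have "mon (a + 1) (b + 1) c x + mon a b (c + 2) x = mon a b c x * (horizontal x * cnj (horizontal x) + of_real (x $ 3) ^ 2)"
    by (simp only: mon_horizontal power_add power_one_right distrib_left mult_ac)
  then show ?thesis using 1 by simp
qed

text \<open>For the extension of degree 0 the exponent m equals n = a + b + c, and on the sphere the
  radial terms combine to - n (2 n + 3) + n (n + 2) = - n (n + 1).\<close>

lemma laplace_beltrami_mon:
  assumes x: "x \<in> S2"
  shows "laplace_beltrami (mon a b c) x =
    4 * of_nat a * of_nat b * mon (a - 1) (b - 1) c x + of_nat c * of_nat (c - 1) * mon a b (c - 2) x
     - of_nat (a + b + c) * of_nat (a + b + c + 1) * mon a b c x"
proof -
  have nx: "norm x = 1" using x by simp
  then have x0: "x \<noteq> 0" by auto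
  have h: "homog a' b' c' m' x = mon a' b' c' x" for a' b' c' m' using nx by (simp add: homog_def)
  have lb: "laplace_beltrami (mon a b c) x = 4 * of_nat a * of_nat b * mon (a - 1) (b - 1) c x + of_nat c * of_nat (c - 1) * mon a b (c - 2) x
     - of_nat (a + b + c) * (2 * of_nat (a + b + c) + 3) * mon a b c x
     + of_nat (a + b + c) * of_nat (a + b + c + 2) * mon a b c x"
    unfolding laplace_beltrami_def degree0_extension_mon using laplacian_homog[of x "a + b + c" a b c] x0
    by (simp only: h mon_sphere[OF x] simp_thms)
  show ?thesis unfolding lb by (simp only: of_nat_add of_nat_numeral of_nat_1) (simp add: algebra_simps)
qed

section \<open>Monomials as smooth test functions\<close>

lemma Ck_on_add: "Ck_on k F S \<Longrightarrow> Ck_on k G S \<Longrightarrow> Ck_on k (\<lambda>x. F x + G x) S"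
proof (induction k arbitrary: F G)
  case (Suc k)
  obtain F' G' where F': "\<forall>x\<in>S. (F has_derivative F' x) (at x)" "\<forall>v. Ck_on k (\<lambda>x. F' x v) S"
    and G': "\<forall>x\<in>S. (G has_derivative G' x) (at x)" "\<forall>v. Ck_on k (\<lambda>x. G' x v) S"
    using Suc.prems by auto
  show ?case unfolding Ck_on.simps
    by (rule exI[of _ "\<lambda>x v. F' x v + G' x v"]) (use F' G' Suc.IH in \<open>auto intro!: has_derivative_add\<close>)
qed (auto intro: continuous_intros)

lemma Ck_on_cmult: "Ck_on k F S \<Longrightarrow> Ck_on k (\<lambda>x. (c::complex) * F x) S"
proof (induction k arbitrary: F)
  case (Suc k)
  obtain F' where F': "\<forall>x\<in>S. (F has_derivative F' x) (at x)" "\<forall>v. Ck_on k (\<lambda>x. F' x v) S"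
    using Suc.prems by auto
  show ?case unfolding Ck_on.simps
    by (rule exI[of _ "\<lambda>x v. c * F' x v"]) (use F' Suc.IH in \<open>auto intro!: has_derivative_mult_right\<close>)
qed (auto intro: continuous_intros)

lemma Ck_on_homog: "Ck_on k (homog a b c m) (- {0})"
proof (induction k arbitrary: a b c m)
  case 0
  have "(homog a b c m has_derivative homog_deriv a b c m x) (at x)" if "x \<in> - {0}" for x
    by (rule homog_has_derivative) (use that in simp)
  then show ?case
    by (auto intro!: continuous_at_imp_continuous_on has_derivative_continuous)
next
  case (Suc k)
  have "Ck_on k (\<lambda>x. homog_deriv a b c m x v) (- {0})" for v
  proof -
    have "(\<lambda>x. homog_deriv a b c m x v) = (\<lambda>x.
     (horizontal v * of_nat a) * homog (a - 1) b c m x + (cnj (horizontal v) * of_nat b) * homog a (b - 1) c m x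
     + (of_real (v $ 3) * of_nat c) * homog a b (c - 1) m x
     + ((- of_nat m * cnj (horizontal v) / 2) * homog (a + 1) b c (m + 2) x + (- of_nat m * horizontal v / 2) * homog a (b + 1) c (m + 2) x
        + (- of_nat m * of_real (v $ 3)) * homog a b (c + 1) (m + 2) x))"
      by (simp add: fun_eq_iff homog_deriv_def algebra_simps)
    then show ?thesis by (simp only:) (intro Ck_on_add Ck_on_cmult Suc.IH)
  qed
  then show ?case unfolding Ck_on.simps
    by (intro exI[of _ "homog_deriv a b c m"] conjI ballI homog_has_derivative allI) auto
qed

lemma smooth_on_sphere_mon: "smooth_on_sphere (mon a b c)"
  unfolding smooth_on_sphere_def degree0_extension_mon by (simp add: Ck_on_homog)

section \<open>Functions determined by their moments\<close>

text \<open>The complex polynomials, presented as the span of the monomials, so that linear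
  statements reduce to \<open>mon\<close>.\<close>

inductive mpoly :: "(real ^ 3 \<Rightarrow> complex) \<Rightarrow> bool" where
  mono: "mpoly (\<lambda>x. k * mon a b c x)"
| add: "mpoly f \<Longrightarrow> mpoly g \<Longrightarrow> mpoly (\<lambda>x. f x + g x)"

lemma mpoly_const: "mpoly (\<lambda>x. k)"
  using mpoly.mono[of k 0 0 0] by (simp add: mon_def)

lemma mpoly_cmult: "mpoly f \<Longrightarrow> mpoly (\<lambda>x. k * f x)"
proof (induction rule: mpoly.induct)
  case (mono k' a b c)
  then show ?case using mpoly.mono[of "k * k'" a b c] by (simp add: mult.assoc)
qed (auto simp: distrib_left intro: mpoly.add)

lemma mpoly_mult: "mpoly f \<Longrightarrow> mpoly g \<Longrightarrow> mpoly (\<lambda>x. f x * g x)"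
proof (induction rule: mpoly.induct)
  case (mono k a b c)
  then show ?case
  proof (induction rule: mpoly.induct)
    case (mono k' a' b' c')
    have "(\<lambda>x. k * mon a b c x * (k' * mon a' b' c' x)) = (\<lambda>x. (k * k') * mon (a + a') (b + b') (c + c') x)"
      by (simp add: fun_eq_iff mon_mult[symmetric])
    then show ?case by (simp only:) (rule mpoly.mono)
  qed (auto simp: distrib_left intro: mpoly.add)
qed (auto simp: distrib_right intro: mpoly.add)

lemma mpoly_coordinate: "mpoly (\<lambda>x. of_real (x $ i))"
proof -
  have "mpoly (\<lambda>x. (1/2) * mon 1 0 0 x + (1/2) * mon 0 1 0 x)" "mpoly (\<lambda>x. (-\<i>/2) * mon 1 0 0 x + (\<i>/2) * mon 0 1 0 x)"
    "mpoly (\<lambda>x. 1 * mon 0 0 1 x)"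
    by (intro mpoly.intros)+
  moreover have "(\<lambda>x. (1/2) * mon 1 0 0 x + (1/2) * mon 0 1 0 x) = (\<lambda>x. of_real (x $ 1))"
    "(\<lambda>x. (-\<i>/2) * mon 1 0 0 x + (\<i>/2) * mon 0 1 0 x) = (\<lambda>x. of_real (x $ 2))"
    "(\<lambda>x. 1 * mon 0 0 1 x) = (\<lambda>x. of_real (x $ 3))"
    by (auto simp: fun_eq_iff mon_def complex_eq_iff)
  ultimately have "\<forall>i. mpoly (\<lambda>x. of_real (x $ i))" unfolding forall_3 by simp
  then show ?thesis ..
qed

lemma mpoly_real_polynomial: "real_polynomial_function g \<Longrightarrow> mpoly (\<lambda>x. of_real (g x))"
proof (induction rule: real_polynomial_function.induct)
  case (linear f)
  have "of_real (f x) = of_real (f (axis 1 1)) * of_real (x $ 1) + of_real (f (axis 2 1)) * of_real (x $ 2) + of_real (f (axis 3 1)) * (of_real (x $ 3) :: complex)" for x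
  proof -
    have "x = (x $ 1) *\<^sub>R axis 1 1 + (x $ 2) *\<^sub>R axis 2 1 + (x $ 3) *\<^sub>R axis 3 1"
      by (simp add: vec_eq_iff forall_3 axis_def)
    then have "f x = f ((x $ 1) *\<^sub>R axis 1 1 + (x $ 2) *\<^sub>R axis 2 1 + (x $ 3) *\<^sub>R axis 3 1)" by simp
    also have "\<dots> = (x $ 1) * f (axis 1 1) + (x $ 2) * f (axis 2 1) + (x $ 3) * f (axis 3 1)"
      using bounded_linear.linear[OF linear] by (simp add: linear_add linear_scale)
    finally show ?thesis by (simp add: mult.commute)
  qed
  then have "(\<lambda>x. complex_of_real (f x)) = (\<lambda>x. of_real (f (axis 1 1)) * of_real (x $ 1) + of_real (f (axis 2 1)) * of_real (x $ 2) + of_real (f (axis 3 1)) * of_real (x $ 3))"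
    by (rule ext)
  then show ?case by (elim ssubst) (intro mpoly.add mpoly_cmult mpoly_coordinate)
qed (auto simp: intro: mpoly_const mpoly.add mpoly_mult)

lemma continuous_on_mpoly: "mpoly f \<Longrightarrow> continuous_on S f"
  by (induction rule: mpoly.induct) (auto intro!: continuous_intros)

lemma integrable_sphere_mult_continuous:
  assumes w: "integrable sphere_measure w" and h: "continuous_on S2 h"
  shows "integrable sphere_measure (\<lambda>x. w x * h x :: complex)"
proof -
  obtain B where B: "B > 0" "\<And>x. x \<in> S2 \<Longrightarrow> cmod (h x) \<le> B" using bounded_sphere_continuous[OF h] by blast
  show ?thesis
  proof (rule Bochner_Integration.integrable_bound)
    show "integrable sphere_measure (\<lambda>x. B * cmod (w x))" using w by simp
    show "(\<lambda>x. w x * h x) \<in> borel_measurable sphere_measure"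
      using w borel_measurable_sphere_continuous[OF h] by (intro borel_measurable_times) auto
    show "AE x in sphere_measure. cmod (w x * h x) \<le> norm (B * cmod (w x))"
      using B by (intro AE_I2) (simp add: space_sphere_measure norm_mult mult.commute[of B] mult_left_mono)
  qed
qed

lemma integral_mult_continuous_bound:
  assumes w: "integrable sphere_measure w" and h: "continuous_on S2 h" and B: "\<And>x. x \<in> S2 \<Longrightarrow> cmod (h x) \<le> B"
  shows "cmod (\<integral>x. w x * h x \<partial>sphere_measure) \<le> B * (\<integral>x. cmod (w x) \<partial>sphere_measure)"
proof -
  have "cmod (\<integral>x. w x * h x \<partial>sphere_measure) \<le> (\<integral>x. B * cmod (w x) \<partial>sphere_measure)"
  proof (rule Bochner_Integration.integral_norm_bound_integral)
    show "cmod (w x * h x) \<le> B * cmod (w x)" if "x \<in> space sphere_measure" for x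
      using B[of x] that by (simp add: space_sphere_measure norm_mult mult.commute[of B] mult_left_mono)
  qed (use w h in \<open>auto intro: integrable_sphere_mult_continuous\<close>)
  then show ?thesis by simp
qed

lemma mpoly_integral_zero:
  assumes w: "integrable sphere_measure w" and z: "\<And>a b c. (\<integral>x. w x * mon a b c x \<partial>sphere_measure) = 0" and h: "mpoly h"
  shows "(\<integral>x. w x * h x \<partial>sphere_measure) = 0"
  using h
proof (induction rule: mpoly.induct)
  case (mono k a b c)
  have "(\<integral>x. w x * (k * mon a b c x) \<partial>sphere_measure) = (\<integral>x. k * (w x * mon a b c x) \<partial>sphere_measure)" by (simp add: mult_ac)
  then show ?case using z by simp
next
  case (add f g)
  then show ?case using w by (simp add: distrib_left integrable_sphere_mult_continuous continuous_on_mpoly)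
qed

text \<open>Completeness of the spherical harmonics in \<open>L\<^sup>1\<close>: Stone--Weierstrass.\<close>

theorem sphere_moments_unique:
  assumes w: "integrable sphere_measure w" and z: "\<And>a b c. (\<integral>x. w x * mon a b c x \<partial>sphere_measure) = 0"
  shows "AE x in sphere_measure. w x = 0"
proof -
  interpret finite_measure sphere_measure by (rule finite_measure_sphere)
  \<comment> \<open>Stone-Weierstrass: a real polynomial is uniformly close to g on the compact
    sphere, and its integral against w vanishes.\<close>
  have cont: "(\<integral>x. w x * of_real (g x) \<partial>sphere_measure) = 0" if g: "continuous_on S2 g" for g :: "real ^ 3 \<Rightarrow> real"
  proof -
    define I where "I = (\<integral>x. cmod (w x) \<partial>sphere_measure)"
    have gc: "continuous_on S2 (\<lambda>x. complex_of_real (g x))" by (intro continuous_intros g)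
    have "cmod (\<integral>x. w x * of_real (g x) \<partial>sphere_measure) \<le> e * I" if e: "e > 0" for e
    proof -
      obtain q where q: "real_polynomial_function q" "\<And>x. x \<in> S2 \<Longrightarrow> \<bar>g x - q x\<bar> < e"
        using Stone_Weierstrass_real_polynomial_function[OF compact_sphere g e] by blast
      have qc: "continuous_on S2 (\<lambda>x. complex_of_real (q x))" by (rule continuous_on_mpoly[OF mpoly_real_polynomial[OF q(1)]])
      have "(\<integral>x. w x * of_real (g x) \<partial>sphere_measure) = (\<integral>x. w x * of_real (g x) \<partial>sphere_measure) - (\<integral>x. w x * of_real (q x) \<partial>sphere_measure)"
        using mpoly_integral_zero[OF w z mpoly_real_polynomial[OF q(1)]] by simp
      also have "\<dots> = (\<integral>x. w x * of_real (g x - q x) \<partial>sphere_measure)"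
        by (subst Bochner_Integration.integral_diff[symmetric]) (auto intro!: integrable_sphere_mult_continuous w gc qc simp: right_diff_distrib)
      also have "cmod \<dots> \<le> e * I"
      proof -
        have "continuous_on S2 (\<lambda>x. complex_of_real (g x - q x))" using continuous_on_diff[OF gc qc] by simp
        moreover have "cmod (complex_of_real (g x - q x)) \<le> e" if "x \<in> S2" for x
          using q(2)[OF that] unfolding norm_of_real by (rule less_imp_le)
        ultimately show ?thesis unfolding I_def by (rule integral_mult_continuous_bound[OF w])
      qed
      finally show ?thesis .
    qed
    then have "\<forall>\<^sub>F e in at_right 0. cmod (\<integral>x. w x * of_real (g x) \<partial>sphere_measure) \<le> e * I"
      by (auto simp: eventually_at_right_field intro!: exI[of _ 1])
    moreover have "((\<lambda>e. e * I) \<longlongrightarrow> 0 * I) (at_right 0)" by (intro tendsto_intros)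
    ultimately have "cmod (\<integral>x. w x * of_real (g x) \<partial>sphere_measure) \<le> 0 * I"
      by (intro tendsto_lowerbound) auto
    then show ?thesis by simp
  qed
  have total: "(\<integral>x. w x \<partial>sphere_measure) = 0" using z[of 0 0 0] by (simp add: mon_def)
  have msets: "B \<inter> S2 \<in> sets sphere_measure" if "B \<in> sets borel" for B
    using that by (auto simp: sets_sphere_measure sets_restrict_space)
  have sint: "set_integrable sphere_measure A w" if "A \<in> sets sphere_measure" for A
    unfolding set_integrable_def by (rule integrable_mult_indicator[OF that w])
  have closed: "set_lebesgue_integral sphere_measure (C \<inter> S2) w = 0" if C: "closed C" for C
  proof (cases "C = {}")
    case False
    \<comment> \<open>Equal to 1 on C and 0 at distance 1 / n and beyond, hence a continuous
      approximation of the indicator of a closed set.\<close>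
    define g where "g = (\<lambda>n x. max 0 (1 - real n * infdist x C))"
    have gc: "continuous_on S2 (g n)" for n unfolding g_def by (intro continuous_intros)
    have lim: "(\<lambda>n. g n x) \<longlonglongrightarrow> indicator C x" for x
    proof (cases "x \<in> C")
      case True
      then show ?thesis by (simp add: g_def)
    next
      case out: False
      then have "infdist x C > 0" using C False by (simp add: infdist_pos_not_in_closed)
      then obtain N where N: "1 < real N * infdist x C" using reals_Archimedean3 by blast
      have "g n x = 0" if "n \<ge> N" for n
      proof -
        have "real N * infdist x C \<le> real n * infdist x C" using that by (intro mult_right_mono infdist_nonneg) auto
        then show ?thesis using N by (simp add: g_def)
      qed
      then have "\<forall>\<^sub>F n in sequentially. g n x = 0" by (auto simp: eventually_sequentially)
      then show ?thesis using out by (simp add: tendsto_eventually)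
    qed
    have "(\<lambda>n. \<integral>x. w x * of_real (g n x) \<partial>sphere_measure) \<longlonglongrightarrow> (\<integral>x. w x * of_real (indicator C x) \<partial>sphere_measure)"
    proof (rule integral_dominated_convergence[where w = "\<lambda>x. cmod (w x)"])
      have "C \<in> sets borel" using C by (rule borel_closed)
      then have "indicat_real C \<in> borel_measurable (restrict_space borel S2)"
        by (intro measurable_restrict_space1 borel_measurable_indicator)
      then have "indicat_real C \<in> borel_measurable sphere_measure"
        by (simp only: measurable_cong_sets[OF sets_sphere_measure refl])
      then show "(\<lambda>x. w x * complex_of_real (indicator C x)) \<in> borel_measurable sphere_measure"
        using w by (intro borel_measurable_times borel_measurable_of_real) auto
      show "(\<lambda>x. w x * complex_of_real (g n x)) \<in> borel_measurable sphere_measure" for n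
        using w borel_measurable_sphere_continuous[OF gc] by (intro borel_measurable_times borel_measurable_of_real) auto
      show "integrable sphere_measure (\<lambda>x. cmod (w x))" using w by simp
      show "AE x in sphere_measure. (\<lambda>n. w x * complex_of_real (g n x)) \<longlonglongrightarrow> w x * complex_of_real (indicator C x)"
        by (intro AE_I2 tendsto_intros lim)
      have "\<bar>g n x\<bar> \<le> 1" for n x using infdist_nonneg[of x C] by (auto simp: g_def max_def)
      then show "AE x in sphere_measure. cmod (w x * complex_of_real (g n x)) \<le> cmod (w x)" for n
        by (intro AE_I2) (simp add: norm_mult mult_left_le)
    qed
    then have "(\<integral>x. w x * of_real (indicator C x) \<partial>sphere_measure) = 0"
      unfolding cont[OF gc] by (simp add: LIMSEQ_const_iff)
    moreover have "(\<integral>x. w x * of_real (indicator C x) \<partial>sphere_measure) = set_lebesgue_integral sphere_measure (C \<inter> S2) w"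
      unfolding set_lebesgue_integral_def
      by (intro Bochner_Integration.integral_cong refl) (simp add: space_sphere_measure scaleR_conv_of_real indicator_inter_arith mult.commute)
    ultimately show ?thesis by simp
  qed (simp add: set_lebesgue_integral_def)
  \<comment> \<open>Closed sets are stable under intersection and generate the Borel sets, so
    Dynkin's theorem extends the vanishing to all measurable sets; \<open>total\<close> serves the
    complements.\<close>
  have IS: "Int_stable (Collect closed :: (real ^ 3) set set)" "(Collect closed :: (real ^ 3) set set) \<subseteq> Pow UNIV"
    by (auto simp: Int_stable_def)
  have gen: "set_lebesgue_integral sphere_measure (B \<inter> S2) w = 0" if B: "B \<in> sigma_sets UNIV (Collect closed)" for B :: "(real ^ 3) set"
    using IS B
  proof (induct B rule: sigma_sets_induct_disjoint)
    case (basic A)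
    then show ?case using closed by simp
  next
    case empty
    then show ?case by (simp add: set_lebesgue_integral_def)
  next
    case (compl A)
    have A: "A \<in> sets borel" using compl(1) by (simp add: borel_eq_closed)
    have "set_lebesgue_integral sphere_measure S2 w = set_lebesgue_integral sphere_measure ((A \<inter> S2) \<union> ((UNIV - A) \<inter> S2)) w"
      by (rule arg_cong[where f = "\<lambda>A. set_lebesgue_integral sphere_measure A w"]) auto
    also have "\<dots> = set_lebesgue_integral sphere_measure (A \<inter> S2) w + set_lebesgue_integral sphere_measure ((UNIV - A) \<inter> S2) w"
      using A by (intro set_integral_Un sint msets) auto
    also have "set_lebesgue_integral sphere_measure S2 w = (\<integral>x. w x \<partial>sphere_measure)"
      unfolding set_lebesgue_integral_def by (intro Bochner_Integration.integral_cong refl) (simp add: space_sphere_measure)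
    finally show ?case using total compl(2) by simp
  next
    case (union A)
    have A: "A i \<in> sets borel" for i using union(2) by (auto simp: borel_eq_closed)
    have "set_lebesgue_integral sphere_measure ((\<Union>i. A i) \<inter> S2) w = set_lebesgue_integral sphere_measure (\<Union>i. A i \<inter> S2) w"
      by (rule arg_cong[where f = "\<lambda>A. set_lebesgue_integral sphere_measure A w"]) blast
    also have "\<dots> = (\<Sum>i. set_lebesgue_integral sphere_measure (A i \<inter> S2) w)"
    proof (rule lebesgue_integral_countable_add)
      show "A i \<inter> S2 \<in> sets sphere_measure" for i by (rule msets[OF A])
      show "set_integrable sphere_measure (\<Union>i. A i \<inter> S2) w" by (intro sint sets.countable_UN image_subsetI msets A)
      show "i \<noteq> j \<Longrightarrow> (A i \<inter> S2) \<inter> (A j \<inter> S2) = {}" for i j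
        using union(1) unfolding disjoint_family_on_def by blast
    qed
    finally show ?case by (simp only: union(3) suminf_zero)
  qed
  have "set_lebesgue_integral sphere_measure A w = 0" if "A \<in> sets sphere_measure" for A
  proof -
    have "A \<in> (\<inter>) S2 ` sets borel" using that by (simp only: sets_sphere_measure sets_restrict_space)
    then obtain B where B: "A = S2 \<inter> B" "B \<in> sets borel" by (rule imageE)
    have "B \<in> sigma_sets UNIV (Collect closed)" using B(2) by (simp add: borel_eq_closed)
    from gen[OF this] show ?thesis unfolding B(1) by (simp only: Int_commute)
  qed
  then show ?thesis by (rule density_zero[OF w])
qed

section \<open>Identification of the solution\<close>

lemma sphere_L2_continuous: "continuous_on S2 g \<Longrightarrow> g \<in> sphere_L2"
  unfolding sphere_L2_def
  by (auto intro!: borel_measurable_sphere_continuous integrable_sphere_continuous continuous_intros)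

lemma sphere_L2_diff:
  assumes g: "g \<in> sphere_L2" and h: "h \<in> sphere_L2"
  shows "(\<lambda>x. g x - h x) \<in> sphere_L2"
proof -
  have m: "g \<in> borel_measurable sphere_measure" "h \<in> borel_measurable sphere_measure"
    and i: "integrable sphere_measure (\<lambda>x. (cmod (g x))\<^sup>2)" "integrable sphere_measure (\<lambda>x. (cmod (h x))\<^sup>2)"
    using g h by (auto simp: sphere_L2_def)
  have "integrable sphere_measure (\<lambda>x. (cmod (g x - h x))\<^sup>2)"
  proof (rule Bochner_Integration.integrable_bound)
    show "integrable sphere_measure (\<lambda>x. 2 * (cmod (g x))\<^sup>2 + 2 * (cmod (h x))\<^sup>2)" using i by simp
    show "(\<lambda>x. (cmod (g x - h x))\<^sup>2) \<in> borel_measurable sphere_measure" using m by measurable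
    have "(cmod (g x - h x))\<^sup>2 \<le> 2 * (cmod (g x))\<^sup>2 + 2 * (cmod (h x))\<^sup>2" for x
    proof -
      have "(cmod (g x - h x))\<^sup>2 \<le> (cmod (g x) + cmod (h x))\<^sup>2" by (intro power_mono norm_triangle_ineq4) simp
      also have "\<dots> \<le> 2 * (cmod (g x))\<^sup>2 + 2 * (cmod (h x))\<^sup>2"
        using sum_squares_bound[of "cmod (g x)" "cmod (h x)"] by (simp add: power2_sum)
      finally show ?thesis .
    qed
    then show "AE x in sphere_measure. norm ((cmod (g x - h x))\<^sup>2) \<le> norm (2 * (cmod (g x))\<^sup>2 + 2 * (cmod (h x))\<^sup>2)"
      by (intro AE_I2) simp
  qed
  then show ?thesis using m by (auto simp: sphere_L2_def)
qed

lemma sphere_L2_integrable: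
  assumes g: "g \<in> sphere_L2"
  shows "integrable sphere_measure g"
proof (rule Bochner_Integration.integrable_bound)
  show "integrable sphere_measure (\<lambda>x. 1 + (cmod (g x))\<^sup>2)"
    using g integrable_sphere_continuous[of "\<lambda>x. 1::real"] by (auto simp: sphere_L2_def)
  have "cmod z \<le> 1 + (cmod z)\<^sup>2" for z
  proof (cases "cmod z \<le> 1")
    case False
    then have "cmod z * 1 \<le> cmod z * cmod z" by (intro mult_left_mono) auto
    then show ?thesis by (simp add: power2_eq_square)
  qed (simp add: add_increasing2)
  then show "AE x in sphere_measure. norm (g x) \<le> norm (1 + (cmod (g x))\<^sup>2)"
    by (intro AE_I2) simp
qed (use g in \<open>auto simp: sphere_L2_def\<close>)

text \<open>Instead of the Cauchy-Schwarz inequality, |g| \<le> s / 2 + |g|^2 / (2 s) is integrated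
  with s the L2 norm of g; s = 0 is treated apart.\<close>

lemma sphere_L1_le_L2:
  assumes g: "g \<in> sphere_L2"
  shows "(\<integral>x. cmod (g x) \<partial>sphere_measure) \<le> (measure sphere_measure S2 + 1) * sphere_L2_norm g"
proof -
  define s where "s = sphere_L2_norm g"
  define Q where "Q = (\<integral>x. (cmod (g x))\<^sup>2 \<partial>sphere_measure)"
  have i: "integrable sphere_measure g" by (rule sphere_L2_integrable[OF g])
  have i2: "integrable sphere_measure (\<lambda>x. (cmod (g x))\<^sup>2)" using g by (simp add: sphere_L2_def)
  have Q0: "Q \<ge> 0" unfolding Q_def by simp
  have s: "s = sqrt Q" by (simp add: s_def Q_def sphere_L2_norm_def)
  show ?thesis
  proof (cases "s = 0")
    case True
    then have "Q = 0" using s by simp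
    then have "AE x in sphere_measure. (cmod (g x))\<^sup>2 = 0"
      unfolding Q_def by (subst (asm) integral_nonneg_eq_0_iff_AE[OF i2]) auto
    then have "AE x in sphere_measure. cmod (g x) = 0" by eventually_elim simp
    then have "(\<integral>x. cmod (g x) \<partial>sphere_measure) = 0" by (rule integral_eq_zero_AE)
    then show ?thesis using True by (simp add: s_def)
  next
    case False
    then have s0: "s > 0" using s Q0 by (simp add: order_less_le)
    have "(\<integral>x. cmod (g x) \<partial>sphere_measure) \<le> (\<integral>x. s / 2 + (cmod (g x))\<^sup>2 / (2 * s) \<partial>sphere_measure)"
    proof (rule Bochner_Integration.integral_mono)
      show "integrable sphere_measure (\<lambda>x. s / 2 + (cmod (g x))\<^sup>2 / (2 * s))"
        using i2 integrable_sphere_continuous[of "\<lambda>x. s / 2"] by auto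
      show "cmod (g x) \<le> s / 2 + (cmod (g x))\<^sup>2 / (2 * s)" for x
        using sum_squares_bound[of s "cmod (g x)"] s0 by (simp add: field_simps power2_eq_square)
    qed (use i in simp)
    also have "\<dots> = (\<integral>x. s / 2 \<partial>sphere_measure) + (\<integral>x. (cmod (g x))\<^sup>2 / (2 * s) \<partial>sphere_measure)"
      using i2 integrable_sphere_continuous[of "\<lambda>x. s / 2"] by (intro Bochner_Integration.integral_add) auto
    also have "\<dots> = measure sphere_measure S2 * (s / 2) + Q / (2 * s)"
      by (simp add: Q_def space_sphere_measure)
    also have "Q / (2 * s) = s / 2" using s s0 Q0 by (simp add: real_div_sqrt field_simps)
    also have "measure sphere_measure S2 * (s / 2) + s / 2 = (measure sphere_measure S2 + 1) * (s / 2)"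
      by (simp add: algebra_simps)
    also have "\<dots> \<le> (measure sphere_measure S2 + 1) * s"
      using s0 by (intro mult_left_mono) auto
    finally show ?thesis by (simp add: s_def)
  qed
qed

text \<open>The integrating factor \<open>cis (\<kappa> * t)\<close> makes the product constant in
  t.\<close>

lemma linear_ode_zero:
  fixes d :: "real \<Rightarrow> complex"
  assumes d: "\<And>t. (d has_vector_derivative (- \<i> * of_real \<kappa> * d t)) (at t)" and d0: "d 0 = 0"
  shows "d t = 0"
proof -
  have c: "((\<lambda>t. cis (\<kappa> * t)) has_vector_derivative (\<i> * of_real \<kappa> * cis (\<kappa> * t))) (at t)" for t
    by (auto intro!: derivative_eq_intros simp: has_vector_derivative_def scaleR_conv_of_real mult_ac)
  have "((\<lambda>t. d t * cis (\<kappa> * t)) has_vector_derivative 0) (at t)" for t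
    using has_vector_derivative_mult[OF d c, of t] by (simp add: mult_ac)
  then obtain k where "\<And>t. t \<in> UNIV \<Longrightarrow> d t * cis (\<kappa> * t) = k"
    using has_vector_derivative_zero_constant[of UNIV "\<lambda>t. d t * cis (\<kappa> * t)"] by (metis convex_UNIV)
  then have k: "\<And>t. d t * cis (\<kappa> * t) = k" by simp
  have "k = 0" using k[of 0] d0 by simp
  then show ?thesis using k[of t] by simp
qed

definition beam_coeff :: "nat \<Rightarrow> real" where
  "beam_coeff n = sqrt (real ((2 * n + 1) * ((2 * n) choose n))) * (1 / 2) ^ n"

lemma gaussian_beam_mon: "x \<in> S2 \<Longrightarrow> gaussian_beam n x = of_real (beam_coeff n) * mon 0 n 0 x"
  by (simp only: gaussian_beam_cartesian beam_coeff_def mon_def power_0 mult_1 mult_1_right)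

text \<open>The moment against \<open>mon a b c\<close> that the expected solution must have, when
  its component of degree n is \<alpha> n times \<open>weyl_phase t n\<close> times
  \<open>mon 0 n 0\<close>: the azimuthal integral leaves only n = a - b.\<close>

definition wave_moment :: "(nat \<Rightarrow> complex) \<Rightarrow> real \<Rightarrow> nat \<Rightarrow> nat \<Rightarrow> nat \<Rightarrow> complex" where
  "wave_moment \<alpha> t a b c = (if b \<le> a then \<alpha> (a - b) * weyl_phase t (a - b) * of_real (polar_moment a c) else 0)"

lemma integral_beam_mon:
  "(\<integral>x. mon 0 n 0 x * mon a b c x \<partial>sphere_measure) = (if a = b + n then of_real (polar_moment a c) else 0)"
  unfolding mon_mult integral_mon by (simp add: add.commute)

lemma integral_beam_sum:
  assumes "finite S"
  shows "(\<integral>x. (\<Sum>n\<in>S. \<gamma> n * mon 0 n 0 x) * mon a b c x \<partial>sphere_measure) =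
    (if b \<le> a \<and> a - b \<in> S then \<gamma> (a - b) * of_real (polar_moment a c) else 0)"
proof -
  have "(\<integral>x. (\<Sum>n\<in>S. \<gamma> n * mon 0 n 0 x) * mon a b c x \<partial>sphere_measure) = (\<integral>x. (\<Sum>n\<in>S. \<gamma> n * (mon 0 n 0 x * mon a b c x)) \<partial>sphere_measure)"
    by (simp add: sum_distrib_right mult.assoc)
  also have "\<dots> = (\<Sum>n\<in>S. \<gamma> n * (\<integral>x. mon 0 n 0 x * mon a b c x \<partial>sphere_measure))"
    by (subst Bochner_Integration.integral_sum) (auto intro!: integrable_mult_right integrable_sphere_continuous continuous_intros)
  also have "\<dots> = (\<Sum>n\<in>S. if n = a - b \<and> b \<le> a then \<gamma> (a - b) * of_real (polar_moment a c) else 0)"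
    unfolding integral_beam_mon by (intro sum.cong refl) auto
  also have "\<dots> = (if b \<le> a \<and> a - b \<in> S then \<gamma> (a - b) * of_real (polar_moment a c) else 0)"
    using assms by (cases "b \<le> a") auto
  finally show ?thesis .
qed

text \<open>\<open>beam_moment_eigen\<close> for the single degree a - b that is visible to the
  monomial.\<close>

lemma wave_moment_eigen:
  "4 * of_nat a * of_nat b * wave_moment \<alpha> t (a - 1) (b - 1) c + of_nat c * of_nat (c - 1) * wave_moment \<alpha> t a b (c - 2)
     - of_nat (a + b + c) * of_nat (a + b + c + 1) * wave_moment \<alpha> t a b c
   = - of_real (real (a - b) * real (a - b + 1)) * wave_moment \<alpha> t a b c"
proof (cases "b \<le> a")
  case True
  define m where "m = a - b"
  have am: "a = b + m" using True by (simp add: m_def)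
  define I where "I = (\<lambda>a b c. if a = b then polar_moment a c else 0)"
  have "4 * of_nat a * of_nat b * wave_moment \<alpha> t (a - 1) (b - 1) c = \<alpha> m * weyl_phase t m * of_real (4 * real a * real b * I (a - 1) (b - 1 + m) c)"
    by (cases b) (auto simp: wave_moment_def I_def am)
  moreover have "of_nat c * of_nat (c - 1) * wave_moment \<alpha> t a b (c - 2) = \<alpha> m * weyl_phase t m * of_real (real c * real (c - 1) * I a (b + m) (c - 2))"
    by (auto simp: wave_moment_def I_def am)
  moreover have w: "wave_moment \<alpha> t a b c = \<alpha> m * weyl_phase t m * of_real (I a (b + m) c)"
    by (auto simp: wave_moment_def I_def am)
  ultimately have "4 * of_nat a * of_nat b * wave_moment \<alpha> t (a - 1) (b - 1) c + of_nat c * of_nat (c - 1) * wave_moment \<alpha> t a b (c - 2)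
     - of_nat (a + b + c) * of_nat (a + b + c + 1) * wave_moment \<alpha> t a b c
    = \<alpha> m * weyl_phase t m * of_real (4 * real a * real b * I (a - 1) (b - 1 + m) c + real c * real (c - 1) * I a (b + m) (c - 2)
     - real (a + b + c) * real (a + b + c + 1) * I a (b + m) c)"
    by (simp only: of_real_add of_real_diff of_real_mult of_real_of_nat_eq distrib_left right_diff_distrib) (simp only: mult_ac)
  also have "\<dots> = \<alpha> m * weyl_phase t m * of_real (- (real m * real (m + 1)) * I a (b + m) c)"
    by (subst beam_moment_eigen[of I]) (simp_all add: I_def)
  finally show ?thesis unfolding w m_def[symmetric] by (simp only: of_real_mult of_real_minus) (simp only: mult_ac minus_mult_left minus_mult_right)
next
  case False
  then have "wave_moment \<alpha> t a b c = 0" "wave_moment \<alpha> t a b (c - 2) = 0" by (simp_all add: wave_moment_def)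
  moreover have "of_nat a * wave_moment \<alpha> t (a - 1) (b - 1) c = 0"
    using False by (cases a) (auto simp: wave_moment_def)
  ultimately show ?thesis by auto
qed

lemma wave_moment_has_derivative:
  "((\<lambda>t. wave_moment \<alpha> t a b c) has_vector_derivative (- \<i> * of_real (real (a - b) * real (a - b + 1)) * wave_moment \<alpha> t a b c)) (at t)"
proof (cases "b \<le> a")
  case True
  define m where "m = a - b"
  have "((\<lambda>t. cis (- t * (real m * (real m + 1)))) has_vector_derivative (- \<i> * of_real (real m * real (m + 1)) * cis (- t * (real m * (real m + 1))))) (at t)"
    by (auto intro!: derivative_eq_intros simp: has_vector_derivative_def scaleR_conv_of_real algebra_simps)
  then have "((\<lambda>t. \<alpha> m * of_real (polar_moment a c) * weyl_phase t m) has_vector_derivative (\<alpha> m * of_real (polar_moment a c) * (- \<i> * of_real (real m * real (m + 1)) * weyl_phase t m))) (at t)"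
    unfolding weyl_phase_def by (rule has_vector_derivative_mult_right)
  then show ?thesis using True by (simp add: wave_moment_def m_def[symmetric] mult_ac)
qed (simp add: wave_moment_def)

lemma beam_expansion_integral_tendsto:
  assumes f: "f \<in> sphere_L2"
    and lim: "(\<lambda>N. sphere_L2_norm (\<lambda>x. f x - (\<Sum>n\<le>N. co n * gaussian_beam n x))) \<longlonglongrightarrow> 0"
    and h: "continuous_on S2 h"
  shows "(\<lambda>N. \<integral>x. (\<Sum>n\<le>N. (co n * of_real (beam_coeff n)) * mon 0 n 0 x) * h x \<partial>sphere_measure) \<longlonglongrightarrow> (\<integral>x. f x * h x \<partial>sphere_measure)"
proof -
  define S where "S = (\<lambda>N x. \<Sum>n\<le>N. (co n * of_real (beam_coeff n)) * mon 0 n 0 x)"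
  define G where "G = (\<lambda>N x. f x - (\<Sum>n\<le>N. co n * gaussian_beam n x))"
  have Sc: "continuous_on S2 (S N)" for N unfolding S_def by (intro continuous_intros)
  have SG: "(\<Sum>n\<le>N. co n * gaussian_beam n x) = S N x" if "x \<in> S2" for N x
    unfolding S_def using that by (simp add: gaussian_beam_mon mult.assoc)
  have "continuous_on S2 (\<lambda>x. \<Sum>n\<le>N. co n * gaussian_beam n x)" for N
    using Sc[of N] by (rule continuous_on_eq) (simp only: SG)
  then have GL2: "G N \<in> sphere_L2" for N unfolding G_def by (intro sphere_L2_diff f sphere_L2_continuous)
  obtain B where B: "B > 0" "\<And>x. x \<in> S2 \<Longrightarrow> cmod (h x) \<le> B"
    using bounded_sphere_continuous[OF h] by blast
  have fi: "integrable sphere_measure (\<lambda>x. f x * h x)"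
    by (rule integrable_sphere_mult_continuous[OF sphere_L2_integrable[OF f] h])
  have Si: "integrable sphere_measure (\<lambda>x. S N x * h x)" for N
    by (rule integrable_sphere_mult_continuous[OF integrable_sphere_continuous[OF Sc] h])
  have split: "(\<integral>x. f x * h x \<partial>sphere_measure) - (\<integral>x. S N x * h x \<partial>sphere_measure) = (\<integral>x. G N x * h x \<partial>sphere_measure)" for N
  proof -
    have "(\<integral>x. f x * h x \<partial>sphere_measure) - (\<integral>x. S N x * h x \<partial>sphere_measure) = (\<integral>x. f x * h x - S N x * h x \<partial>sphere_measure)"
      by (rule Bochner_Integration.integral_diff[OF fi Si, symmetric])
    also have "\<dots> = (\<integral>x. G N x * h x \<partial>sphere_measure)"
      by (intro Bochner_Integration.integral_cong refl) (simp add: space_sphere_measure G_def SG left_diff_distrib)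
    finally show ?thesis .
  qed
  have "(\<lambda>N. \<integral>x. G N x * h x \<partial>sphere_measure) \<longlonglongrightarrow> 0"
  proof (rule Lim_null_comparison)
    show "\<forall>\<^sub>F N in sequentially. norm (\<integral>x. G N x * h x \<partial>sphere_measure) \<le> B * ((measure sphere_measure S2 + 1) * sphere_L2_norm (G N))"
    proof (intro always_eventually allI)
      fix N
      have "norm (\<integral>x. G N x * h x \<partial>sphere_measure) \<le> B * (\<integral>x. cmod (G N x) \<partial>sphere_measure)"
        by (rule integral_mult_continuous_bound[OF sphere_L2_integrable[OF GL2] h B(2)])
      also have "\<dots> \<le> B * ((measure sphere_measure S2 + 1) * sphere_L2_norm (G N))"
        using B(1) by (intro mult_left_mono sphere_L1_le_L2 GL2) auto
      finally show "norm (\<integral>x. G N x * h x \<partial>sphere_measure) \<le> \<dots>" .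
    qed
    have "(\<lambda>N. B * ((measure sphere_measure S2 + 1) * sphere_L2_norm (G N))) \<longlonglongrightarrow> B * ((measure sphere_measure S2 + 1) * 0)"
      unfolding G_def by (intro tendsto_intros lim)
    then show "(\<lambda>N. B * ((measure sphere_measure S2 + 1) * sphere_L2_norm (G N))) \<longlonglongrightarrow> 0" by simp
  qed
  from tendsto_diff[OF tendsto_const this, of "\<integral>x. f x * h x \<partial>sphere_measure"]
  have "(\<lambda>N. (\<integral>x. f x * h x \<partial>sphere_measure) - (\<integral>x. G N x * h x \<partial>sphere_measure)) \<longlonglongrightarrow> (\<integral>x. f x * h x \<partial>sphere_measure)" by simp
  moreover have "(\<integral>x. f x * h x \<partial>sphere_measure) - (\<integral>x. G N x * h x \<partial>sphere_measure) = (\<integral>x. S N x * h x \<partial>sphere_measure)" for N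
    using split[of N] by (simp add: algebra_simps)
  ultimately show ?thesis unfolding S_def by simp
qed

text \<open>Induction on the degree a + b + c. Tested against a monomial, the equation couples its
  moment only to moments of degree lower by two, which agree with \<open>wave_moment\<close> by
  induction. The difference then solves a homogeneous linear equation in t with initial value
  0.\<close>

theorem schroedinger_moments:
  assumes f: "f \<in> sphere_L2"
    and lim: "(\<lambda>N. sphere_L2_norm (\<lambda>x. f x - (\<Sum>n\<le>N. co n * gaussian_beam n x))) \<longlonglongrightarrow> 0"
    and u: "schroedinger_solution f u"
  shows "(\<integral>x. u t x * mon a b c x \<partial>sphere_measure) = wave_moment (\<lambda>n. co n * of_real (beam_coeff n)) t a b c"
proof -
  define \<alpha> where "\<alpha> = (\<lambda>n. co n * complex_of_real (beam_coeff n))"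
  define Y where "Y = (\<lambda>a b c t. \<integral>x. u t x * mon a b c x \<partial>sphere_measure)"
  have uL2: "u t \<in> sphere_L2" for t using u by (simp add: schroedinger_solution_def)
  have ui: "integrable sphere_measure (u t)" for t by (rule sphere_L2_integrable[OF uL2])
  have mi: "integrable sphere_measure (\<lambda>x. u t x * mon a b c x)" for t a b c
    by (intro integrable_sphere_mult_continuous ui continuous_intros)
  have Y0: "Y a b c 0 = wave_moment \<alpha> 0 a b c" for a b c
  proof -
    have "(\<integral>x. u 0 x * mon a b c x \<partial>sphere_measure) = (\<integral>x. f x * mon a b c x \<partial>sphere_measure)"
    proof (rule integral_cong_AE)
      have "AE x in sphere_measure. u 0 x = f x" using u by (simp add: schroedinger_solution_def)
      then show "AE x in sphere_measure. u 0 x * mon a b c x = f x * mon a b c x" by eventually_elim simp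
      show "(\<lambda>x. u 0 x * mon a b c x) \<in> borel_measurable sphere_measure" by (rule borel_measurable_integrable[OF mi])
      show "(\<lambda>x. f x * mon a b c x) \<in> borel_measurable sphere_measure"
        by (rule borel_measurable_integrable[OF integrable_sphere_mult_continuous[OF sphere_L2_integrable[OF f] continuous_on_mon]])
    qed
    then have Yf: "Y a b c 0 = (\<integral>x. f x * mon a b c x \<partial>sphere_measure)" by (simp add: Y_def)
    \<comment> \<open>From N = a on the partial sums contain the only degree that matters, so their
      moments no longer change.\<close>
    have "\<forall>\<^sub>F N in sequentially. (\<integral>x. (\<Sum>n\<le>N. \<alpha> n * mon 0 n 0 x) * mon a b c x \<partial>sphere_measure) = wave_moment \<alpha> 0 a b c"
      using eventually_ge_at_top[of a]
    proof eventually_elim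
      case (elim N)
      then show ?case
        using integral_beam_sum[of "{..N}" \<alpha> a b c] by (auto simp: wave_moment_def weyl_phase_def)
    qed
    then have "(\<lambda>N. \<integral>x. (\<Sum>n\<le>N. \<alpha> n * mon 0 n 0 x) * mon a b c x \<partial>sphere_measure) \<longlonglongrightarrow> wave_moment \<alpha> 0 a b c"
      by (rule tendsto_eventually)
    then show ?thesis
      using beam_expansion_integral_tendsto[OF f lim continuous_on_mon[of S2 a b c]] unfolding Yf \<alpha>_def by (rule LIMSEQ_unique[rotated])
  qed
  have Y': "(Y a b c has_vector_derivative (\<i> * (4 * of_nat a * of_nat b * Y (a - 1) (b - 1) c t + of_nat c * of_nat (c - 1) * Y a b (c - 2) t
     - of_nat (a + b + c) * of_nat (a + b + c + 1) * Y a b c t))) (at t)" for a b c t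
  proof -
    obtain D where D: "(Y a b c has_vector_derivative D) (at t)"
      "\<i> * D + (\<integral>x. u t x * laplace_beltrami (mon a b c) x \<partial>sphere_measure) = 0"
      using u smooth_on_sphere_mon[of a b c] unfolding schroedinger_solution_def Y_def by blast
    let ?k1 = "4 * of_nat a * of_nat b :: complex" and ?k2 = "of_nat c * of_nat (c - 1) :: complex" and ?k3 = "of_nat (a + b + c) * of_nat (a + b + c + 1) :: complex"
    have "(\<integral>x. u t x * laplace_beltrami (mon a b c) x \<partial>sphere_measure) = (\<integral>x. ?k1 * (u t x * mon (a - 1) (b - 1) c x) + ?k2 * (u t x * mon a b (c - 2) x) - ?k3 * (u t x * mon a b c x) \<partial>sphere_measure)"
      by (intro Bochner_Integration.integral_cong refl) (simp only: space_sphere_measure laplace_beltrami_mon distrib_left right_diff_distrib mult_ac)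
    also have "\<dots> = ?k1 * Y (a - 1) (b - 1) c t + ?k2 * Y a b (c - 2) t - ?k3 * Y a b c t"
      unfolding Y_def
      by (subst Bochner_Integration.integral_diff Bochner_Integration.integral_add, (intro Bochner_Integration.integrable_add Bochner_Integration.integrable_diff integrable_mult_right mi)+)+
        (simp only: integral_mult_right_zero)
    finally have "\<i> * D + (?k1 * Y (a - 1) (b - 1) c t + ?k2 * Y a b (c - 2) t - ?k3 * Y a b c t) = 0" using D(2) by simp
    then have "\<i> * (\<i> * D + (?k1 * Y (a - 1) (b - 1) c t + ?k2 * Y a b (c - 2) t - ?k3 * Y a b c t)) = 0" by simp
    then have "D = \<i> * (?k1 * Y (a - 1) (b - 1) c t + ?k2 * Y a b (c - 2) t - ?k3 * Y a b c t)"
      by (simp add: distrib_left[of \<i> "\<i> * D"] mult.assoc[symmetric])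
    then show ?thesis using D(1) by simp
  qed
  have "\<forall>t. Y a b c t = wave_moment \<alpha> t a b c" for a b c
  proof (induction "a + b + c" arbitrary: a b c rule: less_induct)
    case less
    let ?d = "\<lambda>t. Y a b c t - wave_moment \<alpha> t a b c"
    have "(?d has_vector_derivative (- \<i> * of_real (real (a + b + c) * real (a + b + c + 1)) * ?d t)) (at t)" for t
    proof -
      have ab: "of_nat a * of_nat b * Y (a - 1) (b - 1) c t = of_nat a * of_nat b * wave_moment \<alpha> t (a - 1) (b - 1) c"
        using less[of "a - 1" "b - 1" c] by (cases "a = 0 \<or> b = 0") auto
      have cc: "of_nat c * of_nat (c - 1) * Y a b (c - 2) t = of_nat c * of_nat (c - 1) * wave_moment \<alpha> t a b (c - 2)"
        using less[of a b "c - 2"] by (cases "c \<le> 1") auto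
      let ?E = "wave_moment \<alpha> t" and ?k3 = "of_nat (a + b + c) * of_nat (a + b + c + 1) :: complex"
      have "(?d has_vector_derivative (\<i> * (4 * of_nat a * of_nat b * Y (a - 1) (b - 1) c t + of_nat c * of_nat (c - 1) * Y a b (c - 2) t - ?k3 * Y a b c t)
        - (- \<i> * of_real (real (a - b) * real (a - b + 1)) * ?E a b c))) (at t)"
        by (intro has_vector_derivative_diff Y' wave_moment_has_derivative)
      moreover have "- of_real (real (a - b) * real (a - b + 1)) * ?E a b c = 4 * of_nat a * of_nat b * Y (a - 1) (b - 1) c t + of_nat c * of_nat (c - 1) * Y a b (c - 2) t - ?k3 * ?E a b c"
        unfolding wave_moment_eigen[symmetric] cc using ab by (simp only: mult.assoc)
      then have "\<i> * (- of_real (real (a - b) * real (a - b + 1)) * ?E a b c) = \<i> * (4 * of_nat a * of_nat b * Y (a - 1) (b - 1) c t + of_nat c * of_nat (c - 1) * Y a b (c - 2) t - ?k3 * ?E a b c)"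
        by (rule arg_cong)
      moreover have "- \<i> * of_real (real (a - b) * real (a - b + 1)) * ?E a b c = \<i> * (- of_real (real (a - b) * real (a - b + 1)) * ?E a b c)"
        by simp
      ultimately have "(?d has_vector_derivative (\<i> * (4 * of_nat a * of_nat b * Y (a - 1) (b - 1) c t + of_nat c * of_nat (c - 1) * Y a b (c - 2) t - ?k3 * Y a b c t)
        - \<i> * (4 * of_nat a * of_nat b * Y (a - 1) (b - 1) c t + of_nat c * of_nat (c - 1) * Y a b (c - 2) t - ?k3 * ?E a b c))) (at t)"
        by (simp only:)
      moreover have "\<i> * (X - ?k3 * Y a b c t) - \<i> * (X - ?k3 * ?E a b c) = - \<i> * of_real (real (a + b + c) * real (a + b + c + 1)) * ?d t" for X
        by (simp add: algebra_simps)
      ultimately show ?thesis by (simp only:)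
    qed
    then have "?d t = 0" for t by (rule linear_ode_zero) (simp add: Y0)
    then show ?case by simp
  qed
  then show ?thesis by (simp add: Y_def \<alpha>_def)
qed

lemma horizontal_disc: "x \<in> S2 \<Longrightarrow> cmod (Complex (x $ 1) (- (x $ 2))) \<le> 1"
proof -
  assume "x \<in> S2"
  then have "(x $ 1)\<^sup>2 + (x $ 2)\<^sup>2 + (x $ 3)\<^sup>2 = 1"
    by (simp add: norm_eq_1 inner_vec_def sum_3 power2_eq_square)
  then have "(x $ 1)\<^sup>2 + (x $ 2)\<^sup>2 \<le> 1" using zero_le_power2[of "x $ 3"] by linarith
  then show ?thesis by (simp add: cmod_def)
qed

text \<open>The restricted series is a uniform limit of its dyadic partial sums, so its moments are
  \<open>wave_moment\<close>, like those of u; an integrable function is determined by its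
  moments.\<close>

lemma continuous_version_series:
  fixes F :: "complex \<Rightarrow> complex"
  assumes u: "u \<in> sphere_L2" and m: "\<And>a b c. (\<integral>x. u x * mon a b c x \<partial>sphere_measure) = wave_moment \<alpha> t a b c"
    and F: "continuous_on (cball 0 1) F"
    and R: "\<And>J z. cmod z \<le> 1 \<Longrightarrow> cmod (F z - (\<Sum>n<2^J. (\<alpha> n * weyl_phase t n) * z ^ n)) \<le> R J" "R \<longlonglongrightarrow> 0"
  shows "continuous_version u (\<lambda>x. F (Complex (x $ 1) (- (x $ 2))))"
proof -
  define v where "v = (\<lambda>x :: real ^ 3. F (Complex (x $ 1) (- (x $ 2))))"
  have vc: "continuous_on S2 v"
    unfolding v_def
  proof (rule continuous_on_compose2[OF F])
    show "continuous_on S2 (\<lambda>x::real^3. Complex (x $ 1) (- (x $ 2)))"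
      unfolding Complex_eq by (intro continuous_intros)
  qed (auto intro: horizontal_disc simp del: mem_sphere_0 mem_sphere)
  have vm: "(\<integral>x. v x * mon a b c x \<partial>sphere_measure) = wave_moment \<alpha> t a b c" for a b c
  proof -
    define S where "S = (\<lambda>J x. \<Sum>n\<in>{..<2^J}. (\<alpha> n * weyl_phase t n) * mon 0 n 0 x)"
    have Sc: "continuous_on S2 (S J)" for J unfolding S_def by (intro continuous_intros)
    obtain B where B: "B > 0" "\<And>x. x \<in> S2 \<Longrightarrow> cmod (mon a b c x) \<le> B"
      using bounded_sphere_continuous[OF continuous_on_mon] by blast
    have d: "cmod (v x - S J x) \<le> R J" if "x \<in> S2" for x J
      using R(1)[OF horizontal_disc[OF that], of J] by (simp add: v_def S_def mon_def)
    have dc: "continuous_on S2 (\<lambda>x. v x - S J x)" for J by (intro continuous_intros vc Sc)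
    have "(\<lambda>J. \<integral>x. (v x - S J x) * mon a b c x \<partial>sphere_measure) \<longlonglongrightarrow> 0"
    proof (rule Lim_null_comparison)
      show "\<forall>\<^sub>F J in sequentially. norm (\<integral>x. (v x - S J x) * mon a b c x \<partial>sphere_measure) \<le> B * (measure sphere_measure S2 * R J)"
      proof (intro always_eventually allI)
        fix J
        have "norm (\<integral>x. (v x - S J x) * mon a b c x \<partial>sphere_measure) \<le> B * (\<integral>x. cmod (v x - S J x) \<partial>sphere_measure)"
          by (rule integral_mult_continuous_bound[OF integrable_sphere_continuous[OF dc] continuous_on_mon B(2)])
        also have "(\<integral>x. cmod (v x - S J x) \<partial>sphere_measure) \<le> (\<integral>x. R J \<partial>sphere_measure)"
          by (rule Bochner_Integration.integral_mono) (auto intro!: integrable_sphere_continuous continuous_intros vc Sc d simp: space_sphere_measure simp del: mem_sphere_0 mem_sphere)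
        also have "(\<integral>x. R J \<partial>sphere_measure) = measure sphere_measure S2 * R J" by (simp add: space_sphere_measure)
        finally show "norm (\<integral>x. (v x - S J x) * mon a b c x \<partial>sphere_measure) \<le> B * (measure sphere_measure S2 * R J)"
          using B(1) by (simp add: mult_left_mono)
      qed
      have "(\<lambda>J. B * (measure sphere_measure S2 * R J)) \<longlonglongrightarrow> B * (measure sphere_measure S2 * 0)" by (intro tendsto_intros R(2))
      then show "(\<lambda>J. B * (measure sphere_measure S2 * R J)) \<longlonglongrightarrow> 0" by simp
    qed
    moreover have "\<forall>\<^sub>F J in sequentially. (\<integral>x. (v x - S J x) * mon a b c x \<partial>sphere_measure) = (\<integral>x. v x * mon a b c x \<partial>sphere_measure) - wave_moment \<alpha> t a b c"
      using eventually_ge_at_top[of a]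
    proof eventually_elim
      case (elim J)
      have "a < 2 ^ J" using elim less_exp[of J] by linarith
      then have "a - b < 2 ^ J" by linarith
      then have "(\<integral>x. S J x * mon a b c x \<partial>sphere_measure) = wave_moment \<alpha> t a b c"
        unfolding S_def using integral_beam_sum[of "{..<2^J}" "\<lambda>n. \<alpha> n * weyl_phase t n" a b c] by (auto simp: wave_moment_def)
      moreover have "(\<integral>x. (v x - S J x) * mon a b c x \<partial>sphere_measure) = (\<integral>x. v x * mon a b c x \<partial>sphere_measure) - (\<integral>x. S J x * mon a b c x \<partial>sphere_measure)"
        unfolding left_diff_distrib by (rule Bochner_Integration.integral_diff) (auto intro!: integrable_sphere_continuous continuous_intros vc Sc)
      ultimately show ?case by simp
    qed
    ultimately have "(\<lambda>J. (\<integral>x. v x * mon a b c x \<partial>sphere_measure) - wave_moment \<alpha> t a b c) \<longlonglongrightarrow> 0"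
      by (rule Lim_transform_eventually)
    then show ?thesis by (simp add: LIMSEQ_const_iff)
  qed
  have ui: "integrable sphere_measure u" by (rule sphere_L2_integrable[OF u])
  have vi: "integrable sphere_measure v" by (rule integrable_sphere_continuous[OF vc])
  have "AE x in sphere_measure. u x - v x = 0"
  proof (rule sphere_moments_unique)
    show "integrable sphere_measure (\<lambda>x. u x - v x)" using ui vi by (rule Bochner_Integration.integrable_diff)
    show "(\<integral>x. (u x - v x) * mon a b c x \<partial>sphere_measure) = 0" for a b c
    proof -
      have "(\<integral>x. (u x - v x) * mon a b c x \<partial>sphere_measure) = (\<integral>x. u x * mon a b c x \<partial>sphere_measure) - (\<integral>x. v x * mon a b c x \<partial>sphere_measure)"
        unfolding left_diff_distrib by (rule Bochner_Integration.integral_diff) (intro integrable_sphere_mult_continuous ui vi continuous_intros)+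
      then show ?thesis by (simp add: m vm)
    qed
  qed
  then have "AE x in sphere_measure. u x = v x" by eventually_elim simp
  then show ?thesis using vc unfolding continuous_version_def v_def by blast
qed

section \<open>Projections of beam expansions\<close>

lemma beam_coeff_pos: "beam_coeff n > 0"
proof -
  have "0 < (2 * n + 1) * ((2 * n) choose n)" by simp
  then have "0 < sqrt (real ((2 * n + 1) * ((2 * n) choose n)))" by (simp only: real_sqrt_gt_0_iff of_nat_0_less_iff)
  then show ?thesis unfolding beam_coeff_def by (intro mult_pos_pos) simp_all
qed

lemma central_binomial_Suc: "real (Suc n) * real ((2 * Suc n) choose Suc n) = 2 * real (2 * n + 1) * real ((2 * n) choose n)"
proof -
  have d: "2 * Suc n = Suc (Suc (2 * n))" by simp
  have "Suc n * (2 * Suc n choose Suc n) = Suc (Suc (2 * n)) * (Suc (2 * n) choose n)"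
    unfolding d by (rule Suc_times_binomial)
  also have "Suc (2 * n) choose n = Suc (2 * n) choose Suc n"
    by (subst binomial_symmetric) auto
  also have "Suc (Suc (2 * n)) * (Suc (2 * n) choose Suc n) = 2 * (Suc n * (Suc (2 * n) choose Suc n))"
    unfolding d[symmetric] by (rule mult.assoc)
  also have "Suc n * (Suc (2 * n) choose Suc n) = Suc (2 * n) * (2 * n choose n)"
    by (rule Suc_times_binomial)
  finally have "real (Suc n * (2 * Suc n choose Suc n)) = real (2 * (Suc (2 * n) * (2 * n choose n)))" by (simp only:)
  then show ?thesis by (simp only: of_nat_mult) simp
qed

lemma beam_coeff_square: "(beam_coeff n)\<^sup>2 = real (2 * n + 1) * real ((2 * n) choose n) / 4 ^ n"
proof -
  have "(((1 / 2 :: real) ^ n))\<^sup>2 = ((1 / 2)\<^sup>2) ^ n" by (simp only: power_mult[symmetric] mult.commute)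
  then have "(((1 / 2 :: real) ^ n))\<^sup>2 = 1 / 4 ^ n" by (simp add: power_one_over power2_eq_square)
  moreover have "(beam_coeff n)\<^sup>2 = real ((2 * n + 1) * ((2 * n) choose n)) * ((1 / 2) ^ n)\<^sup>2"
    unfolding beam_coeff_def power_mult_distrib by (subst real_sqrt_pow2) (rule of_nat_0_le_iff, rule refl)
  ultimately show ?thesis by (simp only: of_nat_mult times_divide_eq_right mult_1_right)
qed

lemma beam_coeff_square_Suc: "(beam_coeff (Suc n))\<^sup>2 = (beam_coeff n)\<^sup>2 * (1 + 1 / (2 * (real n + 1)))"
proof -
  have "real ((2 * Suc n) choose Suc n) = 2 * real (2 * n + 1) * real ((2 * n) choose n) / real (Suc n)"
    using central_binomial_Suc[of n] by (simp add: field_simps)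
  then have "(beam_coeff (Suc n))\<^sup>2 = real (2 * Suc n + 1) * (2 * real (2 * n + 1) * real ((2 * n) choose n) / real (Suc n)) / 4 ^ Suc n"
    unfolding beam_coeff_square by (simp only:)
  also have "\<dots> = (real (2 * n + 1) * real ((2 * n) choose n) / 4 ^ n) * (real (2 * Suc n + 1) / (2 * real (Suc n)))"
  proof -
    have "x * (2 * y * P / z) / 4 ^ Suc n = y * P / 4 ^ n * (x / (2 * z))" if "z \<noteq> 0" for x y z P :: real
      using that by (simp add: field_simps)
    then show ?thesis by (simp only: of_nat_neq_0 not_False_eq_True)
  qed
  also have "real (2 * Suc n + 1) / (2 * real (Suc n)) = 1 + 1 / (2 * (real n + 1))" by (simp add: field_simps)
  finally show ?thesis unfolding beam_coeff_square .
qed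

text \<open>The L2 normalisation of the beams, as \<open>polar_moment n 0\<close> is the integral of
  |\<open>mon 0 n 0\<close>|^2. From n to n + 1 the two factors change by reciprocal ratios.\<close>

lemma beam_coeff_norm: "(beam_coeff n)\<^sup>2 * polar_moment n 0 = 1"
proof (induction n)
  case 0
  then show ?case by (simp add: beam_coeff_def polar_moment_0_0)
next
  case (Suc n)
  have "2 * real (Suc n) * polar_moment n 0 = real (2 * Suc n + 1) * polar_moment (Suc n) 0"
    using polar_moment_lower_sin[of "Suc n" 0] by simp
  then have eq: "polar_moment (Suc n) 0 * (1 + 1 / (2 * (real n + 1))) = polar_moment n 0" by (simp add: field_simps)
  have "(beam_coeff (Suc n))\<^sup>2 * polar_moment (Suc n) 0 = (beam_coeff n)\<^sup>2 * (polar_moment (Suc n) 0 * (1 + 1 / (2 * (real n + 1))))"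
    unfolding beam_coeff_square_Suc by (simp only: mult_ac)
  then show ?case unfolding eq Suc.IH .
qed

text \<open>\<open>mpoly_ops h d e e2\<close>: the Laplacian \<open>d\<close> of the polynomial \<open>h\<close>, and its first and second
  derivatives \<open>e\<close>, \<open>e2\<close> along rays, computed on monomials.\<close>

inductive mpoly_ops :: "(real ^ 3 \<Rightarrow> complex) \<Rightarrow> (real ^ 3 \<Rightarrow> complex) \<Rightarrow> (real ^ 3 \<Rightarrow> complex) \<Rightarrow> (real ^ 3 \<Rightarrow> complex) \<Rightarrow> bool" where
  mono: "mpoly_ops (\<lambda>x. k * mon a b c x)
     (\<lambda>x. k * (4 * of_nat a * of_nat b * mon (a - 1) (b - 1) c x + of_nat c * of_nat (c - 1) * mon a b (c - 2) x))
     (\<lambda>x. k * (of_nat (a + b + c) * mon a b c x)) (\<lambda>x. k * (of_nat (a + b + c) * of_nat (a + b + c - 1) * mon a b c x))"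
| add: "mpoly_ops h d e e2 \<Longrightarrow> mpoly_ops h' d' e' e2' \<Longrightarrow>
     mpoly_ops (\<lambda>x. h x + h' x) (\<lambda>x. d x + d' x) (\<lambda>x. e x + e' x) (\<lambda>x. e2 x + e2' x)"

lemma mpoly_ops_exists: "mpoly h \<Longrightarrow> \<exists>d e e2. mpoly_ops h d e e2"
  by (induction rule: mpoly.induct) (blast intro: mpoly_ops.intros)+

lemma mpoly_ops_cmult: "mpoly_ops h d e e2 \<Longrightarrow> mpoly_ops (\<lambda>x. k * h x) (\<lambda>x. k * d x) (\<lambda>x. k * e x) (\<lambda>x. k * e2 x)"
proof (induction rule: mpoly_ops.induct)
  case (mono k' a b c)
  show ?case using mpoly_ops.mono[of "k * k'" a b c] by (simp only: mult.assoc)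
next
  case (add h d e e2 h' d' e' e2')
  then show ?case unfolding distrib_left by (intro mpoly_ops.add)
qed

lemma mpoly_ops_continuous: "mpoly_ops h d e e2 \<Longrightarrow> continuous_on S h \<and> continuous_on S d \<and> continuous_on S e \<and> continuous_on S e2"
  by (induction rule: mpoly_ops.induct) (auto intro!: continuous_intros)

lemma mpoly_ops_derivatives:
  "mpoly_ops h d e e2 \<Longrightarrow> \<exists>F' F''. (\<forall>y. (h has_derivative F' y) (at y)) \<and>
     (\<forall>y b. ((\<lambda>y. F' y b) has_derivative F'' y b) (at y)) \<and> (\<forall>y. (\<Sum>b\<in>Basis. F'' y b b) = d y)"
proof (induction rule: mpoly_ops.induct)
  case (mono k a b c)
  have hom: "homog a b c 0 = mon a b c" for a b c by (simp add: homog_def fun_eq_iff)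
  have 1: "(mon a b c has_derivative homog_deriv a b c 0 y) (at y)" for y
    using homog_has_derivative[of y 0 a b c] by (simp add: hom)
  have 2: "((\<lambda>y. homog_deriv a b c 0 y v) has_derivative homog_deriv2 a b c 0 y v) (at y)" for y v
    by (rule homog_deriv_has_derivative) simp
  have 3: "(\<Sum>v\<in>Basis. homog_deriv2 a b c 0 y v v) = 4 * of_nat a * of_nat b * mon (a - 1) (b - 1) c y + of_nat c * of_nat (c - 1) * mon a b (c - 2) y" for y
    unfolding sum_homog_deriv2 hom by simp
  show ?case
    by (rule exI[of _ "\<lambda>y v. k * homog_deriv a b c 0 y v"], rule exI[of _ "\<lambda>y v w. k * homog_deriv2 a b c 0 y v w"])
      (auto intro!: has_derivative_mult_right 1 2 simp: sum_distrib_left[symmetric] 3 simp del: of_nat_diff)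
next
  case (add h d e e2 h' d' e' e2')
  then obtain F' F'' G' G'' where
    "\<forall>y. (h has_derivative F' y) (at y)" "\<forall>y b. ((\<lambda>y. F' y b) has_derivative F'' y b) (at y)" "\<forall>y. (\<Sum>b\<in>Basis. F'' y b b) = d y"
    "\<forall>y. (h' has_derivative G' y) (at y)" "\<forall>y b. ((\<lambda>y. G' y b) has_derivative G'' y b) (at y)" "\<forall>y. (\<Sum>b\<in>Basis. G'' y b b) = d' y"
    by blast
  then show ?case
    by (intro exI[of _ "\<lambda>y v. F' y v + G' y v"] exI[of _ "\<lambda>y v w. F'' y v w + G'' y v w"])
      (auto intro!: has_derivative_add simp: sum.distrib)
qed

lemma mpoly_ops_laplacian: "mpoly_ops h d e e2 \<Longrightarrow> laplacian h x = d x"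
proof -
  assume "mpoly_ops h d e e2"
  from mpoly_ops_derivatives[OF this] obtain F' F'' where
    F: "\<And>y. (h has_derivative F' y) (at y)" "\<And>y b. ((\<lambda>y. F' y b) has_derivative F'' y b) (at y)" "\<And>y. (\<Sum>b\<in>Basis. F'' y b b) = d y"
    by blast
  have "laplacian h x = (\<Sum>b\<in>Basis. F'' x b b)"
    by (rule laplacian_eq[of UNIV x h F']) (use F in auto)
  then show ?thesis using F(3) by simp
qed

lemma mon_scaleR: "mon a b c (s *\<^sub>R x) = of_real s ^ (a + b + c) * mon a b c x"
proof -
  have "horizontal (s *\<^sub>R x) = of_real s * horizontal x"
    by (simp add: horizontal_def complex_of_real_mult_Complex)
  then show ?thesis unfolding mon_horizontal by (simp add: power_mult_distrib power_add mult_ac)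
qed

lemma mpoly_ops_radial:
  "mpoly_ops h d e e2 \<Longrightarrow> \<exists>g'. (\<forall>s. ((\<lambda>s. h (s *\<^sub>R x)) has_vector_derivative g' s) (at s)) \<and> g' 1 = e x \<and> (g' has_vector_derivative e2 x) (at 1)"
proof (induction rule: mpoly_ops.induct)
  case (mono k a b c)
  define n where "n = a + b + c"
  have p: "((\<lambda>s. complex_of_real s ^ m) has_vector_derivative (of_nat m * of_real s ^ (m - 1))) (at s)" for m s
    by (auto intro!: derivative_eq_intros simp: has_vector_derivative_def scaleR_conv_of_real mult_ac)
  have 1: "((\<lambda>s. k * mon a b c x * (complex_of_real s ^ n)) has_vector_derivative (k * mon a b c x * (of_nat n * of_real s ^ (n - 1)))) (at s)" for s
    by (rule has_vector_derivative_mult_right[OF p])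
  have 2: "((\<lambda>s. (k * mon a b c x * of_nat n) * (complex_of_real s ^ (n - 1))) has_vector_derivative ((k * mon a b c x * of_nat n) * (of_nat (n - 1) * of_real 1 ^ (n - 1 - 1)))) (at 1)"
    by (rule has_vector_derivative_mult_right[OF p])
  have f: "(\<lambda>s. k * mon a b c (s *\<^sub>R x)) = (\<lambda>s. k * mon a b c x * (complex_of_real s ^ n))"
    by (simp add: mon_scaleR n_def mult_ac)
  show ?case unfolding n_def[symmetric] f
  proof (rule exI[of _ "\<lambda>s. k * mon a b c x * (of_nat n * of_real s ^ (n - 1))"], intro conjI allI)
    show "((\<lambda>s. k * mon a b c x * (of_nat n * complex_of_real s ^ (n - 1))) has_vector_derivative k * (of_nat n * of_nat (n - 1) * mon a b c x)) (at 1)"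
      using 2 by (simp add: mult_ac del: of_nat_diff)
  qed (use 1 in \<open>simp_all add: mult_ac\<close>)
next
  case (add h d e e2 h' d' e' e2')
  then obtain g g' where "\<forall>s. ((\<lambda>s. h (s *\<^sub>R x)) has_vector_derivative g s) (at s)" "g 1 = e x" "(g has_vector_derivative e2 x) (at 1)"
    "\<forall>s. ((\<lambda>s. h' (s *\<^sub>R x)) has_vector_derivative g' s) (at s)" "g' 1 = e' x" "(g' has_vector_derivative e2' x) (at 1)"
    by blast
  then show ?case
    by (intro exI[of _ "\<lambda>s. g s + g' s"]) (auto intro!: has_vector_derivative_add)
qed

section \<open>Orthogonality of beams to harmonics of other degrees\<close>

definition beam_pairing :: "nat \<Rightarrow> (real ^ 3 \<Rightarrow> complex) \<Rightarrow> complex" where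
  "beam_pairing m h = (\<integral>x. mon 0 m 0 x * cnj (h x) \<partial>sphere_measure)"

lemma beam_pairing_add:
  assumes "continuous_on S2 h" "continuous_on S2 h'"
  shows "beam_pairing m (\<lambda>x. h x + h' x) = beam_pairing m h + beam_pairing m h'"
  unfolding beam_pairing_def complex_cnj_add distrib_left
  by (rule Bochner_Integration.integral_add) (intro integrable_sphere_continuous continuous_intros assms)+

lemma beam_pairing_cmult: "beam_pairing m (\<lambda>x. k * h x) = cnj k * beam_pairing m h"
  unfolding beam_pairing_def complex_cnj_mult by (simp add: mult.left_commute)

lemma cnj_mon: "cnj (mon a b c x) = mon b a c x"
  by (simp add: mon_horizontal)

lemma beam_pairing_mon: "beam_pairing m (mon a b c) = of_real (if b = a + m then polar_moment b c else 0)"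
  unfolding beam_pairing_def cnj_mon mon_mult integral_mon by (simp add: add.commute)

text \<open>On the unit sphere the Euclidean Laplacian is the second radial derivative plus twice
  the first plus the Laplace-Beltrami operator; the last one passes to the beam and yields the
  eigenvalue - m (m + 1). On monomials this is \<open>beam_moment_eigen\<close> with a and b
  exchanged by conjugation.\<close>

lemma mpoly_ops_beam_pairing:
  "mpoly_ops h d e e2 \<Longrightarrow> beam_pairing m d = beam_pairing m e2 + 2 * beam_pairing m e - of_real (real m * real (m + 1)) * beam_pairing m h"
proof (induction rule: mpoly_ops.induct)
  case (mono k a b c)
  define I where "I = (\<lambda>a b c. if a = b then polar_moment a c else 0)"
  define n where "n = a + b + c"
  have bp: "beam_pairing m (mon a b c) = of_real (I b (a + m) c)" for a b c
    by (simp add: beam_pairing_mon I_def)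
  have cm: "beam_pairing m (\<lambda>x. k * (4 * of_nat a * of_nat b * mon (a - 1) (b - 1) c x + of_nat c * of_nat (c - 1) * mon a b (c - 2) x))
    = cnj k * of_real (4 * real b * real a * I (b - 1) (a - 1 + m) c + real c * real (c - 1) * I b (a + m) (c - 2))"
    unfolding beam_pairing_cmult
    by (subst beam_pairing_add) (auto intro!: continuous_intros simp: beam_pairing_cmult bp mult_ac simp del: of_nat_diff)
  have id: "4 * real b * real a * I (b - 1) (a - 1 + m) c + real c * real (c - 1) * I b (a + m) (c - 2)
     = (real n * real (n + 1) - real m * real (m + 1)) * I b (a + m) c"
    using beam_moment_eigen[of I b a m c] by (simp add: I_def n_def algebra_simps del: of_nat_diff)
  have n1: "real n * real (n - 1) + 2 * real n = real n * real (n + 1)" by (cases n) (auto simp: algebra_simps)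
  have "beam_pairing m (\<lambda>x. k * (of_nat n * of_nat (n - 1) * mon a b c x)) + 2 * beam_pairing m (\<lambda>x. k * (of_nat n * mon a b c x)) - of_real (real m * real (m + 1)) * beam_pairing m (\<lambda>x. k * mon a b c x)
     = cnj k * of_real ((real n * real (n - 1) + 2 * real n - real m * real (m + 1)) * I b (a + m) c)"
    unfolding beam_pairing_cmult bp by (simp add: algebra_simps del: of_nat_diff)
  then show ?case unfolding cm id n_def[symmetric] n1 by simp
next
  case (add h d e e2 h' d' e' e2')
  have c: "continuous_on S2 h" "continuous_on S2 d" "continuous_on S2 e" "continuous_on S2 e2"
    "continuous_on S2 h'" "continuous_on S2 d'" "continuous_on S2 e'" "continuous_on S2 e2'"
    using mpoly_ops_continuous[OF add.hyps(1)] mpoly_ops_continuous[OF add.hyps(2)] by blast+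
  show ?case by (simp only: beam_pairing_add c add.IH) (simp add: algebra_simps)
qed

lemma mpoly_polynomial_function:
  fixes h :: "real ^ 3 \<Rightarrow> complex"
  assumes "polynomial_function h"
  shows "mpoly h"
proof -
  have "real_polynomial_function (Re \<circ> h)" "real_polynomial_function (Im \<circ> h)"
    using assms bounded_linear_Re bounded_linear_Im unfolding polynomial_function_def by blast+
  then have "mpoly (\<lambda>x. of_real ((Re \<circ> h) x) + \<i> * of_real ((Im \<circ> h) x))"
    by (intro mpoly.add mpoly_cmult mpoly_real_polynomial)
  moreover have "(\<lambda>x. of_real ((Re \<circ> h) x) + \<i> * of_real ((Im \<circ> h) x)) = h"
    by (simp add: fun_eq_iff complex_eq_iff)
  ultimately show ?thesis by simp
qed

lemma spherical_harmonics_continuous: "h \<in> spherical_harmonics n \<Longrightarrow> continuous_on S h"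
  by (auto simp: spherical_harmonics_def intro: continuous_on_polymonial_function)

text \<open>For h harmonic and homogeneous of degree n, \<open>mpoly_ops_beam_pairing\<close> reads
  0 = (n (n + 1) - m (m + 1)) \<open>beam_pairing m h\<close>, and the factor is nonzero for m
  \<noteq> n.\<close>

lemma beam_orthogonal_spherical_harmonics:
  assumes h: "h \<in> spherical_harmonics n" and mn: "m \<noteq> n"
  shows "beam_pairing m h = 0"
proof -
  have hp: "mpoly h" and hom: "\<And>c x. h (c *\<^sub>R x) = c ^ n *\<^sub>R h x" and lap: "\<And>x. laplacian h x = 0"
    using h mpoly_polynomial_function by (auto simp: spherical_harmonics_def)
  obtain d e e2 where ops: "mpoly_ops h d e e2" using mpoly_ops_exists[OF hp] by blast
  have d0: "d = (\<lambda>x. 0)" using mpoly_ops_laplacian[OF ops] lap by (simp add: fun_eq_iff)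
  \<comment> \<open>The radial derivatives found termwise from an expansion of h agree, by
    uniqueness of derivatives, with those of s^n h(x).\<close>
  have e: "e x = of_nat n * h x \<and> e2 x = of_nat n * of_nat (n - 1) * h x" for x
  proof -
    obtain g' where g': "\<And>s. ((\<lambda>s. h (s *\<^sub>R x)) has_vector_derivative g' s) (at s)" "g' 1 = e x" "(g' has_vector_derivative e2 x) (at 1)"
      using mpoly_ops_radial[OF ops, of x] by blast
    have p: "((\<lambda>s. complex_of_real s ^ m) has_vector_derivative (of_nat m * of_real s ^ (m - 1))) (at s)" for m s
      by (auto intro!: derivative_eq_intros simp: has_vector_derivative_def scaleR_conv_of_real mult_ac)
    have hx: "(\<lambda>s. h (s *\<^sub>R x)) = (\<lambda>s. h x * complex_of_real s ^ n)" unfolding hom by (simp add: scaleR_conv_of_real mult.commute)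
    have d: "((\<lambda>s. h (s *\<^sub>R x)) has_vector_derivative h x * (of_nat n * of_real s ^ (n - 1))) (at s)" for s
      unfolding hx by (rule has_vector_derivative_mult_right[OF p])
    have g's: "g' = (\<lambda>s. (h x * of_nat n) * complex_of_real s ^ (n - 1))"
      by (rule ext) (simp only: vector_derivative_unique_at[OF g'(1) d] mult.assoc)
    have "(g' has_vector_derivative (h x * of_nat n) * (of_nat (n - 1) * of_real 1 ^ (n - 1 - 1))) (at 1)"
      unfolding g's by (rule has_vector_derivative_mult_right[OF p])
    then have "e2 x = (h x * of_nat n) * (of_nat (n - 1) * of_real 1 ^ (n - 1 - 1))"
      by (rule vector_derivative_unique_at[OF g'(3)])
    then show ?thesis using g'(2) g's by (simp add: mult_ac del: of_nat_diff)
  qed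
  have en: "e = (\<lambda>x. of_nat n * h x)" "e2 = (\<lambda>x. (of_nat n * of_nat (n - 1)) * h x)" using e by (auto simp: fun_eq_iff)
  have "0 = beam_pairing m e2 + 2 * beam_pairing m e - of_real (real m * real (m + 1)) * beam_pairing m h"
    using mpoly_ops_beam_pairing[OF ops, of m] unfolding d0 by (simp add: beam_pairing_def)
  also have "\<dots> = of_real (real n * real (n - 1) + 2 * real n - real m * real (m + 1)) * beam_pairing m h"
    unfolding en beam_pairing_cmult by (simp add: algebra_simps del: of_nat_diff)
  also have "real n * real (n - 1) + 2 * real n - real m * real (m + 1) = (real n - real m) * (real n + real m + 1)"
    by (cases n) (auto simp: algebra_simps)
  finally have eq: "0 = of_real ((real n - real m) * (real n + real m + 1)) * beam_pairing m h" .
  have "real n + real m + 1 > 0" by linarith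
  then have "(real n - real m) * (real n + real m + 1) \<noteq> 0" using mn by simp
  then show ?thesis using eq by (metis mult_eq_0_iff of_real_eq_0_iff)
qed

text \<open>\<open>laplacian\<close> is built from \<open>vector_derivative\<close>, whose
  additivity presupposes differentiability; linearity is therefore taken from expansions in
  monomials.\<close>

lemma spherical_harmonics_diff:
  assumes h: "h \<in> spherical_harmonics n" and k: "k \<in> spherical_harmonics n"
  shows "(\<lambda>x. h x - k x) \<in> spherical_harmonics n"
proof -
  obtain d e e2 where ops: "mpoly_ops h d e e2" using h mpoly_polynomial_function mpoly_ops_exists by (auto simp: spherical_harmonics_def) metis
  obtain d' e' e2' where ops': "mpoly_ops k d' e' e2'" using k mpoly_polynomial_function mpoly_ops_exists by (auto simp: spherical_harmonics_def) metis
  have "laplacian (\<lambda>x. h x + (-1) * k x) x = d x + (-1) * d' x" for x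
    by (rule mpoly_ops_laplacian[OF mpoly_ops.add[OF ops mpoly_ops_cmult[OF ops']]])
  moreover have "d x = 0" "d' x = 0" for x
    using mpoly_ops_laplacian[OF ops, of x] mpoly_ops_laplacian[OF ops', of x] h k by (auto simp: spherical_harmonics_def)
  ultimately show ?thesis using h k by (auto simp: spherical_harmonics_def scaleR_diff_right intro: polynomial_function_diff)
qed

lemma polynomial_function_complex_mult:
  fixes f g :: "real ^ 3 \<Rightarrow> complex"
  assumes "polynomial_function f" "polynomial_function g"
  shows "polynomial_function (\<lambda>x. f x * g x)"
  using assms unfolding polynomial_function_iff_Basis_inner Basis_complex_def
  by (auto simp: complex_inner_1_right complex_inner_i_right intro!: real_polynomial_function_diff real_polynomial_function.intros(3,4))

lemma beam_spherical_harmonics: "(\<lambda>x. k * mon 0 n 0 x) \<in> spherical_harmonics n"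
proof -
  have lin: "polynomial_function (\<lambda>x. cnj (horizontal x))"
    by (intro polynomial_function_bounded_linear bounded_linear_compose[OF bounded_linear_cnj bounded_linear_horizontal])
  have "polynomial_function (\<lambda>x. cnj (horizontal x) ^ n)"
    by (induction n) (auto intro: polynomial_function_complex_mult[OF lin] polynomial_function_const)
  then have "polynomial_function (\<lambda>x. k * mon 0 n 0 x)"
    unfolding mon_horizontal by (simp add: polynomial_function_complex_mult polynomial_function_const)
  moreover have "laplacian (\<lambda>x. k * mon 0 n 0 x) x = 0" for x
    using mpoly_ops_laplacian[OF mpoly_ops.mono[of k 0 n 0], of x] by simp
  moreover have "k * mon 0 n 0 (c *\<^sub>R x) = c ^ n *\<^sub>R (k * mon 0 n 0 x)" for c x
    unfolding mon_scaleR by (simp add: scaleR_conv_of_real)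
  ultimately show ?thesis unfolding spherical_harmonics_def by blast
qed

text \<open>In the open rectangle of angles the weight is positive, so the angles with nonzero value
  form an open null set, which is empty. Continuity extends the vanishing to the closed rectangle,
  which contains the poles and the cut meridian.\<close>

lemma sphere_continuous_AE_zero:
  fixes d :: "real ^ 3 \<Rightarrow> complex"
  assumes d: "continuous_on UNIV d" and z: "AE x in sphere_measure. d x = 0" and x: "x \<in> S2"
  shows "d x = 0"
proof -
  define g where "g = (\<lambda>p. d (sph_point (fst p) (snd p)))"
  have gc: "continuous_on S g" for S
    unfolding g_def by (rule continuous_on_compose2[OF d continuous_on_sph_point]) auto
  have "(\<integral>x. (cmod (d x)) \<partial>sphere_measure) = 0"
    by (rule integral_eq_zero_AE) (use z in eventually_elim, simp)
  have dm: "(\<lambda>x. cmod (d x)) \<in> borel_measurable sphere_measure"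
    by (intro borel_measurable_sphere_continuous continuous_intros continuous_on_subset[OF d]) auto
  define R where "R = {0<..<pi} \<times> {0<..<2 * pi}"
  have oR: "open R" unfolding R_def by (intro open_Times) auto
  have "0 = (\<integral>p. sphere_weight p *\<^sub>R cmod (g p) \<partial>lborel)"
    unfolding g_def integral_sphere_measure[OF dm, symmetric] using \<open>(\<integral>x. (cmod (d x)) \<partial>sphere_measure) = 0\<close> by simp
  moreover have int: "integrable lborel (\<lambda>p. sphere_weight p *\<^sub>R cmod (g p))"
  proof -
    have "integrable sphere_measure (\<lambda>x. cmod (d x))"
      by (intro integrable_sphere_continuous continuous_intros continuous_on_subset[OF d]) auto
    then have "integrable (density lborel (\<lambda>p. ennreal (sphere_weight p))) (\<lambda>p. cmod (g p))"
      unfolding sphere_measure_eq g_def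
      by (subst (asm) integrable_distr_eq) (auto intro!: borel_measurable_continuous_on_restrict continuous_intros continuous_on_subset[OF d])
    then show ?thesis
      by (subst (asm) integrable_density) (auto intro!: borel_measurable_continuous_onI continuous_intros gc simp: sphere_weight_nonneg)
  qed
  ultimately have "AE p in lborel. sphere_weight p *\<^sub>R cmod (g p) = 0"
    by (subst (asm) eq_commute, subst (asm) integral_nonneg_eq_0_iff_AE) (auto simp: sphere_weight_nonneg)
  then have ae: "AE p in lborel. p \<notin> {p\<in>R. g p \<noteq> 0}"
  proof eventually_elim
    case (elim p)
    have "sphere_weight p > 0" if "p \<in> R"
      using that by (auto simp: R_def sphere_weight_def intro!: divide_pos_pos sin_gt_zero)
    then show ?case using elim by auto
  qed
  have op: "open {p\<in>R. g p \<noteq> 0}"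
  proof -
    have "{p\<in>R. g p \<noteq> 0} = R \<inter> g -` (- {0})" by auto
    then show ?thesis using continuous_open_preimage[OF gc oR, of "- {0}"] by (simp add: open_Compl)
  qed
  have E: "{p\<in>R. g p \<noteq> 0} = {}"
  proof (rule ccontr)
    assume ne: "{p\<in>R. g p \<noteq> 0} \<noteq> {}"
    have "{p\<in>R. g p \<noteq> 0} \<in> null_sets lborel"
      using ae op by (subst AE_iff_null_sets) auto
    then have "negligible {p\<in>R. g p \<noteq> 0}"
      by (simp add: negligible_iff_null_sets null_sets_completionI)
    then show False using open_not_negligible[OF op ne] by blast
  qed
  have gR: "g p = 0" if "p \<in> R" for p using E that by blast
  have cl: "closure R = {0..pi} \<times> {0..2 * pi}" unfolding R_def by (simp add: closure_Times)
  have gcl: "g p = 0" if "p \<in> {0..pi} \<times> {0..2 * pi}" for p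
    by (rule continuous_constant_on_closure[OF gc gR]) (use that cl in auto)
  show ?thesis
    using gcl[of "(polar_angle x, azimuth x)"] sph_point_polar_azimuth[OF x] by (auto simp: g_def)
qed

text \<open>\<open>sphere_proj\<close> is a definite description, so uniqueness has to be shown as
  well: the difference d of two candidates is orthogonal to itself, hence zero on the sphere, and
  zero everywhere by homogeneity.\<close>

theorem sphere_proj_beam_expansion:
  assumes f: "f \<in> sphere_L2"
    and lim: "(\<lambda>N. sphere_L2_norm (\<lambda>x. f x - (\<Sum>n\<le>N. co n * gaussian_beam n x))) \<longlonglongrightarrow> 0"
  shows "sphere_proj n f = (\<lambda>x. (co n * of_real (beam_coeff n)) * mon 0 n 0 x)"
proof -
  define h where "h = (\<lambda>x. (co n * of_real (beam_coeff n)) * mon 0 n 0 x)"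
  define \<alpha> where "\<alpha> = (\<lambda>n. co n * complex_of_real (beam_coeff n))"
  have hH: "h \<in> spherical_harmonics n" unfolding h_def by (rule beam_spherical_harmonics)
  have fi: "integrable sphere_measure f" by (rule sphere_L2_integrable[OF f])
  have f_pair: "(\<integral>x. f x * cnj (k x) \<partial>sphere_measure) = (\<integral>x. h x * cnj (k x) \<partial>sphere_measure)" if k: "k \<in> spherical_harmonics n" for k
  proof -
    have kc: "continuous_on S2 (\<lambda>x. cnj (k x))" by (intro continuous_intros spherical_harmonics_continuous[OF k])
    have "(\<integral>x. (\<Sum>m\<le>N. \<alpha> m * mon 0 m 0 x) * cnj (k x) \<partial>sphere_measure) = (\<Sum>m\<le>N. \<alpha> m * beam_pairing m k)" for N
    proof -
      have "(\<integral>x. (\<Sum>m\<le>N. \<alpha> m * mon 0 m 0 x) * cnj (k x) \<partial>sphere_measure) = (\<integral>x. (\<Sum>m\<le>N. \<alpha> m * (mon 0 m 0 x * cnj (k x))) \<partial>sphere_measure)"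
        by (simp add: sum_distrib_right mult.assoc)
      also have "\<dots> = (\<Sum>m\<le>N. \<alpha> m * beam_pairing m k)"
        unfolding beam_pairing_def
        by (subst Bochner_Integration.integral_sum) (auto intro!: integrable_mult_right integrable_sphere_continuous continuous_intros spherical_harmonics_continuous[OF k])
      finally show ?thesis .
    qed
    moreover have "(\<Sum>m\<le>N. \<alpha> m * beam_pairing m k) = \<alpha> n * beam_pairing n k" if "N \<ge> n" for N
    proof -
      have "(\<Sum>m\<le>N. \<alpha> m * beam_pairing m k) = (\<Sum>m\<in>{n}. \<alpha> m * beam_pairing m k)"
        by (rule sum.mono_neutral_right) (use that beam_orthogonal_spherical_harmonics[OF k] in auto)
      then show ?thesis by simp
    qed
    ultimately have "(\<integral>x. (\<Sum>m\<le>N. \<alpha> m * mon 0 m 0 x) * cnj (k x) \<partial>sphere_measure) = \<alpha> n * beam_pairing n k" if "N \<ge> n" for N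
      using that by simp
    then have "\<forall>\<^sub>F N in sequentially. (\<integral>x. (\<Sum>m\<le>N. \<alpha> m * mon 0 m 0 x) * cnj (k x) \<partial>sphere_measure) = \<alpha> n * beam_pairing n k"
      unfolding eventually_sequentially by blast
    then have "(\<lambda>N. \<integral>x. (\<Sum>m\<le>N. \<alpha> m * mon 0 m 0 x) * cnj (k x) \<partial>sphere_measure) \<longlonglongrightarrow> \<alpha> n * beam_pairing n k"
      by (rule tendsto_eventually)
    then have "(\<integral>x. f x * cnj (k x) \<partial>sphere_measure) = \<alpha> n * beam_pairing n k"
      using beam_expansion_integral_tendsto[OF f lim kc] unfolding \<alpha>_def by (rule LIMSEQ_unique[rotated])
    then show ?thesis unfolding h_def beam_pairing_def \<alpha>_def by (simp add: mult.assoc)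
  qed
  have diff: "(\<integral>x. (f x - g x) * cnj (k x) \<partial>sphere_measure) = (\<integral>x. f x * cnj (k x) \<partial>sphere_measure) - (\<integral>x. g x * cnj (k x) \<partial>sphere_measure)"
    if g: "g \<in> spherical_harmonics n" and k: "k \<in> spherical_harmonics n" for g k
    unfolding left_diff_distrib
    by (rule Bochner_Integration.integral_diff)
      (intro integrable_sphere_mult_continuous fi integrable_sphere_continuous continuous_intros spherical_harmonics_continuous[OF k] spherical_harmonics_continuous[OF g])+
  show ?thesis
    unfolding sphere_proj_def h_def[symmetric]
  proof (rule the_equality)
    show "h \<in> spherical_harmonics n \<and> (\<forall>k\<in>spherical_harmonics n. (\<integral>x. (f x - h x) * cnj (k x) \<partial>sphere_measure) = 0)"
      using hH diff[OF hH] f_pair by simp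
  next
    fix g assume g: "g \<in> spherical_harmonics n \<and> (\<forall>k\<in>spherical_harmonics n. (\<integral>x. (f x - g x) * cnj (k x) \<partial>sphere_measure) = 0)"
    then have gH: "g \<in> spherical_harmonics n" by simp
    define d where "d = (\<lambda>x. g x - h x)"
    have dH: "d \<in> spherical_harmonics n" unfolding d_def by (rule spherical_harmonics_diff[OF gH hH])
    have dc: "continuous_on S d" for S by (rule spherical_harmonics_continuous[OF dH])
    have "(\<integral>x. g x * cnj (d x) \<partial>sphere_measure) = (\<integral>x. h x * cnj (d x) \<partial>sphere_measure)"
      using g dH diff[OF gH dH] f_pair[OF dH] by simp
    moreover have "(\<integral>x. d x * cnj (d x) \<partial>sphere_measure) = (\<integral>x. g x * cnj (d x) \<partial>sphere_measure) - (\<integral>x. h x * cnj (d x) \<partial>sphere_measure)"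
      unfolding d_def[THEN fun_cong] left_diff_distrib
      by (rule Bochner_Integration.integral_diff)
        (intro integrable_sphere_continuous continuous_intros spherical_harmonics_continuous[OF gH] spherical_harmonics_continuous[OF hH])+
    ultimately have "(\<integral>x. d x * cnj (d x) \<partial>sphere_measure) = 0" by simp
    then have "(\<integral>x. complex_of_real ((cmod (d x))\<^sup>2) \<partial>sphere_measure) = 0" by (simp only: complex_norm_square)
    then have "(\<integral>x. (cmod (d x))\<^sup>2 \<partial>sphere_measure) = 0" by (simp only: integral_complex_of_real of_real_eq_0_iff)
    then have "AE x in sphere_measure. (cmod (d x))\<^sup>2 = 0"
      by (subst (asm) integral_nonneg_eq_0_iff_AE) (auto intro!: integrable_sphere_continuous continuous_intros dc)
    then have "AE x in sphere_measure. d x = 0" by eventually_elim simp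
    then have d0: "d x = 0" if "x \<in> S2" for x using sphere_continuous_AE_zero[OF dc _ that] by blast
    have hom: "d (s *\<^sub>R x) = s ^ n *\<^sub>R d x" for s x using dH by (simp add: spherical_harmonics_def)
    have "d y = 0" for y
    proof (cases "y = 0")
      case True
      \<comment> \<open>For n = 0 the factor is 0^0 = 1, so the vanishing of d at a point of the
        sphere is what decides.\<close>
      have "d (0 *\<^sub>R sph_point 0 0) = 0 ^ n *\<^sub>R d (sph_point 0 0)" by (rule hom)
      moreover have "d (sph_point 0 0) = 0" by (rule d0) (rule sph_point_in_S2)
      ultimately show ?thesis using True by simp
    next
      case False
      have "d (norm y *\<^sub>R (y /\<^sub>R norm y)) = norm y ^ n *\<^sub>R d (y /\<^sub>R norm y)" by (rule hom)
      moreover have "d (y /\<^sub>R norm y) = 0" by (rule d0) (use False in simp)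
      ultimately show ?thesis using False by simp
    qed
    then show "g = h" by (simp add: d_def fun_eq_iff)
  qed
qed

lemma sphere_sobolev_beam_expansion:
  assumes f: "f \<in> sphere_L2"
    and lim: "(\<lambda>N. sphere_L2_norm (\<lambda>x. f x - (\<Sum>n\<le>N. co n * gaussian_beam n x))) \<longlonglongrightarrow> 0"
  shows "f \<in> sphere_sobolev r \<longleftrightarrow> summable (\<lambda>n. sqrt (1 + (real n)\<^sup>2) powr (2 * r) * (cmod (co n))\<^sup>2)"
proof -
  have "(sphere_L2_norm (sphere_proj n f))\<^sup>2 = (cmod (co n))\<^sup>2" for n
  proof -
    define k where "k = co n * complex_of_real (beam_coeff n)"
    have "(cmod (k * mon 0 n 0 x))\<^sup>2 = (cmod k)\<^sup>2 * Re (mon n n 0 x)" for x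
    proof -
      have "complex_of_real ((cmod (mon 0 n 0 x))\<^sup>2) = mon n n 0 x"
        unfolding complex_norm_square cnj_mon mon_mult by simp
      then have "(cmod (mon 0 n 0 x))\<^sup>2 = Re (mon n n 0 x)" by (metis Re_complex_of_real)
      then show ?thesis by (simp add: norm_mult power_mult_distrib)
    qed
    then have "(\<integral>x. (cmod (k * mon 0 n 0 x))\<^sup>2 \<partial>sphere_measure) = (cmod k)\<^sup>2 * (\<integral>x. Re (mon n n 0 x) \<partial>sphere_measure)"
      by simp
    also have "(\<integral>x. Re (mon n n 0 x) \<partial>sphere_measure) = polar_moment n 0"
      by (subst integral_Re) (auto intro!: integrable_sphere_continuous continuous_intros simp: integral_mon)
    also have "(cmod k)\<^sup>2 * polar_moment n 0 = (cmod (co n))\<^sup>2"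
      using beam_coeff_norm[of n] by (simp add: k_def norm_mult power_mult_distrib mult.assoc)
    finally have "(\<integral>x. (cmod (k * mon 0 n 0 x))\<^sup>2 \<partial>sphere_measure) = (cmod (co n))\<^sup>2" .
    then show ?thesis unfolding sphere_proj_beam_expansion[OF f lim] sphere_L2_norm_def k_def by simp
  qed
  then show ?thesis using f by (simp add: sphere_sobolev_def)
qed

section \<open>Dimension of the graphs\<close>

text \<open>This encloses \<open>beam_coeff n\<close> between multiples of (n + 1)^(1/4) by
  induction. The fourth powers have ratio (2 n + 3)^2 / (2 n + 2)^2, and both linear bounds survive
  it, as the two cross-multiplied differences n + 1 and 2 n + 3 are positive.\<close>

lemma beam_coeff_fourth_power: "real n + 1 \<le> ((beam_coeff n)\<^sup>2)\<^sup>2 \<and> ((beam_coeff n)\<^sup>2)\<^sup>2 \<le> 2 * real n + 1"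
proof (induction n)
  case 0
  then show ?case by (simp add: beam_coeff_def)
next
  case (Suc n)
  define x where "x = real n"
  have x: "x \<ge> 0" by (simp add: x_def)
  have r: "(1 + 1 / (2 * (x + 1)))\<^sup>2 = (2 * x + 3)\<^sup>2 / (4 * (x + 1)\<^sup>2)"
    using x by (simp add: power2_eq_square field_simps)
  have s: "((beam_coeff (Suc n))\<^sup>2)\<^sup>2 = ((beam_coeff n)\<^sup>2)\<^sup>2 * ((2 * x + 3)\<^sup>2 / (4 * (x + 1)\<^sup>2))"
    unfolding beam_coeff_square_Suc power_mult_distrib x_def[symmetric] r ..
  have c: "0 < 4 * (x + 1)\<^sup>2" using x by simp
  have "x + 2 \<le> (x + 1) * ((2 * x + 3)\<^sup>2 / (4 * (x + 1)\<^sup>2))"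
  proof -
    have "(x + 1) * (2 * x + 3)\<^sup>2 - (x + 2) * (4 * (x + 1)\<^sup>2) = x + 1"
      by (simp add: power2_eq_square algebra_simps)
    then show ?thesis using x c by (simp add: pos_le_divide_eq)
  qed
  also have "\<dots> \<le> ((beam_coeff (Suc n))\<^sup>2)\<^sup>2" unfolding s using Suc.IH by (intro mult_right_mono) (auto simp: x_def)
  finally have 1: "x + 2 \<le> ((beam_coeff (Suc n))\<^sup>2)\<^sup>2" .
  have "((beam_coeff (Suc n))\<^sup>2)\<^sup>2 \<le> (2 * x + 1) * ((2 * x + 3)\<^sup>2 / (4 * (x + 1)\<^sup>2))"
    unfolding s using Suc.IH by (intro mult_right_mono) (auto simp: x_def)
  also have "\<dots> \<le> 2 * x + 3"
  proof -
    have "(2 * x + 3) * (4 * (x + 1)\<^sup>2) - (2 * x + 1) * (2 * x + 3)\<^sup>2 = 2 * x + 3"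
      by (simp add: power2_eq_square algebra_simps)
    then show ?thesis using x c by (simp add: pos_divide_le_eq)
  qed
  finally show ?case using 1 by (simp add: x_def)
qed

lemma sqrt_le_beam_coeff_square: "sqrt (real n) \<le> (beam_coeff n)\<^sup>2"
  using beam_coeff_fourth_power[of n] by (intro real_le_lsqrt) auto

lemma beam_coeff_le:
  assumes "n \<ge> 1"
  shows "beam_coeff n \<le> 2 * real n powr (1 / 4)"
proof (rule power_le_imp_le_base[of _ 3])
  have "beam_coeff n ^ Suc 3 = ((beam_coeff n)\<^sup>2)\<^sup>2" by (simp add: power2_eq_square numeral_eq_Suc)
  also have "\<dots> \<le> 16 * real n" using beam_coeff_fourth_power[of n] assms by simp
  also have "\<dots> = 2 ^ Suc 3 * (real n powr (1 / 4)) ^ Suc 3" using assms by (simp add: powr_power)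
  also have "\<dots> = (2 * real n powr (1 / 4)) ^ Suc 3" by (rule power_mult_distrib[symmetric])
  finally show "beam_coeff n ^ Suc 3 \<le> (2 * real n powr (1 / 4)) ^ Suc 3" .
qed simp

text \<open>With c and d the consecutive constants, (d - c) c \<le> d^2 - c^2 = c^2 / (2 (n + 1)),
  so the increment is at most c / (2 (n + 1)).\<close>

lemma beam_coeff_diff_le:
  assumes "n \<ge> 1"
  shows "\<bar>beam_coeff (Suc n) - beam_coeff n\<bar> \<le> real n powr (1 / 4 - 1)"
proof -
  let ?c = "beam_coeff n" and ?d = "beam_coeff (Suc n)"
  have p: "?c > 0" "?d > 0" by (rule beam_coeff_pos)+
  have sq: "?d\<^sup>2 = ?c\<^sup>2 + ?c\<^sup>2 / (2 * (real n + 1))" unfolding beam_coeff_square_Suc by (simp add: algebra_simps)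
  then have "?c\<^sup>2 \<le> ?d\<^sup>2" by simp
  then have cd: "?c \<le> ?d" using p by (simp add: power2_le_iff_abs_le)
  have "(?d - ?c) * ?c \<le> (?d - ?c) * (?d + ?c)" using cd p by (intro mult_left_mono) auto
  also have "\<dots> = ?d\<^sup>2 - ?c\<^sup>2" by (simp add: power2_eq_square algebra_simps)
  also have "\<dots> = (?c / (2 * (real n + 1))) * ?c" unfolding sq by (simp add: power2_eq_square)
  finally have "?d - ?c \<le> ?c / (2 * (real n + 1))" using p by (simp only: mult_le_cancel_right_pos)
  also have "\<dots> \<le> (2 * real n powr (1 / 4)) / (2 * real n)"
    using beam_coeff_le[OF assms] p assms by (intro frac_le) auto
  also have "\<dots> = real n powr (1 / 4 - 1)" using assms by (simp only: powr_diff) simp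
  finally show ?thesis using cd by simp
qed

text \<open>Normalisation of the beams multiplies the coefficients by a factor of order n^(1/4), so
  the decay exponent drops from p to p - 1/4. The 3 is 2 from \<open>beam_coeff_le\<close> plus 1
  from the increments of \<open>beam_coeff\<close>.\<close>

lemma beam_coefficient_bounds:
  fixes a :: "nat \<Rightarrow> complex"
  assumes p: "1 / 4 < p"
    and a1: "\<And>n. n \<ge> 1 \<Longrightarrow> cmod (a n) \<le> C / real n powr p"
    and a2: "\<And>n. n \<ge> 1 \<Longrightarrow> cmod (a n - a (n - 1)) \<le> C / real n powr (p + 1)"
  shows beam_coefficient_bound: "n \<ge> 1 \<Longrightarrow> cmod (a n * of_real (beam_coeff n)) \<le> (3 * C) * real n powr (- (p - 1 / 4))"
    and beam_coefficient_diff_bound: "n \<ge> 1 \<Longrightarrow>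
      cmod (a (Suc n) * of_real (beam_coeff (Suc n)) - a n * of_real (beam_coeff n)) \<le> (3 * C) * real n powr (- (p - 1 / 4) - 1)"
proof -
  have C: "0 \<le> C" using order_trans[OF norm_ge_zero a1[of 1]] by simp
  have bp: "beam_coeff n \<ge> 0" for n using beam_coeff_pos[of n] by simp
  show "cmod (a n * of_real (beam_coeff n)) \<le> (3 * C) * real n powr (- (p - 1 / 4))" if n: "n \<ge> 1" for n
  proof -
    have "cmod (a n * of_real (beam_coeff n)) = cmod (a n) * beam_coeff n" using bp by (simp add: norm_mult)
    also have "\<dots> \<le> (C / real n powr p) * (2 * real n powr (1 / 4))"
      using a1[OF n] beam_coeff_le[OF n] bp C by (intro mult_mono) auto
    also have "\<dots> = 2 * C * real n powr (- (p - 1 / 4))"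
    proof -
      have "real n powr (- (p - 1 / 4)) = real n powr (1 / 4) / real n powr p"
        unfolding powr_diff[symmetric] by (rule arg_cong[where f = "\<lambda>y. real n powr y"]) simp
      then show ?thesis by (simp only:) simp
    qed
    also have "\<dots> \<le> 3 * C * real n powr (- (p - 1 / 4))" using C by (intro mult_right_mono) auto
    finally show ?thesis by simp
  qed
  show "cmod (a (Suc n) * of_real (beam_coeff (Suc n)) - a n * of_real (beam_coeff n)) \<le> (3 * C) * real n powr (- (p - 1 / 4) - 1)"
    if n: "n \<ge> 1" for n
  proof -
    have "a (Suc n) * of_real (beam_coeff (Suc n)) - a n * of_real (beam_coeff n)
       = (a (Suc n) - a n) * of_real (beam_coeff (Suc n)) + a n * of_real (beam_coeff (Suc n) - beam_coeff n)"
      by (simp add: algebra_simps)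
    also have "cmod \<dots> \<le> cmod (a (Suc n) - a n) * beam_coeff (Suc n) + cmod (a n) * \<bar>beam_coeff (Suc n) - beam_coeff n\<bar>"
      by (rule order.trans[OF norm_triangle_ineq]) (use bp in \<open>simp add: norm_mult del: of_real_diff\<close>)
    also have "\<dots> \<le> (C / real (Suc n) powr (p + 1)) * (2 * real (Suc n) powr (1 / 4)) + (C / real n powr p) * real n powr (1 / 4 - 1)"
      using a1[OF n] a2[of "Suc n"] beam_coeff_le[of "Suc n"] beam_coeff_diff_le[OF n] bp C by (intro add_mono mult_mono) auto
    also have "(C / real (Suc n) powr (p + 1)) * (2 * real (Suc n) powr (1 / 4)) = 2 * C * real (Suc n) powr (- (p - 1 / 4) - 1)"
    proof -
      have "real (Suc n) powr (- (p - 1 / 4) - 1) = real (Suc n) powr (1 / 4) / real (Suc n) powr (p + 1)"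
        unfolding powr_diff[symmetric] by (rule arg_cong[where f = "\<lambda>y. real (Suc n) powr y"]) simp
      then show ?thesis by (simp only:) simp
    qed
    also have "(C / real n powr p) * real n powr (1 / 4 - 1) = C * real n powr (- (p - 1 / 4) - 1)"
    proof -
      have "real n powr (- (p - 1 / 4) - 1) = real n powr (1 / 4 - 1) / real n powr p"
        unfolding powr_diff[symmetric] by (rule arg_cong[where f = "\<lambda>y. real n powr y"]) simp
      then show ?thesis by (simp only:) simp
    qed
    also have "2 * C * real (Suc n) powr (- (p - 1 / 4) - 1) \<le> 2 * C * real n powr (- (p - 1 / 4) - 1)"
      using n p C by (intro mult_left_mono powr_mono2') auto
    finally show ?thesis by simp
  qed
qed

text \<open>Failing to lie in the Sobolev space forces infinitely many dyadic blocks to carry almost the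
  largest energy that the coefficient bounds allow.\<close>

lemma large_dyadic_energy:
  fixes a :: "nat \<Rightarrow> complex"
  assumes p: "3 / 4 < p" and \<eta>: "0 < \<eta>"
    and ns: "\<not> summable (\<lambda>n. sqrt (1 + (real n)\<^sup>2) powr (2 * (p - 1 / 2 + \<eta> / 4)) * (cmod (a n))\<^sup>2)"
  shows "\<exists>j\<ge>j0. (2 ^ j) powr (1 - 2 * (p - 1 / 4) - \<eta>) \<le> (\<Sum>n\<in>{2^j..<2 * 2^j}. (cmod (a n * of_real (beam_coeff n)))\<^sup>2)"
proof (rule ccontr)
  assume neg: "\<not> ?thesis"
  \<comment> \<open>The Sobolev excess \<eta> / 4 enters the weight as N^(\<eta> / 2), which leaves
    half of the assumed energy deficit N^(-\<eta>) for a geometric series.\<close>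
  define r where "r = 2 * (p - 1 / 2 + \<eta> / 4)"
  define E where "E = (\<lambda>j. \<Sum>n\<in>{2^j..<2 * 2^j}. (cmod (a n * of_real (beam_coeff n)))\<^sup>2)"
  have E: "E j < (2 ^ j) powr (1 - 2 * (p - 1 / 4) - \<eta>)" if "j \<ge> j0" for j
    using neg that unfolding E_def not_le[symmetric] by blast
  define g where "g = (\<lambda>n. sqrt (1 + (real n)\<^sup>2) powr r * (cmod (a n))\<^sup>2)"
  define G where "G = (\<lambda>j. \<Sum>n\<in>{2^j..<2 * 2^j}. g n)"
  have g0: "g n \<ge> 0" for n by (simp add: g_def)
  have G0: "G j \<ge> 0" for j unfolding G_def by (intro sum_nonneg g0)
  have r0: "r > 0" using p \<eta> by (simp add: r_def)
  have G: "G j \<le> 4 powr r * (2 powr (- \<eta> / 2)) ^ j" if j: "j \<ge> j0" for j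
  proof -
    define N where "N = (2::real) ^ j"
    have N: "N \<ge> 1" by (simp add: N_def)
    have "g n \<le> (4 * N) powr r * N powr (- 1 / 2) * (cmod (a n * of_real (beam_coeff n)))\<^sup>2" if n: "n \<in> {2^j..<2 * 2^j}" for n
    proof -
      have nN: "N \<le> real n" "real n \<le> 2 * N"
        using n of_nat_mono[of "2 ^ j" n, where 'a = real] of_nat_mono[of n "2 * 2 ^ j", where 'a = real] by (auto simp: N_def)
      have "sqrt (1 + (real n)\<^sup>2) \<le> 1 + real n"
        using nN N by (intro real_le_lsqrt) (auto simp: power2_eq_square algebra_simps)
      also have "\<dots> \<le> 4 * N" using nN N by linarith
      finally have 1: "sqrt (1 + (real n)\<^sup>2) powr r \<le> (4 * N) powr r" using r0 by (intro powr_mono2) auto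
      \<comment> \<open>The squared normalising constant is at least sqrt n, so passing from the
        monomial coefficient back to a n gains N^(-1/2).\<close>
      have "(cmod (a n))\<^sup>2 * N powr (1 / 2) \<le> (cmod (a n))\<^sup>2 * (beam_coeff n)\<^sup>2"
        using order_trans[OF real_sqrt_le_mono[OF nN(1)] sqrt_le_beam_coeff_square] N
        by (intro mult_left_mono) (simp_all add: powr_half_sqrt del: real_sqrt_le_iff)
      then have "(cmod (a n))\<^sup>2 * N powr (1 / 2) * N powr (- 1 / 2) \<le> (cmod (a n))\<^sup>2 * (beam_coeff n)\<^sup>2 * N powr (- 1 / 2)"
        by (rule mult_right_mono) simp
      moreover have "N powr (1 / 2) * N powr (- 1 / 2) = 1" using N by (simp flip: powr_add)
      ultimately have 2: "(cmod (a n))\<^sup>2 \<le> N powr (- 1 / 2) * (cmod (a n * of_real (beam_coeff n)))\<^sup>2"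
        by (simp add: norm_mult power_mult_distrib mult.assoc) (simp add: mult_ac)
      have "g n \<le> (4 * N) powr r * (N powr (- 1 / 2) * (cmod (a n * of_real (beam_coeff n)))\<^sup>2)"
        unfolding g_def using 1 2 by (intro mult_mono) auto
      then show ?thesis by (simp only: mult.assoc)
    qed
    then have "G j \<le> (\<Sum>n\<in>{2^j..<2 * 2^j}. (4 * N) powr r * N powr (- 1 / 2) * (cmod (a n * of_real (beam_coeff n)))\<^sup>2)"
      unfolding G_def by (rule sum_mono)
    also have "\<dots> = (4 * N) powr r * N powr (- 1 / 2) * E j" by (simp add: E_def sum_distrib_left)
    also have "\<dots> \<le> (4 * N) powr r * N powr (- 1 / 2) * N powr (1 - 2 * (p - 1 / 4) - \<eta>)"
      using E[OF j] by (intro mult_left_mono) (auto simp: N_def)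
    also have "\<dots> = 4 powr r * (N powr r * N powr (- 1 / 2) * N powr (1 - 2 * (p - 1 / 4) - \<eta>))"
      using N by (simp add: powr_mult)
    also have "N powr r * N powr (- 1 / 2) * N powr (1 - 2 * (p - 1 / 4) - \<eta>) = N powr (- \<eta> / 2)"
      unfolding powr_add[symmetric] by (rule arg_cong[where f = "\<lambda>x. N powr x"]) (simp add: r_def field_simps)
    also have "N powr (- \<eta> / 2) = (2 powr (- \<eta> / 2)) ^ j"
      by (simp add: N_def powr_realpow[symmetric] powr_powr mult.commute)
    finally show ?thesis .
  qed
  have "2 powr (- \<eta> / 2) < (2::real) powr 0" using \<eta> by (intro powr_less_mono) auto
  then have "summable (\<lambda>j. 4 powr r * (2 powr (- \<eta> / 2)) ^ j)" by (intro summable_mult summable_geometric) auto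
  then have sG: "summable G"
    by (rule summable_comparison_test'[of _ j0]) (use G G0 in auto)
  have "summable g"
  proof (rule summableI_nonneg_bounded[of _ "g 0 + suminf G"])
    fix N
    have "(\<Sum>n<N. g n) \<le> (\<Sum>n<2^N. g n)"
      using less_exp[of N] by (intro sum_mono2) (auto simp: g0)
    also have "\<dots> = g 0 + (\<Sum>j<N. G j)" unfolding G_def by (rule sum_dyadic)
    also have "\<dots> \<le> g 0 + suminf G" using sum_le_suminf[OF sG, of "{..<N}"] G0 by simp
    finally show "(\<Sum>n<N. g n) \<le> g 0 + suminf G" .
  qed (rule g0)
  then show False using ns by (simp add: g_def r_def)
qed

section \<open>From coefficient bounds to dimensions\<close>

lemma hoelder_continuous_on:
  fixes F :: "'a::metric_space \<Rightarrow> 'b::metric_space"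
  assumes H: "0 \<le> H" and \<alpha>: "0 < \<alpha>" and F: "\<And>x y. x \<in> S \<Longrightarrow> y \<in> S \<Longrightarrow> dist (F x) (F y) \<le> H * dist x y powr \<alpha>"
  shows "continuous_on S F"
  unfolding continuous_on_iff
proof (intro ballI allI impI)
  fix x e assume x: "x \<in> S" and e: "(e::real) > 0"
  define \<delta> where "\<delta> = (e / (H + 1)) powr (1 / \<alpha>)"
  have d0: "\<delta> > 0" using e H by (simp add: \<delta>_def)
  have "dist (F y) (F x) < e" if y: "y \<in> S" "dist y x < \<delta>" for y
  proof -
    have "dist y x powr \<alpha> \<le> \<delta> powr \<alpha>" using y \<alpha> by (intro powr_mono2) auto
    also have "\<dots> = e / (H + 1)" using \<alpha> e H by (simp add: \<delta>_def powr_powr)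
    finally have "H * dist y x powr \<alpha> \<le> H * (e / (H + 1))" using H by (rule mult_left_mono)
    also have "\<dots> < e" using e H by (simp add: field_simps)
    finally show ?thesis using F[OF y(1) x] by simp
  qed
  then show "\<exists>d>0. \<forall>y\<in>S. dist y x < d \<longrightarrow> dist (F y) (F x) < e" using d0 by blast
qed

lemma horizontal_dist: "cmod (Complex (x $ 1) (- (x $ 2)) - Complex (y $ 1) (- (y $ 2))) \<le> norm (x - y :: real ^ 3)"
proof -
  have "(x $ 1 - y $ 1)\<^sup>2 + (y $ 2 - x $ 2)\<^sup>2 \<le> (x $ 1 - y $ 1)\<^sup>2 + (x $ 2 - y $ 2)\<^sup>2 + (x $ 3 - y $ 3)\<^sup>2"
    by (simp add: power2_commute)
  also have "\<dots> = (norm (x - y))\<^sup>2"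
    unfolding power2_norm_eq_inner inner_vec_def sum_3 by (simp add: power2_eq_square)
  finally show ?thesis unfolding cmod_def by (intro real_le_lsqrt) (simp_all add: algebra_simps)
qed

text \<open>Everything is first proved with a loss d > 0 and then d tends to 0. One v is produced
  for both bounds, and the lower one is conditional on large energies of infinitely many
  blocks.\<close>

lemma graph_dim_series_bounds:
  fixes b :: "nat \<Rightarrow> complex"
  assumes q: "1 / 2 < q" "q < 1" and C: "0 \<le> C"
    and b1: "\<And>n. n \<ge> 1 \<Longrightarrow> cmod (b n) \<le> C * real n powr (-q)"
    and b2: "\<And>n. n \<ge> 1 \<Longrightarrow> cmod (b (Suc n) - b n) \<le> C * real n powr (-q-1)"
    and W: "\<forall>d>0. \<exists>K\<ge>0. \<forall>M L w. cmod w = 1 \<longrightarrow> cmod (\<Sum>m<L. weyl_phase t (M+m) * w ^ (M+m)) \<le> K * real L powr (1/2 + d)"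
    and u: "u \<in> sphere_L2" and m: "\<And>a c e. (\<integral>x. u x * mon a c e x \<partial>sphere_measure) = wave_moment b t a c e"
  obtains v where "continuous_version u v" "graph_dim v \<le> ereal (7 / 2 - q)"
    "(\<And>\<eta> j0. 0 < \<eta> \<Longrightarrow> \<exists>j\<ge>j0. (2 ^ j) powr (1 - 2 * q - \<eta>) \<le> (\<Sum>n\<in>{2^j..<2 * 2^j}. (cmod (b n))\<^sup>2)) \<Longrightarrow> ereal (3 - q) \<le> graph_dim v"
proof -
  define \<beta> where "\<beta> = (\<lambda>n. b n * weyl_phase t n)"
  define F where "F = dyadic_series \<beta>"
  define v where "v = (\<lambda>x :: real ^ 3. F (Complex (x $ 1) (- (x $ 2))))"
  \<comment> \<open>A, R and H depend on d, but F and v do not, so the bounds for different d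
    concern the same graph.\<close>
  have data: "\<exists>A R H. A \<ge> 0 \<and> (\<forall>j z. cmod z \<le> 1 \<longrightarrow> cmod (dyadic_block \<beta> j z) \<le> A * (2 powr (1/2 + d - q)) ^ j)
      \<and> (\<forall>J z. cmod z \<le> 1 \<longrightarrow> cmod (F z - (\<Sum>n<2^J. \<beta> n * z ^ n)) \<le> R J) \<and> R \<longlonglongrightarrow> 0
      \<and> H \<ge> 0 \<and> (\<forall>z z'. cmod z \<le> 1 \<longrightarrow> cmod z' \<le> 1 \<longrightarrow> cmod (F z - F z') \<le> H * cmod (z - z') powr (q - 1/2 - d))"
    if d: "0 < d" "d < q - 1 / 2" for d
  proof -
    define y where "y = (2::real) powr (1/2 + d - q)"
    have "2 powr (-1) < y" unfolding y_def using d q by (intro powr_less_mono) auto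
    then have y1: "1 / 2 < y" by (simp add: powr_minus)
    have "y < 2 powr 0" unfolding y_def using d q by (intro powr_less_mono) auto
    then have y2: "y < 1" by simp
    have q0: "0 < q" using q by simp
    obtain A where A: "A \<ge> 0" "\<And>j z. cmod z \<le> 1 \<Longrightarrow> cmod (dyadic_block \<beta> j z) \<le> A * y ^ j"
      "\<And>j z z'. cmod z \<le> 1 \<Longrightarrow> cmod z' \<le> 1 \<Longrightarrow> cmod (dyadic_block \<beta> j z - dyadic_block \<beta> j z') \<le> A * (2 * y) ^ j * cmod (z - z')"
      using weyl_dyadic_bounds[OF q0 C d(1) b1 b2 W] unfolding \<beta>_def y_def by blast
    have rem: "cmod (F z - (\<Sum>n<2^J. \<beta> n * z ^ n)) \<le> A / (1 - y) * y ^ J" if "cmod z \<le> 1" for z J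
      unfolding F_def by (rule dyadic_series_remainder[OF y1 y2 A that])
    obtain H where H: "H \<ge> 0" "\<forall>z z'. cmod z \<le> 1 \<longrightarrow> cmod z' \<le> 1 \<longrightarrow> cmod (F z - F z') \<le> H * cmod (z - z') powr (- log 2 y)"
      using dyadic_series_hoelder[OF y1 y2 A] unfolding F_def by blast
    have "(\<lambda>J. A / (1 - y) * y ^ J) \<longlonglongrightarrow> A / (1 - y) * 0"
      using y1 y2 by (intro tendsto_intros LIMSEQ_realpow_zero) auto
    then have R: "(\<lambda>J. A / (1 - y) * y ^ J) \<longlonglongrightarrow> 0" by simp
    have "- log 2 y = q - 1/2 - d" by (simp add: y_def log_powr)
    then show ?thesis
      using A(1,2) rem R H unfolding y_def[symmetric] by (intro exI[of _ A] exI[of _ "\<lambda>J. A / (1 - y) * y ^ J"] exI[of _ H]) auto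
  qed
  \<comment> \<open>Any admissible loss yields continuity; d0 is one fixed choice.\<close>
  define d0 where "d0 = (q - 1 / 2) / 2"
  have d0: "0 < d0" "d0 < q - 1 / 2" using q by (auto simp: d0_def)
  obtain R H where R: "\<And>J z. cmod z \<le> 1 \<Longrightarrow> cmod (F z - (\<Sum>n<2^J. \<beta> n * z ^ n)) \<le> R J" "R \<longlonglongrightarrow> 0"
    and H: "H \<ge> 0" "\<And>z z'. cmod z \<le> 1 \<Longrightarrow> cmod z' \<le> 1 \<Longrightarrow> cmod (F z - F z') \<le> H * cmod (z - z') powr (q - 1/2 - d0)"
    using data[OF d0] by blast
  have Fc: "continuous_on (cball 0 1) F"
    by (rule hoelder_continuous_on[OF H(1), of "q - 1/2 - d0"]) (use H(2) d0 in \<open>auto simp: dist_norm\<close>)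
  have ver: "continuous_version u v"
    unfolding v_def by (rule continuous_version_series[OF u m Fc R(1)[unfolded \<beta>_def] R(2)])
  then have vc: "continuous_on S2 v" by (simp add: continuous_version_def)
  have hoelder: "\<exists>H\<ge>0. \<forall>x\<in>S2. \<forall>y\<in>S2. cmod (v x - v y) \<le> H * norm (x - y) powr (q - 1/2 - d)" if d: "0 < d" "d < q - 1 / 2" for d
  proof -
    obtain H where H: "H \<ge> 0" "\<And>z z'. cmod z \<le> 1 \<Longrightarrow> cmod z' \<le> 1 \<Longrightarrow> cmod (F z - F z') \<le> H * cmod (z - z') powr (q - 1/2 - d)"
      using data[OF d] by blast
    have "cmod (v x - v y) \<le> H * norm (x - y) powr (q - 1/2 - d)" if "x \<in> S2" "y \<in> S2" for x y
    proof -
      have "cmod (v x - v y) \<le> H * cmod (Complex (x $ 1) (- (x $ 2)) - Complex (y $ 1) (- (y $ 2))) powr (q - 1/2 - d)"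
        unfolding v_def by (rule H(2)[OF horizontal_disc[OF that(1)] horizontal_disc[OF that(2)]])
      also have "\<dots> \<le> H * norm (x - y) powr (q - 1/2 - d)"
        using H(1) d horizontal_dist[of x y] by (intro mult_left_mono powr_mono2) auto
      finally show ?thesis .
    qed
    then show ?thesis using H(1) by blast
  qed
  have dim_le: "graph_dim v \<le> ereal (7 / 2 - q + d)" if d: "0 < d" "d < q - 1 / 2" for d
  proof -
    obtain H where H: "H \<ge> 0" "\<And>x y. x \<in> S2 \<Longrightarrow> y \<in> S2 \<Longrightarrow> cmod (v x - v y) \<le> H * norm (x - y) powr (q - 1/2 - d)"
      using hoelder[OF d] by blast
    have "\<bar>Re (v x) - Re (v y)\<bar> \<le> H * norm (x - y) powr (q - 1/2 - d)" "\<bar>Im (v x) - Im (v y)\<bar> \<le> H * norm (x - y) powr (q - 1/2 - d)"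
      if "x \<in> S2" "y \<in> S2" for x y
      using H(2)[OF that] abs_Re_le_cmod[of "v x - v y"] abs_Im_le_cmod[of "v x - v y"] by auto
    then have "fractal_dim (sphere_graph (\<lambda>x. Re (v x))) \<le> ereal (3 - (q - 1/2 - d))" "fractal_dim (sphere_graph (\<lambda>x. Im (v x))) \<le> ereal (3 - (q - 1/2 - d))"
      using q d by (intro fractal_dim_hoelder_graph[OF _ _ H(1)]; simp)+
    then show ?thesis unfolding graph_dim_def by (simp add: algebra_simps)
  qed
  have upper: "graph_dim v \<le> ereal (7 / 2 - q)"
  proof (rule ereal_le_epsilon2)
    fix e :: real assume e: "e > 0"
    have "graph_dim v \<le> ereal (7 / 2 - q + min e d0)" by (rule dim_le) (use e d0 in auto)
    also have "\<dots> \<le> ereal (7 / 2 - q) + ereal e" by simp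
    finally show "graph_dim v \<le> ereal (7 / 2 - q) + ereal e" .
  qed
  have lower: "ereal (3 - q) \<le> graph_dim v"
    if energy: "\<And>\<eta> j0. 0 < \<eta> \<Longrightarrow> \<exists>j\<ge>j0. (2 ^ j) powr (1 - 2 * q - \<eta>) \<le> (\<Sum>n\<in>{2^j..<2 * 2^j}. (cmod (b n))\<^sup>2)"
  proof (rule ereal_le_epsilon2)
    let ?g1 = "sphere_graph (\<lambda>x. Re (v x))" and ?g2 = "sphere_graph (\<lambda>x. Im (v x))"
    have main: "ereal (3 - q - 2 * d) \<le> graph_dim v" if d: "0 < d" "d < q - 1 / 2" for d
    proof -
      obtain A where A: "A \<ge> 0" "\<And>j z. cmod z \<le> 1 \<Longrightarrow> cmod (dyadic_block \<beta> j z) \<le> A * (2 powr (1/2 + d - q)) ^ j"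
        using data[OF d] by blast
      obtain H where H: "H \<ge> 0" "\<And>x y. x \<in> S2 \<Longrightarrow> y \<in> S2 \<Longrightarrow> cmod (v x - v y) \<le> H * norm (x - y) powr (q - 1/2 - d)"
        using hoelder[OF d] by blast
      \<comment> \<open>One d is lost in the energy of the block and one in its sup norm.\<close>
      define s where "s = 3 - q - 2 * d"
      \<comment> \<open>1600 is twice the 800 of \<open>graph_cover_lower_bound\<close>, so each
        graph can be compared with half of the total 2 K; A + 1 keeps B positive when A = 0.\<close>
      define K where "K = 1 / (1600 * (A + 1))"
      have K: "K > 0" using A(1) by (simp add: K_def)
      have cover: "\<exists>j\<ge>j0. 2 * K * (1 / (1 / 2 ^ j)) powr s \<le> real (covering_number ?g1 (1 / 2 ^ j)) + real (covering_number ?g2 (1 / 2 ^ j))" for j0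
      proof -
        obtain j where j: "j \<ge> max j0 4" "(2 ^ j) powr (1 - 2 * q - d) \<le> (\<Sum>n\<in>{2^j..<2 * 2^j}. (cmod (b n))\<^sup>2)"
          using energy[OF d(1), of "max j0 4"] by blast
        define N where "N = (2::nat) ^ j"
        have N2: "real N = 2 ^ j" by (simp add: N_def)
        have N1: "real N > 1" unfolding N2 using j(1) by simp
        have e: "0 < 1 / real N" "1 / real N < 1" using N1 by auto
        have attained: "\<exists>B. finite B \<and> sphere_graph g \<subseteq> (\<Union>c\<in>B. cbox c (c + (1 / real N) *\<^sub>R One)) \<and> covering_number (sphere_graph g) (1 / real N) = card B"
          if g: "\<And>x y. x \<in> S2 \<Longrightarrow> y \<in> S2 \<Longrightarrow> \<bar>g x - g y\<bar> \<le> H * norm (x - y) powr (q - 1/2 - d)" for g :: "real ^ 3 \<Rightarrow> real"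
        proof -
          have a: "0 < q - 1/2 - d" "q - 1/2 - d \<le> 1" using d q by auto
          obtain B where "finite B" "sphere_graph g \<subseteq> (\<Union>c\<in>B. cbox c (c + (1 / real N) *\<^sub>R One))"
            by (rule sphere_graph_cover[where g = g, OF a H(1) g e])
          then obtain B' where "finite B'" "sphere_graph g \<subseteq> (\<Union>c\<in>B'. cbox c (c + (1 / real N) *\<^sub>R One))"
            "covering_number (sphere_graph g) (1 / real N) = card B'"
            by (rule covering_number_attained)
          then show ?thesis by (intro exI[of _ B'] conjI)
        qed
        have re: "\<bar>Re (v x) - Re (v y)\<bar> \<le> H * norm (x - y) powr (q - 1/2 - d)"
          and im: "\<bar>Im (v x) - Im (v y)\<bar> \<le> H * norm (x - y) powr (q - 1/2 - d)" if "x \<in> S2" "y \<in> S2" for x y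
          using H(2)[OF that] abs_Re_le_cmod[of "v x - v y"] abs_Im_le_cmod[of "v x - v y"] by auto
        obtain A1 where A1: "finite A1" "?g1 \<subseteq> (\<Union>c\<in>A1. cbox c (c + (1 / real N) *\<^sub>R One))" "covering_number ?g1 (1 / real N) = card A1"
          using attained[OF re] by blast
        obtain A2 where A2: "finite A2" "?g2 \<subseteq> (\<Union>c\<in>A2. cbox c (c + (1 / real N) *\<^sub>R One))" "covering_number ?g2 (1 / real N) = card A2"
          using attained[OF im] by blast
        define B where "B = (A + 1) * real N powr (1/2 + d - q)"
        have Bp: "B > 0" using A(1) N1 by (simp add: B_def)
        have yN: "(2 powr (1/2 + d - q)) ^ j = real N powr (1/2 + d - q)"
          unfolding N2 by (simp add: powr_realpow[symmetric] powr_powr mult.commute)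
        have Bb: "cmod (dyadic_block \<beta> j w) \<le> B" if "cmod w = 1" for w
        proof -
          have "cmod (dyadic_block \<beta> j w) \<le> A * (2 powr (1/2 + d - q)) ^ j" by (rule A(2)) (simp add: that)
          also have "\<dots> \<le> B" unfolding yN B_def by (intro mult_right_mono) auto
          finally show ?thesis .
        qed
        have j4: "4 \<le> j" using j(1) by simp
        have lb: "(real N)\<^sup>2 * sqrt (real N) * (\<Sum>n\<in>{N..<2*N}. (cmod (\<beta> n))\<^sup>2) / (800 * B) \<le> real (card A1) + real (card A2)"
          by (rule graph_cover_lower_bound[OF Fc v_def[THEN fun_cong] vc R Bb Bp j4 N_def A1(1,2) A2(1,2)])
        have \<beta>_b: "(\<Sum>n\<in>{N..<2*N}. (cmod (\<beta> n))\<^sup>2) = (\<Sum>n\<in>{2^j..<2 * 2^j}. (cmod (b n))\<^sup>2)"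
          unfolding N_def \<beta>_def by (simp add: norm_mult)
        have "2 * K * real N powr s \<le> (real N)\<^sup>2 * sqrt (real N) * (\<Sum>n\<in>{2^j..<2 * 2^j}. (cmod (b n))\<^sup>2) / (800 * B)"
        proof -
          have "2 * K * real N powr s = real N powr 2 * real N powr (1/2) * real N powr (1 - 2 * q - d) / (800 * B)"
          proof -
            have "real N powr 2 * real N powr (1/2) * real N powr (1 - 2 * q - d) / real N powr (1/2 + d - q) = real N powr s"
              unfolding powr_add[symmetric] powr_diff[symmetric] by (rule arg_cong[where f = "\<lambda>x. real N powr x"]) (simp add: s_def)
            note this[symmetric]
            moreover have "2 * (1 / (1600 * c)) * (y / x) = y / (800 * (c * x))" for c x y :: real by simp
            ultimately show ?thesis unfolding B_def K_def by (simp only:)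
          qed
          also have "\<dots> \<le> (real N)\<^sup>2 * sqrt (real N) * (\<Sum>n\<in>{2^j..<2 * 2^j}. (cmod (b n))\<^sup>2) / (800 * B)"
            using j(2) Bp N1 by (intro divide_right_mono mult_mono) (auto simp: N2[symmetric] powr_half_sqrt)
          finally show ?thesis .
        qed
        then have "2 * K * real N powr s \<le> real (covering_number ?g1 (1 / real N)) + real (covering_number ?g2 (1 / real N))"
          using lb unfolding \<beta>_b A1(3) A2(3) by linarith
        then show ?thesis using j(1) unfolding N2 by (intro exI[of _ j]) simp
      qed
      \<comment> \<open>Which graph needs many boxes may change with the scale. If both dimensions
        were below s, both counts would be below K \<epsilon>^(-s) at all small scales, against the
        bound 2 K \<epsilon>^(-s) for their sum.\<close>
      have "ereal s \<le> fractal_dim ?g1 \<or> ereal s \<le> fractal_dim ?g2"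
      proof (rule ccontr)
        assume neg: "\<not> ?thesis"
        have "\<exists>\<delta>>0. \<forall>\<epsilon>. 0 < \<epsilon> \<and> \<epsilon> < \<delta> \<longrightarrow> real (covering_number E \<epsilon>) < K * (1 / \<epsilon>) powr s" if "\<not> ereal s \<le> fractal_dim E" for E :: "((real ^ 3) \<times> real) set"
        proof (rule ccontr)
          assume *: "\<not> ?thesis"
          have "ereal s \<le> fractal_dim E" by (rule fractal_dim_ge[OF K]) (use * in \<open>meson not_le\<close>)
          then show False using that by simp
        qed
        then obtain \<delta>1 \<delta>2 where \<delta>: "\<delta>1 > 0" "\<And>\<epsilon>. 0 < \<epsilon> \<Longrightarrow> \<epsilon> < \<delta>1 \<Longrightarrow> real (covering_number ?g1 \<epsilon>) < K * (1 / \<epsilon>) powr s"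
          "\<delta>2 > 0" "\<And>\<epsilon>. 0 < \<epsilon> \<Longrightarrow> \<epsilon> < \<delta>2 \<Longrightarrow> real (covering_number ?g2 \<epsilon>) < K * (1 / \<epsilon>) powr s"
          using neg by (metis (no_types, lifting))
        obtain j0 where j0: "(1 / 2) ^ j0 < min \<delta>1 \<delta>2" using \<delta>(1,3) real_arch_pow_inv[of "min \<delta>1 \<delta>2" "1 / 2"] by auto
        obtain j where j: "j \<ge> j0" "2 * K * (1 / (1 / 2 ^ j)) powr s \<le> real (covering_number ?g1 (1 / 2 ^ j)) + real (covering_number ?g2 (1 / 2 ^ j))"
          using cover by blast
        have "(1 / 2 ^ j :: real) \<le> (1 / 2) ^ j0" using power_decreasing[OF j(1), of "1 / 2 :: real"] by (simp add: power_one_over)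
        then have "1 / 2 ^ j < \<delta>1" "1 / 2 ^ j < \<delta>2" using j0 by auto
        then show False using \<delta>(2)[of "1 / 2 ^ j"] \<delta>(4)[of "1 / 2 ^ j"] j(2) by simp
      qed
      then show ?thesis unfolding graph_dim_def s_def by (auto simp: le_max_iff_disj)
    qed
    fix e :: real assume e: "e > 0"
    define d where "d = min (e / 2) d0"
    have "ereal (3 - q - 2 * d) \<le> graph_dim v" by (rule main) (use e d0 in \<open>auto simp: d_def\<close>)
    then have "ereal (3 - q - 2 * d) + ereal e \<le> graph_dim v + ereal e" by (rule add_right_mono)
    moreover have "ereal (3 - q) \<le> ereal (3 - q - 2 * d) + ereal e" by (simp add: d_def)
    ultimately show "ereal (3 - q) \<le> graph_dim v + ereal e" by (rule order_trans[rotated])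
  qed
  show thesis using that[OF ver upper] lower by blast
qed

theorem theorem3p8:
  fixes a :: "nat \<Rightarrow> complex" and f :: "real ^ 3 \<Rightarrow> complex"
    and u :: "real \<Rightarrow> real ^ 3 \<Rightarrow> complex" and p C :: real
  assumes "3 / 4 < p" and "p < 5 / 4"
    and "\<And>n. n \<ge> 1 \<Longrightarrow> cmod (a n) \<le> C / real n powr p"
    and "\<And>n. n \<ge> 1 \<Longrightarrow> cmod (a n - a (n - 1)) \<le> C / real n powr (p + 1)"
    and "f \<in> sphere_L2"
    and "(\<lambda>N. sphere_L2_norm (\<lambda>x. f x - (\<Sum>n\<le>N. a n * gaussian_beam n x))) \<longlonglongrightarrow> 0"
    and "schroedinger_solution f u"
  shows "(AE t in lborel. \<exists>v. continuous_version (u t) v \<and> graph_dim v \<le> ereal (15 / 4 - p)) \<and>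
         ((\<forall>\<epsilon>>0. f \<notin> sphere_sobolev (p - 1 / 2 + \<epsilon>)) \<longrightarrow>
            (AE t in lborel. \<exists>v. continuous_version (u t) v \<and> graph_dim v \<ge> ereal (max (13 / 4 - p) 2)))"
proof -
  define b where "b = (\<lambda>n. a n * complex_of_real (beam_coeff n))"
  define q where "q = p - 1 / 4"
  have q: "1 / 2 < q" "q < 1" using assms(1,2) by (auto simp: q_def)
  have C: "0 \<le> 3 * C" using order_trans[OF norm_ge_zero assms(3)[of 1]] by simp
  have p: "1 / 4 < p" using assms(1) by simp
  have b1: "cmod (b n) \<le> 3 * C * real n powr (- q)" if "n \<ge> 1" for n
    unfolding b_def q_def by (rule beam_coefficient_bound[OF p assms(3,4) that])
  have b2: "cmod (b (Suc n) - b n) \<le> 3 * C * real n powr (- q - 1)" if "n \<ge> 1" for n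
    unfolding b_def q_def by (rule beam_coefficient_diff_bound[OF p assms(3,4) that])
  have u: "u t \<in> sphere_L2" for t using assms(7) by (simp add: schroedinger_solution_def)
  have m: "(\<integral>x. u t x * mon k l n x \<partial>sphere_measure) = wave_moment b t k l n" for t k l n
    unfolding b_def by (rule schroedinger_moments[OF assms(5-7)])
  \<comment> \<open>The null set is that of the Weyl sums for both bounds; the lower bound is kept
    conditional, its hypothesis being independent of t.\<close>
  have *: "AE t in lborel. \<exists>v. continuous_version (u t) v \<and> graph_dim v \<le> ereal (7 / 2 - q) \<and>
     ((\<forall>\<eta> j0. 0 < \<eta> \<longrightarrow> (\<exists>j\<ge>j0. (2 ^ j) powr (1 - 2 * q - \<eta>) \<le> (\<Sum>n\<in>{2^j..<2 * 2^j}. (cmod (b n))\<^sup>2))) \<longrightarrow> ereal (3 - q) \<le> graph_dim v)"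
    using AE_weyl_sum_bound
  proof eventually_elim
    case (elim t)
    show ?case
      by (rule graph_dim_series_bounds[OF q C b1 b2 elim u m]) blast+
  qed
  have "ereal (7 / 2 - q) = ereal (15 / 4 - p)" by (simp add: q_def)
  \<comment> \<open>As p < 5/4, the first entry of the maximum exceeds 2.\<close>
  moreover have "ereal (3 - q) = ereal (max (13 / 4 - p) 2)" using assms(2) by (simp add: q_def max_def)
  moreover have "\<exists>j\<ge>j0. (2 ^ j) powr (1 - 2 * q - \<eta>) \<le> (\<Sum>n\<in>{2^j..<2 * 2^j}. (cmod (b n))\<^sup>2)"
    if "\<forall>\<epsilon>>0. f \<notin> sphere_sobolev (p - 1 / 2 + \<epsilon>)" "0 < \<eta>" for \<eta> :: real and j0 :: nat
  proof -
    have "f \<notin> sphere_sobolev (p - 1 / 2 + \<eta> / 4)" using that by simp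
    then show ?thesis
      unfolding sphere_sobolev_beam_expansion[OF assms(5,6)] b_def q_def
      by (rule large_dyadic_energy[OF assms(1) that(2)])
  qed
  ultimately show ?thesis
    using * by (auto elim!: eventually_mono)
qed

end
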